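(* There are homogeneous functions $p_1,p_2,q,r,s,t$ in $\mathcal B(G_2,\mathrm{SL}_3)$ of degrees $$p_1:(\omega_1;\varpi_2),\ p_2:(\omega_2;\varpi_1+\varpi_2),\ q:(\omega_1;\varpi_1),\ r:(\omega_2;\varpi_2),\ s:(\omega_1;0),\ t:(\omega_2;\varpi_1)$$ such that $$\mathcal B(G_2,\mathrm{SL}_3)=\mathbb C[p_1,p_2,q,r,s,t]/(qr-p_1t-p_2s)=\mathcal U_{\mathrm{LP}}(q;p_1,p_2,s,t).$$ Here the seed has the single mutable variable $q$ with exchange polynomial $E_q=p_1t+p_2s$, its mutation is $q'=r$, and the frozen coefficients $p_1,p_2,s,t$ are polynomial (not inverted).
   Context: For connected complex reductive $K\subset G$ with compatible maximal tori $T_K\subset T_G$ and maximal unipotent subgroups $U_K\subset U_G$, and $U_G^-$ opposite to $U_G$, the branching algebra is $\mathcal B(G,K)=\mathbb C[G]^{U_G^-\times U_K}$, the regular functions with $f(ugv)=f(g)$ for $u\in U_G^-$, $v\in U_K$. It is graded: $f$ has degree $(\lambda;\mu)$ if $f(tgs)=\lambda(t)\mu(s)f(g)$ for $t\in T_G$, $s\in T_K$, and $\mathcal B(G,K)_{\lambda,\mu}\simeq\mathrm{Hom}_K(V_K(\mu),V_G(\lambda))$. Here $G$ has type $G_2$ with simple roots $\alpha_1$ (short), $\alpha_2$ (long) and fundamental weights $\omega_1,\omega_2$; $K=\mathrm{SL}_3$ is the long-root subgroup with simple roots $\alpha_2$, $3\alpha_1+\alpha_2$ (in this order) and fundamental weights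 $\varpi_1,\varpi_2$, so that $\omega_1$ restricts to $\varpi_2$ and $\omega_2$ to $\varpi_1+\varpi_2$. For a seed with a single mutable variable $q$ and frozen variables $\mathbf f$, with irreducible exchange polynomial $E_q\in S=\mathbb C[\mathbf f]$, the mutation replaces $q$ by $q'=E_q/q$, and the upper Laurent phenomenon algebra is $\mathcal U_{\mathrm{LP}}(q;\mathbf f)=S[q^{\pm1}]\cap S[(q')^{\pm1}]$. *)

theory Defs
  imports
    "HOL-Analysis.Analysis"
    "HOL-Algebra.QuotRing"
    "HOL-Algebra.Algebraic_Closure_Type"
    "HOL-Computational_Algebra.Computational_Algebra"
    "HOL-Library.Poly_Mapping"
begin

(* clashes with the notation for vector components *)
no_notation fps_nth (infixl \<open>$\<close> 75)

section \<open>Complex polynomials in an arbitrary set of variables\<close>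

text \<open>The polynomial ring with variables indexed by the type \<^typ>\<open>'v\<close> is the monoid algebra of
  the exponent vectors.\<close>

type_synonym 'v cpoly = "('v \<Rightarrow>\<^sub>0 nat) \<Rightarrow>\<^sub>0 complex"

definition Var :: "'v \<Rightarrow> 'v cpoly"
  where "Var v = Poly_Mapping.single (Poly_Mapping.single v 1) 1"

definition Const :: "complex \<Rightarrow> 'v cpoly"
  where "Const c = Poly_Mapping.single 0 c"

definition eval_cpoly :: "('v \<Rightarrow> complex) \<Rightarrow> 'v cpoly \<Rightarrow> complex"
  where "eval_cpoly x P =
    (\<Sum>m\<in>Poly_Mapping.keys P. Poly_Mapping.lookup P m *
       (\<Prod>v\<in>Poly_Mapping.keys m. x v ^ Poly_Mapping.lookup m v))"


section \<open>Branching algebras\<close>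

text \<open>For a Zariski closed subgroup \<open>G\<close> of \<open>GL\<^sub>n\<close> the regular functions are the restrictions
  to \<open>G\<close> of the polynomials in the matrix entries and in the inverse of the determinant.
  Functions on \<open>G\<close> are extensional, i.e. have a fixed dummy value outside \<open>G\<close>, so that
  equality of HOL functions is equality on \<open>G\<close>.\<close>

definition regular_functions ::
    "(complex^'n^'n) set \<Rightarrow> (complex^'n^'n \<Rightarrow> complex) set"
  where "regular_functions G =
    {f \<in> extensional G. \<exists>(P :: ('n \<times> 'n) cpoly) k.
       \<forall>g\<in>G. f g = eval_cpoly (\<lambda>(i, j). g $ i $ j) P / det g ^ k}"

text \<open>\<open>branching_algebra G V U\<close> is the ring of regular functions on \<open>G\<close> that are invariant under
  left translation by \<open>V\<close> (in the application: the maximal unipotent subgroup of \<open>G\<close> opposite to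
  the chosen one) and under right translation by \<open>U\<close> (a maximal unipotent subgroup of \<open>K\<close>).\<close>

definition branching_algebra ::
    "(complex^'n^'n) set \<Rightarrow> (complex^'n^'n) set \<Rightarrow> (complex^'n^'n) set
      \<Rightarrow> (complex^'n^'n \<Rightarrow> complex) ring"
  where "branching_algebra G V U =
    \<lparr> carrier = {f \<in> regular_functions G. \<forall>u\<in>V. \<forall>v\<in>U. \<forall>g\<in>G. f (u ** g ** v) = f g},
      monoid.mult = (\<lambda>f h. \<lambda>g\<in>G. f g * h g),
      one = (\<lambda>g\<in>G. 1),
      ring.zero = (\<lambda>g\<in>G. 0),
      add = (\<lambda>f h. \<lambda>g\<in>G. f g + h g) \<rparr>"

text \<open>Weights are given multiplicatively, as characters of the tori \<open>T\<close> (of \<open>G\<close>) and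
  \<open>S\<close> (of \<open>K\<close>).\<close>

definition has_bidegree ::
    "(complex^'n^'n) set \<Rightarrow> (complex^'n^'n) set \<Rightarrow> (complex^'n^'n) set
      \<Rightarrow> (complex^'n^'n \<Rightarrow> complex)
      \<Rightarrow> (complex^'n^'n \<Rightarrow> complex) \<Rightarrow> (complex^'n^'n \<Rightarrow> complex) \<Rightarrow> bool"
  where "has_bidegree G T S f \<kappa> \<mu> \<longleftrightarrow>
    (\<forall>t\<in>T. \<forall>s\<in>S. \<forall>g\<in>G. f (t ** g ** s) = \<kappa> t * \<mu> s * f g)"

definition subst_functions ::
    "(complex^'n^'n) set \<Rightarrow> ('v \<Rightarrow> complex^'n^'n \<Rightarrow> complex) \<Rightarrow> 'v cpoly
      \<Rightarrow> complex^'n^'n \<Rightarrow> complex"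
  where "subst_functions G x P = (\<lambda>g\<in>G. eval_cpoly (\<lambda>v. x v g) P)"


section \<open>The group \<open>G\<^sub>2\<close> and its subgroup \<open>SL\<^sub>3\<close>\<close>

text \<open>\<open>G\<^sub>2\<close> is realised on its seven-dimensional representation, as the stabiliser in \<open>SL\<^sub>7\<close> of
  a generic alternating three-form (the form \<open>(x, y, z) \<mapsto> \<langle>xy, z\<rangle>\<close> on the trace zero octonions).
  The basis vectors \<open>e\<^sub>0, \<dots>, e\<^sub>6\<close>, indexed by the type \<^typ>\<open>7\<close> whose elements are ordered
  \<open>0 < 1 < \<dots> < 6\<close>, are weight vectors, of weights
  \<open>2\<alpha>\<^sub>1 + \<alpha>\<^sub>2, \<alpha>\<^sub>1 + \<alpha>\<^sub>2, \<alpha>\<^sub>1, 0, -\<alpha>\<^sub>1, -\<alpha>\<^sub>1 - \<alpha>\<^sub>2, -2\<alpha>\<^sub>1 - \<alpha>\<^sub>2\<close>.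
  Under \<open>SL\<^sub>3\<close> the space decomposes as the line of \<open>e\<^sub>3\<close>, the standard representation with basis
  \<open>e\<^sub>1, e\<^sub>2, e\<^sub>6\<close> and its dual with dual basis \<open>e\<^sub>5, e\<^sub>4, e\<^sub>0\<close>.\<close>

definition wedge3 :: "'n::finite \<Rightarrow> 'n \<Rightarrow> 'n \<Rightarrow> complex^'n \<Rightarrow> complex^'n \<Rightarrow> complex^'n \<Rightarrow> complex"
  where "wedge3 i j k x y z =
    det (vector [vector [x $ i, x $ j, x $ k],
                 vector [y $ i, y $ j, y $ k],
                 vector [z $ i, z $ j, z $ k]] :: complex^3^3)"

definition G2_form :: "complex^7 \<Rightarrow> complex^7 \<Rightarrow> complex^7 \<Rightarrow> complex"
  where "G2_form x y z =
    wedge3 3 1 5 x y z + wedge3 3 2 4 x y z + wedge3 3 6 0 x y z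
      + wedge3 1 2 6 x y z + wedge3 5 4 0 x y z"

definition G2 :: "(complex^7^7) set"
  where "G2 = {g. det g = 1 \<and>
    (\<forall>x y z. G2_form (g *v x) (g *v y) (g *v z) = G2_form x y z)}"

text \<open>The order of the basis is compatible with the choice of positive roots: the simple root
  vectors of \<open>\<alpha>\<^sub>1\<close> and \<open>\<alpha>\<^sub>2\<close> are strictly upper triangular. Hence the diagonal, upper
  unitriangular and lower unitriangular matrices cut out of \<open>G\<^sub>2\<close> a maximal torus and a pair of
  opposite maximal unipotent subgroups.\<close>

definition diagonal_matrices :: "('a::zero^'n^'n) set"
  where "diagonal_matrices = {g. \<forall>i j. i \<noteq> j \<longrightarrow> g $ i $ j = 0}"

definition upper_unitriangular :: "('a::zero_neq_one^'n::{finite,linorder}^'n::{finite,linorder}) set"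
  where "upper_unitriangular = {g. (\<forall>i. g $ i $ i = 1) \<and> (\<forall>i j. j < i \<longrightarrow> g $ i $ j = 0)}"

definition lower_unitriangular :: "('a::zero_neq_one^'n::{finite,linorder}^'n::{finite,linorder}) set"
  where "lower_unitriangular = {g. (\<forall>i. g $ i $ i = 1) \<and> (\<forall>i j. i < j \<longrightarrow> g $ i $ j = 0)}"

definition T_G2 :: "(complex^7^7) set"
  where "T_G2 = G2 \<inter> diagonal_matrices"

definition U_G2 :: "(complex^7^7) set"
  where "U_G2 = G2 \<inter> upper_unitriangular"

definition U_minus_G2 :: "(complex^7^7) set"
  where "U_minus_G2 = G2 \<inter> lower_unitriangular"

text \<open>\<open>SL3_embedding A\<close> acts by \<open>A\<close> on \<open>e\<^sub>1, e\<^sub>2, e\<^sub>6\<close>, by the inverse transpose of \<open>A\<close> on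
  \<open>e\<^sub>5, e\<^sub>4, e\<^sub>0\<close>, and fixes \<open>e\<^sub>3\<close>. The roots of the image with respect to its diagonal torus are
  the differences of the weights \<open>\<alpha>\<^sub>1 + \<alpha>\<^sub>2, \<alpha>\<^sub>1, -2\<alpha>\<^sub>1 - \<alpha>\<^sub>2\<close>, i.e. the long roots; the simple ones
  are \<open>\<alpha>\<^sub>2\<close> and \<open>3\<alpha>\<^sub>1 + \<alpha>\<^sub>2\<close>, in this order.\<close>

definition std_index :: "3 \<Rightarrow> 7"
  where "std_index i = (if i = 1 then 1 else if i = 2 then 2 else 6)"

definition SL3_embedding :: "complex^3^3 \<Rightarrow> complex^7^7"
  where "SL3_embedding A = (\<chi> a b.
    (if a = 3 \<and> b = 3 then 1 else 0) +
    (\<Sum>i\<in>UNIV. \<Sum>j\<in>UNIV.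
       (if a = std_index i \<and> b = std_index j then A $ i $ j else 0) +
       (if a = 6 - std_index i \<and> b = 6 - std_index j then matrix_inv A $ j $ i else 0)))"

definition SL3 :: "(complex^7^7) set"
  where "SL3 = SL3_embedding ` {A. det A = 1}"

definition T_SL3 :: "(complex^7^7) set"
  where "T_SL3 = SL3 \<inter> T_G2"

definition U_SL3 :: "(complex^7^7) set"
  where "U_SL3 = SL3 \<inter> U_G2"

text \<open>The entry of \<open>t\<close> at position \<open>(i, i)\<close> is the weight of \<open>e\<^sub>i\<close>.\<close>

definition alpha1 :: "complex^7^7 \<Rightarrow> complex"
  where "alpha1 t = t $ 2 $ 2"

definition alpha2 :: "complex^7^7 \<Rightarrow> complex"
  where "alpha2 t = t $ 1 $ 1 / t $ 2 $ 2"

definition omega1 :: "complex^7^7 \<Rightarrow> complex"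
  where "omega1 t = alpha1 t ^ 2 * alpha2 t"

definition omega2 :: "complex^7^7 \<Rightarrow> complex"
  where "omega2 t = alpha1 t ^ 3 * alpha2 t ^ 2"

text \<open>The fundamental weights of \<open>SL\<^sub>3\<close>: the first diagonal entry, respectively the product of the
  first two diagonal entries, of the underlying three by three matrix.\<close>

definition varpi1 :: "complex^7^7 \<Rightarrow> complex"
  where "varpi1 s = s $ 1 $ 1"

definition varpi2 :: "complex^7^7 \<Rightarrow> complex"
  where "varpi2 s = s $ 1 $ 1 * s $ 2 $ 2"

definition B_G2_SL3 :: "(complex^7^7 \<Rightarrow> complex) ring"
  where "B_G2_SL3 = branching_algebra G2 U_minus_G2 U_SL3"

abbreviation has_degree ::
    "(complex^7^7 \<Rightarrow> complex) \<Rightarrow> (complex^7^7 \<Rightarrow> complex) \<Rightarrow> (complex^7^7 \<Rightarrow> complex) \<Rightarrow> bool"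
  where "has_degree f \<kappa> \<mu> \<equiv> has_bidegree G2 T_G2 T_SL3 f \<kappa> \<mu>"

lemma omega1_restrict: "s \<in> T_SL3 \<Longrightarrow> omega1 s = varpi2 s"
  and omega2_restrict: "s \<in> T_SL3 \<Longrightarrow> omega2 s = varpi1 s * varpi2 s"
  by (auto simp: omega1_def omega2_def varpi1_def varpi2_def alpha1_def alpha2_def
        power2_eq_square power3_eq_cube)


section \<open>Upper Laurent phenomenon algebras of rank one\<close>

text \<open>The type \<^typ>\<open>'s\<close> plays the role of the coefficient ring \<open>S\<close>. The ambient field is the
  field of rational functions in the mutable variable \<open>q\<close> over \<open>S\<close>, and \<open>laurent_ring x\<close> is
  \<open>S[x, 1/x]\<close>.\<close>

definition lp_coeff :: "'s::idom \<Rightarrow> 's poly fract"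
  where "lp_coeff c = to_fract [:c:]"

definition lp_q :: "'s::idom poly fract"
  where "lp_q = to_fract [:0, 1:]"

definition lp_q' :: "'s::idom \<Rightarrow> 's poly fract"
  where "lp_q' E = lp_coeff E / lp_q"

definition laurent_ring :: "'s::idom poly fract \<Rightarrow> 's poly fract set"
  where "laurent_ring x = {poly (map_poly lp_coeff f) x / x ^ n | f n. True}"

definition upper_LP_algebra :: "'s::idom \<Rightarrow> 's poly fract ring"
  where "upper_LP_algebra E =
    ring_of_type_algebra \<lparr> carrier := laurent_ring lp_q \<inter> laurent_ring (lp_q' E) \<rparr>"


datatype gen = X_p1 | X_p2 | X_q | X_r | X_s | X_t

datatype frozen = F_p1 | F_p2 | F_s | F_t

text \<open>The linear order on the variables only serves to make \<^typ>\<open>frozen cpoly\<close> an instance of the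
  class of integral domains.\<close>

fun frozen_rank :: "frozen \<Rightarrow> nat" where
  "frozen_rank F_p1 = 0"
| "frozen_rank F_p2 = 1"
| "frozen_rank F_s = 2"
| "frozen_rank F_t = 3"

instantiation frozen :: linorder
begin

definition less_eq_frozen :: "frozen \<Rightarrow> frozen \<Rightarrow> bool"
  where "less_eq_frozen x y \<longleftrightarrow> frozen_rank x \<le> frozen_rank y"

definition less_frozen :: "frozen \<Rightarrow> frozen \<Rightarrow> bool"
  where "less_frozen x y \<longleftrightarrow> frozen_rank x < frozen_rank y"

instance
proof
  fix x y :: frozen
  assume "x \<le> y" "y \<le> x"
  then show "x = y"
    by (cases x; cases y) (auto simp: less_eq_frozen_def)
qed (auto simp: less_eq_frozen_def less_frozen_def)

end

definition exchange_polynomial :: "frozen cpoly"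
  where "exchange_polynomial = Var F_p1 * Var F_t + Var F_p2 * Var F_s"

end

theory Submission
  imports Defs
begin

text \<open>Write \<open>g\<^sub>i\<^sub>j\<close> for the entries of \<open>g \<in> G\<^sub>2\<close> and \<open>\<Delta>\<^sub>i\<^sub>j\<close> for the minors of its first two rows (the
  rows \<open>0\<close> and \<open>1\<close>). The row \<open>0\<close> and the minors \<open>\<Delta>\<^sub>i\<^sub>j\<close> are invariant under the lower unipotent
  subgroup, and the columns \<open>0, 1, 3\<close> are fixed by the upper unipotent subgroup of \<open>SL\<^sub>3\<close>. This gives
  the generators
  \<open>p\<^sub>1 = g\<^sub>0\<^sub>0\<close>, \<open>q = g\<^sub>0\<^sub>1\<close>, \<open>s = g\<^sub>0\<^sub>3\<close>, \<open>p\<^sub>2 = \<Delta>\<^sub>0\<^sub>1\<close>, \<open>t = \<Delta>\<^sub>1\<^sub>3\<close>, \<open>r = \<Delta>\<^sub>0\<^sub>3\<close>, and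
  \<open>q r = p\<^sub>1 t + p\<^sub>2 s\<close> is the vanishing of a determinant with two equal rows.

  Modulo this relation every polynomial in the six generators has a unique normal form
  \<open>A(q) + r B(r)\<close>, where \<open>A\<close> and \<open>B\<close> have coefficients in \<open>S = \<complex>[p\<^sub>1, p\<^sub>2, s, t]\<close>
  (\<open>exists_normal_form\<close>, \<open>normal_form_unique\<close>). Substituting \<open>r = E/q\<close> identifies the quotient ring with
  \<open>S[q\<^sup>\<plusminus>] \<inter> S[r\<^sup>\<plusminus>]\<close>: comparison of coefficients shows that the coefficient of \<open>q\<^sup>-\<^sup>k\<close> of an element of the
  intersection is divisible by \<open>E\<^sup>k\<close> (\<open>to_LP_eq_0_iff\<close>, \<open>to_LP_range\<close>).

  It remains to see that the six functions generate the branching algebra and satisfy no other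
  relation. Both rest on two explicit maps from open parts of the quadric \<open>q r = p\<^sub>1 t + p\<^sub>2 s\<close> to \<open>G\<^sub>2\<close>
  along which the generators are the coordinates: \<open>section1\<close> is defined for \<open>p\<^sub>1 p\<^sub>2 \<noteq> 0\<close>, and \<open>section2\<close>
  for \<open>q r t \<noteq> 0\<close>. The existence of \<open>section1\<close> excludes further relations (\<open>eval_gens_eq_iff\<close>).
  For generation, two elements of \<open>G\<^sub>2\<close> with the same generators and \<open>p\<^sub>1 q \<noteq> 0\<close> lie in the same double
  coset of the two unipotent groups (\<open>separation\<close>). Hence an element \<open>f\<close> of the branching algebra is
  determined, where \<open>p\<^sub>1 p\<^sub>2 q \<noteq> 0\<close>, by its restriction to \<open>section1\<close>, and \<open>f (p\<^sub>1 p\<^sub>2)\<^sup>k\<close> is there a polynomial in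
  the generators. Its restriction to \<open>section2\<close> has no pole along \<open>p\<^sub>1 p\<^sub>2 = 0\<close>; as \<open>p\<^sub>1\<close> and \<open>p\<^sub>2\<close> are prime
  in \<open>S\<close> and do not divide \<open>E t\<close>, the factor \<open>(p\<^sub>1 p\<^sub>2)\<^sup>k\<close> can be cancelled in the normal form
  (\<open>generic_generation\<close>). Root subgroups connect every element of \<open>G\<^sub>2\<close> with the locus
  \<open>p\<^sub>1 p\<^sub>2 q \<noteq> 0\<close>, so that an identity on this locus holds on \<open>G\<^sub>2\<close> (\<open>vanishing_on_G2\<close>).

  The separation of orbits needs the quadratic equations between the first two rows of an element of
  \<open>G\<^sub>2\<close>. They come from the symmetric bilinear form \<open>bil\<close>, whose invariance (\<open>G2_bil_invariant\<close>) has to be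
  derived from that of the three-form.\<close>

section \<open>Evaluation of polynomials\<close>

text \<open>Homomorphisms of commutative rings with one, given by plain functions on types.\<close>
locale unital_hom =
  fixes h :: "'a::comm_ring_1 \<Rightarrow> 'b::comm_ring_1"
  assumes add: "h (x + y) = h x + h y" and mult: "h (x * y) = h x * h y" and one: "h 1 = 1"
begin

lemma zero: "h 0 = 0"
  using add[of 0 0] by simp

lemma minus: "h (x - y) = h x - h y"
  using add[of "x - y" y] by (simp add: algebra_simps)

lemma sum: "h (sum f A) = (\<Sum>a\<in>A. h (f a))"
  by (induct A rule: infinite_finite_induct) (simp_all add: zero add)

lemma power: "h (x ^ n) = h x ^ n"
  by (induct n) (simp_all add: one mult)

text \<open>\<open>peval z A\<close> is the value at \<open>z\<close> of the polynomial obtained from \<open>A\<close> by applying the homomorphism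
  to the coefficients.\<close>

definition peval :: "'b \<Rightarrow> 'a poly \<Rightarrow> 'b"
  where "peval z A = poly (map_poly h A) z"

lemma peval_0 [simp]: "peval z 0 = 0"
  by (simp add: peval_def)

lemma peval_pCons: "peval z (pCons a A) = h a + z * peval z A"
  by (simp add: peval_def map_poly_pCons zero)

lemma peval_add: "peval z (A + B) = peval z A + peval z B"
  by (induct A B rule: poly_induct2) (simp_all add: peval_pCons add algebra_simps)

lemma peval_smult: "peval z (Polynomial.smult c A) = h c * peval z A"
  by (induct A) (simp_all add: peval_pCons mult algebra_simps)

lemma peval_mult: "peval z (A * B) = peval z A * peval z B"
  by (induct A) (simp_all add: peval_pCons peval_add peval_smult zero algebra_simps)

lemma peval_1: "peval z 1 = 1"
  by (simp add: one_pCons peval_pCons one)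

lemma peval_hom: "unital_hom (peval z)"
  by standard (simp_all add: peval_add peval_mult peval_1)

lemma peval_monom: "peval z (Polynomial.monom c n) = h c * z ^ n"
  by (induct n) (simp_all add: monom_0 monom_Suc peval_pCons zero)

lemma peval_altdef: "Polynomial.degree A \<le> n \<Longrightarrow> peval z A = (\<Sum>k\<le>n. h (Polynomial.coeff A k) * z ^ k)"
proof -
  assume "Polynomial.degree A \<le> n"
  hence "A = (\<Sum>k\<le>n. Polynomial.monom (Polynomial.coeff A k) k)"
    by (simp add: poly_as_sum_of_monoms')
  hence "peval z A = peval z (\<Sum>k\<le>n. Polynomial.monom (Polynomial.coeff A k) k)" by simp
  also have "\<dots> = (\<Sum>k\<le>n. h (Polynomial.coeff A k) * z ^ k)"
    by (simp add: unital_hom.sum[OF peval_hom] peval_monom)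
  finally show ?thesis .
qed

end

lemma unital_hom_id: "unital_hom (\<lambda>x. x)"
  by standard simp_all

lemma unital_hom_comp: "unital_hom f \<Longrightarrow> unital_hom g \<Longrightarrow> unital_hom (\<lambda>x. g (f x))"
  by (simp add: unital_hom_def)

lemma peval_comp:
  assumes "unital_hom f" "unital_hom g"
  shows "g (unital_hom.peval f z A) = unital_hom.peval (\<lambda>x. g (f x)) (g z) A"
proof -
  interpret f: unital_hom f by fact
  interpret g: unital_hom g by fact
  interpret gf: unital_hom "\<lambda>x. g (f x)" by (rule unital_hom_comp) fact+
  show ?thesis
    by (induct A) (simp_all add: f.peval_pCons gf.peval_pCons g.zero g.add g.mult)
qed

text \<open>The value of the monomial with exponent vector \<open>m\<close> at the point \<open>y\<close> of a commutative ring.\<close>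
definition mon :: "('v \<Rightarrow> 'b::comm_ring_1) \<Rightarrow> ('v \<Rightarrow>\<^sub>0 nat) \<Rightarrow> 'b"
  where "mon y m = (\<Prod>v\<in>Poly_Mapping.keys m. y v ^ Poly_Mapping.lookup m v)"

lemma mon_superset:
  assumes "finite A" "Poly_Mapping.keys m \<subseteq> A"
  shows "mon y m = (\<Prod>v\<in>A. y v ^ Poly_Mapping.lookup m v)"
  unfolding mon_def using assms by (intro prod.mono_neutral_left) (auto simp: in_keys_iff)

lemma mon_add: "mon y (m + m') = mon y m * mon y m'"
proof -
  let ?A = "Poly_Mapping.keys m \<union> Poly_Mapping.keys m'"
  have "Poly_Mapping.keys (m + m') \<subseteq> ?A" by (rule Poly_Mapping.keys_add)
  thus ?thesis
    by (simp add: mon_superset[of ?A] lookup_add power_add prod.distrib)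
qed

lemma mon_0 [simp]: "mon y 0 = 1"
  by (simp add: mon_def)

lemma mon_single: "mon y (Poly_Mapping.single v n) = y v ^ n"
  by (simp add: mon_def)

lemma poly_mapping_eq_sum_single:
  "P = (\<Sum>m\<in>Poly_Mapping.keys P. Poly_Mapping.single m (Poly_Mapping.lookup P m))"
  by (rule poly_mapping_eqI)
    (auto simp: lookup_sum lookup_single when_def in_keys_iff sum.delta)

text \<open>Evaluation of polynomials at points of an arbitrary commutative ring, the coefficients being mapped
  by \<open>h\<close>.\<close>
definition insertion :: "(complex \<Rightarrow> 'b::comm_ring_1) \<Rightarrow> ('v \<Rightarrow> 'b) \<Rightarrow> 'v cpoly \<Rightarrow> 'b"
  where "insertion h y P = (\<Sum>m\<in>Poly_Mapping.keys P. h (Poly_Mapping.lookup P m) * mon y m)"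

lemma eval_cpoly_eq_insertion: "eval_cpoly x P = insertion (\<lambda>c. c) x P"
  by (simp add: eval_cpoly_def insertion_def mon_def)

lemma insertion_superset:
  assumes "h 0 = 0" "finite A" "Poly_Mapping.keys P \<subseteq> A"
  shows "insertion h y P = (\<Sum>m\<in>A. h (Poly_Mapping.lookup P m) * mon y m)"
  unfolding insertion_def using assms by (intro sum.mono_neutral_left) (auto simp: in_keys_iff)

lemma insertion_single: "h 0 = 0 \<Longrightarrow> insertion h y (Poly_Mapping.single m c) = h c * mon y m"
  by (simp add: insertion_def)

lemma insertion_add:
  assumes "unital_hom h"
  shows "insertion h y (P + Q) = insertion h y P + insertion h y Q"
proof -
  interpret unital_hom h by fact
  let ?A = "Poly_Mapping.keys P \<union> Poly_Mapping.keys Q"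
  have "Poly_Mapping.keys (P + Q) \<subseteq> ?A" by (rule Poly_Mapping.keys_add)
  thus ?thesis
    by (simp add: insertion_superset[of h ?A] zero lookup_add add sum.distrib algebra_simps)
qed

lemma insertion_hom:
  assumes "unital_hom h"
  shows "unital_hom (insertion h y)"
proof
  interpret unital_hom h by fact
  note [simp] = insertion_single[of h, OF zero]
  show add': "insertion h y (P + Q) = insertion h y P + insertion h y Q" for P Q :: "'b cpoly"
    by (rule insertion_add) fact
  show "insertion h y 1 = 1"
    using insertion_single[of h y 0 1, OF zero] by (simp add: one)
  have sum': "insertion h y (sum f A) = (\<Sum>a\<in>A. insertion h y (f a))" for f :: "'c \<Rightarrow> 'b cpoly" and A
    by (induct A rule: infinite_finite_induct) (simp_all add: add', simp_all add: insertion_def)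
  show "insertion h y (P * Q) = insertion h y P * insertion h y Q" for P Q :: "'b cpoly"
  proof -
    have "P * Q = (\<Sum>m\<in>Poly_Mapping.keys P. \<Sum>n\<in>Poly_Mapping.keys Q.
        Poly_Mapping.single (m + n) (Poly_Mapping.lookup P m * Poly_Mapping.lookup Q n))"
      by (subst (1) poly_mapping_eq_sum_single[of P], subst (1) poly_mapping_eq_sum_single[of Q])
        (simp add: sum_product mult_single)
    hence "insertion h y (P * Q) = (\<Sum>m\<in>Poly_Mapping.keys P. \<Sum>n\<in>Poly_Mapping.keys Q.
        h (Poly_Mapping.lookup P m * Poly_Mapping.lookup Q n) * mon y (m + n))"
      by (simp add: sum')
    thus ?thesis
      by (simp add: insertion_def sum_product mon_add mult algebra_simps)
  qed
qed

lemma insertion_Var: "unital_hom h \<Longrightarrow> insertion h y (Var v) = y v"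
  by (simp add: Var_def insertion_single unital_hom.zero unital_hom.one mon_single)

lemma insertion_Const: "unital_hom h \<Longrightarrow> insertion h y (Const c) = h c"
  by (simp add: Const_def insertion_single unital_hom.zero)

lemma Const_hom: "unital_hom Const"
  by standard (simp_all add: Const_def single_add mult_single flip: single_one)

lemma Var_power: "Var v ^ n = Poly_Mapping.single (Poly_Mapping.single v n) 1"
proof (induct n)
  case (Suc n)
  thus ?case by (simp add: Var_def mult_single flip: single_add)
qed simp

lemma single_eq_mon: "Poly_Mapping.single m 1 = (mon Var m :: 'v cpoly)"
proof -
  have "(\<Prod>v\<in>A. Var v ^ f v :: 'v cpoly) = Poly_Mapping.single (\<Sum>v\<in>A. Poly_Mapping.single v (f v)) 1"
    if "finite A" for A f
    using that by induct (simp_all add: Var_power mult_single)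
  thus ?thesis
    by (simp add: mon_def flip: poly_mapping_eq_sum_single)
qed

text \<open>Polynomials are generated by the constants under addition and multiplication with variables. Two
  ring homomorphisms that agree on constants and variables are compared by means of this rule.\<close>
lemma cpoly_induct [case_names Const add Var_mult]:
  fixes P :: "'v cpoly"
  assumes C: "\<And>c. R (Const c)" and A: "\<And>P Q. R P \<Longrightarrow> R Q \<Longrightarrow> R (P + Q)"
    and V: "\<And>v P. R P \<Longrightarrow> R (Var v * P)"
  shows "R P"
proof -
  have pow: "R (Var v ^ n * Q)" if "R Q" for v n Q
    using that by (induct n) (simp_all add: V mult.assoc)
  have prod: "R ((\<Prod>v\<in>A. Var v ^ f v) * Q)" if "finite A" "R Q" for A f Q
    using that by (induct A) (simp_all add: pow mult.assoc)
  have single: "R (Poly_Mapping.single m c)" for m c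
  proof -
    have "Poly_Mapping.single m c = mon Var m * Const c"
      by (simp add: Const_def mult_single flip: single_eq_mon)
    thus ?thesis using prod[OF _ C] by (simp add: mon_def)
  qed
  have "R (\<Sum>m\<in>A. Poly_Mapping.single m (f m))" if "finite A" for A f
    using that
  proof induct
    case empty
    thus ?case using C[of 0] by (simp add: Const_def)
  qed (simp_all add: A single)
  thus ?thesis by (subst poly_mapping_eq_sum_single) simp
qed

lemma eval_cpoly_hom: "unital_hom (eval_cpoly x)"
  unfolding eval_cpoly_eq_insertion[abs_def] by (rule insertion_hom[OF unital_hom_id])

lemma eval_Var: "eval_cpoly x (Var v) = x v" and eval_Const: "eval_cpoly x (Const c) = c"
  by (simp_all add: eval_cpoly_eq_insertion insertion_Var insertion_Const unital_hom_id)

lemmas eval_cpoly_simps = unital_hom.add[OF eval_cpoly_hom] unital_hom.mult[OF eval_cpoly_hom]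
  unital_hom.one[OF eval_cpoly_hom] unital_hom.minus[OF eval_cpoly_hom] unital_hom.zero[OF eval_cpoly_hom]
  unital_hom.power[OF eval_cpoly_hom] eval_Var eval_Const

section \<open>Polynomials in the frozen variables\<close>

abbreviation (input) "E \<equiv> exchange_polynomial"

lemma UNIV_frozen: "UNIV = {F_p1, F_p2, F_s, F_t}"
proof -
  have "v \<in> {F_p1, F_p2, F_s, F_t}" for v
    by (rule frozen.exhaust[of v]) simp_all
  thus ?thesis by blast
qed

lemma finite_frozen: "finite (UNIV :: frozen set)"
  by (simp add: UNIV_frozen)

lemma eval_exchange: "eval_cpoly x E = x F_p1 * x F_t + x F_p2 * x F_s"
  by (simp add: exchange_polynomial_def eval_cpoly_simps)

text \<open>Uniqueness of digits in base \<open>N\<close>.\<close>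
lemma digit_inj:
  fixes a b N :: nat
  assumes "a < N" "a' < N" "a + N * b = a' + N * b'"
  shows "a = a' \<and> b = b'"
  using assms by (metis add.commute div_mult_self4 div_less add_0 mod_mult_self2 mod_less gr_implies_not0)

text \<open>Kronecker substitution: for \<open>N\<close> larger than all exponents, \<open>v \<mapsto> T ^ (N ^ frozen_rank v)\<close> sends distinct
  monomials of \<open>P\<close> to distinct powers of \<open>T\<close>.\<close>
lemma frozen_cpoly_eq_0:
  fixes P :: "frozen cpoly"
  assumes z: "\<And>x. eval_cpoly x P = 0"
  shows "P = 0"
proof (rule ccontr)
  assume "P \<noteq> 0"
  then obtain m0 where m0: "m0 \<in> Poly_Mapping.keys P" by (metis keys_eq_empty all_not_in_conv)
  let ?K = "Poly_Mapping.keys P" and ?l = "Poly_Mapping.lookup"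
  define N where "N = Suc (\<Sum>m\<in>?K. \<Sum>v\<in>UNIV. ?l m v)"
  have bound: "?l m v < N" if "m \<in> ?K" for m v
  proof -
    have "?l m v \<le> (\<Sum>v\<in>UNIV. ?l m v)"
      by (rule member_le_sum) (simp_all add: finite_frozen)
    also have "\<dots> \<le> (\<Sum>m\<in>?K. \<Sum>v\<in>UNIV. ?l m v)"
      using that by (intro member_le_sum) auto
    finally show ?thesis by (simp add: N_def)
  qed
  define e where "e m = ?l m F_p1 + N * (?l m F_p2 + N * (?l m F_s + N * ?l m F_t))" for m
  have inj: "m = m'" if "m \<in> ?K" "m' \<in> ?K" "e m = e m'" for m m'
  proof -
    note lt = bound[OF that(1)] bound[OF that(2)]
    have 1: "?l m F_p1 = ?l m' F_p1 \<and> ?l m F_p2 + N * (?l m F_s + N * ?l m F_t)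
        = ?l m' F_p2 + N * (?l m' F_s + N * ?l m' F_t)"
      using that(3) unfolding e_def by (rule digit_inj[OF lt])
    have 2: "?l m F_p2 = ?l m' F_p2 \<and> ?l m F_s + N * ?l m F_t = ?l m' F_s + N * ?l m' F_t"
      using conjunct2[OF 1] by (rule digit_inj[OF lt])
    have 3: "?l m F_s = ?l m' F_s \<and> N * ?l m F_t = N * ?l m' F_t"
      using digit_inj[OF lt conjunct2[OF 2]] by simp
    have "N \<noteq> 0" by (simp add: N_def)
    hence "?l m v = ?l m' v" for v
      using 1 2 3 by (cases v) simp_all
    thus ?thesis by (rule poly_mapping_eqI)
  qed
  define Q where "Q = (\<Sum>m\<in>?K. Polynomial.monom (?l P m) (e m))"
  have "poly Q t = 0" for t
  proof -
    let ?x = "\<lambda>v. t ^ (N ^ frozen_rank v)"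
    have "mon ?x m = t ^ e m" for m
    proof -
      have "mon ?x m = (\<Prod>v\<in>UNIV. ?x v ^ ?l m v)"
        by (rule mon_superset) (simp_all add: finite_frozen)
      also have "\<dots> = t ^ (\<Sum>v\<in>UNIV. N ^ frozen_rank v * ?l m v)"
        by (simp add: power_sum power_mult)
      also have "(\<Sum>v\<in>UNIV. N ^ frozen_rank v * ?l m v) = e m"
        by (simp add: UNIV_frozen e_def algebra_simps power2_eq_square power3_eq_cube)
      finally show ?thesis .
    qed
    thus ?thesis using z[of ?x]
      by (simp add: Q_def poly_sum poly_monom eval_cpoly_eq_insertion insertion_def)
  qed
  hence "Q = 0" using poly_all_0_iff_0 by blast
  hence "0 = Polynomial.coeff Q (e m0)" by simp
  also have "\<dots> = (\<Sum>m\<in>?K. if m = m0 then ?l P m else 0)"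
    unfolding Q_def coeff_sum using inj m0 by (intro sum.cong) auto
  also have "\<dots> = ?l P m0" using m0 by simp
  finally show False using m0 by (simp add: in_keys_iff)
qed

lemma frozen_cpoly_poly_eq_0:
  fixes A :: "frozen cpoly poly"
  assumes z: "\<And>x z. unital_hom.peval (eval_cpoly x) z A = 0"
  shows "A = 0"
proof (rule poly_eqI)
  fix n
  have "eval_cpoly x (Polynomial.coeff A n) = 0" for x
  proof -
    interpret unital_hom "eval_cpoly x :: frozen cpoly \<Rightarrow> complex" by (rule eval_cpoly_hom)
    have "map_poly (eval_cpoly x) A = 0"
      using z[of x] unfolding peval_def using poly_all_0_iff_0 by blast
    thus ?thesis by (metis coeff_map_poly zero coeff_0)
  qed
  thus "Polynomial.coeff A n = Polynomial.coeff 0 n" by (simp add: frozen_cpoly_eq_0)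
qed

text \<open>A polynomial in the frozen variables and one further variable that vanishes off a hypersurface is
  zero.\<close>
lemma frozen_cpoly_poly_eq_0_dense:
  fixes A D :: "frozen cpoly poly"
  assumes "D \<noteq> 0"
    and z: "\<And>x z. unital_hom.peval (eval_cpoly x) z D \<noteq> 0 \<Longrightarrow> unital_hom.peval (eval_cpoly x) z A = 0"
  shows "A = 0"
proof -
  have "D * A = 0"
  proof (rule frozen_cpoly_poly_eq_0)
    fix x z
    interpret unital_hom "eval_cpoly x :: frozen cpoly \<Rightarrow> complex" by (rule eval_cpoly_hom)
    show "peval z (D * A) = 0" using assms(2)[of x z] by (auto simp: peval_mult)
  qed
  thus ?thesis using assms(1) by simp
qed

lemma insertion_comp:
  assumes f: "unital_hom f" and g: "unital_hom g"
  shows "g (insertion f y P) = insertion (\<lambda>c. g (f c)) (\<lambda>v. g (y v)) P"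
proof -
  interpret f: unital_hom "insertion f y" by (rule insertion_hom[OF f])
  interpret g: unital_hom g by (rule g)
  have gf: "unital_hom (\<lambda>c. g (f c))" by (rule unital_hom_comp[OF f g])
  interpret gf: unital_hom "insertion (\<lambda>c. g (f c)) (\<lambda>v. g (y v))" by (rule insertion_hom[OF gf])
  show ?thesis
    by (induct P rule: cpoly_induct)
      (simp_all add: f.add gf.add g.add f.mult gf.mult g.mult insertion_Const insertion_Var f gf)
qed

subsection \<open>Variables are prime\<close>

text \<open>\<open>set_zero V\<close> substitutes \<open>0\<close> for the variables in \<open>V\<close>.\<close>
definition set_zero :: "frozen set \<Rightarrow> frozen cpoly \<Rightarrow> frozen cpoly"
  where "set_zero V = insertion Const (\<lambda>v. if v \<in> V then 0 else Var v)"

lemma set_zero_hom: "unital_hom (set_zero V)"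
  unfolding set_zero_def[abs_def] by (rule insertion_hom[OF Const_hom])

lemma set_zero_Var: "set_zero V (Var v) = (if v \<in> V then 0 else Var v)"
  and set_zero_Const: "set_zero V (Const c) = Const c"
  by (simp_all add: set_zero_def insertion_Var insertion_Const Const_hom)

lemma Var_dvd_minus_set_zero: "Var v dvd P - set_zero {v} P"
proof (induct P rule: cpoly_induct)
  case (add P Q)
  have "P + Q - set_zero {v} (P + Q) = (P - set_zero {v} P) + (Q - set_zero {v} Q)"
    by (simp add: unital_hom.add[OF set_zero_hom])
  thus ?case using add by (metis dvd_add)
next
  case (Var_mult w P)
  thus ?case
    by (auto simp: unital_hom.mult[OF set_zero_hom] set_zero_Var simp flip: right_diff_distrib)
qed (simp add: set_zero_Const)

lemma Var_dvd_iff: "Var v dvd P \<longleftrightarrow> set_zero {v} P = 0"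
proof -
  interpret unital_hom "set_zero {v}" by (rule set_zero_hom)
  show ?thesis
  proof
    assume "Var v dvd P"
    thus "set_zero {v} P = 0" by (auto simp: dvd_def mult set_zero_Var)
  next
    assume "set_zero {v} P = 0"
    thus "Var v dvd P" using Var_dvd_minus_set_zero[of v P] by simp
  qed
qed

lemma Var_prime:
  fixes a b :: "frozen cpoly"
  assumes "Var v dvd a * b"
  shows "Var v dvd a \<or> Var v dvd b"
  using assms by (simp add: Var_dvd_iff unital_hom.mult[OF set_zero_hom])

lemma eval_nonzero: "eval_cpoly x P \<noteq> 0 \<Longrightarrow> P \<noteq> 0"
  by (auto simp: eval_cpoly_simps)

lemma Var_neq_0: "Var v \<noteq> 0"
  by (rule eval_nonzero[of "\<lambda>_. 1"]) (simp add: eval_cpoly_simps)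

lemma exchange_neq_0: "E \<noteq> 0"
  by (rule eval_nonzero[of "\<lambda>_. 1"]) (simp add: eval_exchange)

lemma Var_power_dvd_cancel:
  fixes d c :: "frozen cpoly"
  assumes d: "\<not> Var v dvd d" and "Var v ^ M dvd d * c"
  shows "Var v ^ M dvd c"
  using assms(2)
proof (induct M arbitrary: c)
  case (Suc M)
  have "Var v dvd d * c" using Suc(2) by (metis dvd_mult_left power_Suc)
  hence "Var v dvd c" using Var_prime[of v d c] d by blast
  then obtain c' where c: "c = Var v * c'" by (rule dvdE)
  have "Var v * Var v ^ M dvd Var v * (d * c')"
    using Suc(2) by (simp add: c mult.left_commute)
  hence "Var v ^ M dvd d * c'" using Var_neq_0[of v] by (simp add: dvd_times_left_cancel_iff)
  hence "Var v ^ M dvd c'" by (rule Suc(1))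
  thus ?case unfolding c power_Suc by (rule mult_dvd_mono[OF dvd_refl])
qed simp

lemma Var_powers_dvd_cancel:
  fixes d c :: "frozen cpoly"
  assumes "\<not> Var v dvd d" "\<not> Var w dvd d" and d: "Var v ^ M * Var w ^ N dvd d * c"
  shows "Var v ^ M * Var w ^ N dvd c"
proof -
  have "Var v ^ M dvd d * c" using d by (rule dvd_mult_left)
  hence "Var v ^ M dvd c" by (rule Var_power_dvd_cancel[OF assms(1)])
  then obtain c' where c: "c = Var v ^ M * c'" by (auto simp: dvd_def)
  have "Var v ^ M * Var w ^ N dvd Var v ^ M * (d * c')" using d by (simp add: c mult.left_commute)
  hence "Var w ^ N dvd d * c'" using Var_neq_0[of v] by (simp add: dvd_times_left_cancel_iff)
  hence "Var w ^ N dvd c'" by (rule Var_power_dvd_cancel[OF assms(2)])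
  thus ?thesis unfolding c by (rule mult_dvd_mono[OF dvd_refl])
qed

subsection \<open>The exchange polynomial is irreducible\<close>

text \<open>\<open>scale V P\<close> multiplies each variable in \<open>V\<close> by a new variable, in which its degree is then the degree of \<open>P\<close>
  in the variables \<open>V\<close>.\<close>
definition scale :: "frozen set \<Rightarrow> frozen cpoly \<Rightarrow> frozen cpoly poly"
  where "scale V = insertion (\<lambda>c. [:Const c:]) (\<lambda>v. if v \<in> V then [:0, Var v:] else [:Var v:])"

lemma const_poly_hom: "unital_hom (\<lambda>c. [:c:])"
  by standard (simp_all add: one_pCons)

lemma scale_hom: "unital_hom (scale V)"
  unfolding scale_def[abs_def] by (rule insertion_hom[OF unital_hom_comp[OF Const_hom const_poly_hom]])

lemma scale_Var: "scale V (Var v) = (if v \<in> V then [:0, Var v:] else [:Var v:])"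
  and scale_Const: "scale V (Const c) = [:Const c:]"
  by (simp_all add: scale_def insertion_Var insertion_Const unital_hom_comp[OF Const_hom const_poly_hom])

lemma poly_scale_1: "poly (scale V P) 1 = P"
proof (induct P rule: cpoly_induct)
  case (add P Q)
  thus ?case by (simp add: unital_hom.add[OF scale_hom])
next
  case (Var_mult v P)
  thus ?case by (simp add: unital_hom.mult[OF scale_hom] scale_Var)
qed (simp add: scale_Const)

lemma poly_scale_0: "poly (scale V P) 0 = set_zero V P"
proof (induct P rule: cpoly_induct)
  case (add P Q)
  thus ?case by (simp add: unital_hom.add[OF scale_hom] unital_hom.add[OF set_zero_hom])
next
  case (Var_mult v P)
  thus ?case by (simp add: unital_hom.mult[OF scale_hom] unital_hom.mult[OF set_zero_hom] scale_Var set_zero_Var)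
qed (simp add: scale_Const set_zero_Const)

text \<open>If a product has degree at most one in the variables \<open>V\<close>, then one of the factors does not involve
  them.\<close>
lemma scale_degree_le_1:
  assumes "Polynomial.degree (scale V (a * b)) \<le> 1" "a * b \<noteq> 0"
  shows "set_zero V a = a \<or> set_zero V b = b"
proof -
  have *: "set_zero V c = c" if "Polynomial.degree (scale V c) = 0" for c
    using that by (metis degree_eq_zeroE poly_pCons mult_zero_left poly_0 add.right_neutral mult_zero_right
        poly_scale_0 poly_scale_1)
  have "scale V a \<noteq> 0" "scale V b \<noteq> 0"
    using assms(2) poly_scale_1[of V a] poly_scale_1[of V b] by auto
  hence "Polynomial.degree (scale V a) + Polynomial.degree (scale V b) \<le> 1"
    using assms(1) by (simp add: unital_hom.mult[OF scale_hom] degree_mult_eq)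
  hence "Polynomial.degree (scale V a) = 0 \<or> Polynomial.degree (scale V b) = 0" by arith
  thus ?thesis using * by blast
qed

lemma eval_set_zero: "eval_cpoly x (set_zero V P) = eval_cpoly (\<lambda>v. if v \<in> V then 0 else x v) P"
proof (induct P rule: cpoly_induct)
  case (add P Q)
  thus ?case by (simp add: unital_hom.add[OF set_zero_hom] eval_cpoly_simps)
next
  case (Var_mult v P)
  thus ?case by (simp add: unital_hom.mult[OF set_zero_hom] set_zero_Var eval_cpoly_simps)
qed (simp add: set_zero_Const eval_cpoly_simps)

lemma set_zero_UNIV: "set_zero UNIV P = Const (eval_cpoly (\<lambda>_. 0) P)"
proof (induct P rule: cpoly_induct)
  case (add P Q)
  thus ?case by (simp add: unital_hom.add[OF set_zero_hom] eval_cpoly_simps unital_hom.add[OF Const_hom])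
next
  case (Var_mult v P)
  thus ?case by (simp add: unital_hom.mult[OF set_zero_hom] set_zero_Var eval_cpoly_simps unital_hom.zero[OF Const_hom])
qed (simp add: set_zero_Const eval_cpoly_simps)

lemma set_zero_set_zero: "set_zero V (set_zero W P) = set_zero (V \<union> W) P"
proof (induct P rule: cpoly_induct)
  case (add P Q)
  thus ?case by (simp add: unital_hom.add[OF set_zero_hom])
next
  case (Var_mult v P)
  thus ?case by (simp add: unital_hom.mult[OF set_zero_hom] set_zero_Var unital_hom.zero[OF set_zero_hom])
qed (simp add: set_zero_Const)

lemma Const_unit: 
  assumes "Const c \<noteq> 0"
  shows "(Const c :: 'v cpoly) dvd 1"
proof -
  have "c \<noteq> 0" using assms by (auto simp: unital_hom.zero[OF Const_hom])
  hence "Const c * Const (1 / c) = (1 :: 'v cpoly)"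
    by (simp add: unital_hom.one[OF Const_hom] flip: unital_hom.mult[OF Const_hom])
  thus ?thesis by (metis dvd_triv_left)
qed

text \<open>A factor \<open>a\<close> of \<open>E = p\<^sub>1 t + p\<^sub>2 s\<close> that does not involve \<open>p\<^sub>1, p\<^sub>2\<close> is constant: \<open>E\<close> is linear in \<open>s, t\<close>, so
  otherwise the other factor would be a polynomial in \<open>p\<^sub>1, p\<^sub>2\<close>, but \<open>E\<close> is not of the form
  \<open>a(s, t) b(p\<^sub>1, p\<^sub>2)\<close>.\<close>
lemma exchange_factor_unit:
  assumes eq: "E = a * b" and a: "set_zero {F_p1, F_p2} a = a"
  shows "a dvd 1"
proof -
  have "Polynomial.degree (scale {F_s, F_t} E) \<le> 1"
    by (simp add: exchange_polynomial_def unital_hom.mult[OF scale_hom] unital_hom.add[OF scale_hom] scale_Var)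
  hence "set_zero {F_s, F_t} a = a \<or> set_zero {F_s, F_t} b = b"
    using scale_degree_le_1[of _ a b] exchange_neq_0 unfolding eq by blast
  thus ?thesis
  proof
    assume "set_zero {F_s, F_t} a = a"
    hence "a = set_zero UNIV a"
      using a set_zero_set_zero[of "{F_s, F_t}" "{F_p1, F_p2}" a] by (simp add: UNIV_frozen insert_commute)
    hence "a = Const (eval_cpoly (\<lambda>_. 0) a)" by (simp add: set_zero_UNIV)
    thus ?thesis using Const_unit exchange_neq_0 eq by (metis mult_zero_left)
  next
    assume b: "set_zero {F_s, F_t} b = b"
    define x where "x p1 p2 s t = (case_frozen p1 p2 s t :: frozen \<Rightarrow> complex)" for p1 p2 s t
    have [simp]: "x p1 p2 s t F_p1 = p1" "x p1 p2 s t F_p2 = p2" "x p1 p2 s t F_s = s" "x p1 p2 s t F_t = t"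
      for p1 p2 s t by (simp_all add: x_def)
    have ea: "eval_cpoly (x p1 p2 s t) a = eval_cpoly (x 0 0 s t) a" for p1 p2 s t
    proof -
      have "(\<lambda>v. if v \<in> {F_p1, F_p2} then 0 else x p1 p2 s t v) = x 0 0 s t"
        by (rule ext, rename_tac v, case_tac v) simp_all
      thus ?thesis by (metis a eval_set_zero)
    qed
    have eb: "eval_cpoly (x p1 p2 s t) b = eval_cpoly (x p1 p2 0 0) b" for p1 p2 s t
    proof -
      have "(\<lambda>v. if v \<in> {F_s, F_t} then 0 else x p1 p2 s t v) = x p1 p2 0 0"
        by (rule ext, rename_tac v, case_tac v) simp_all
      thus ?thesis by (metis b eval_set_zero)
    qed
    have "eval_cpoly (x 0 0 s t) a * eval_cpoly (x p1 p2 0 0) b = p1 * t + p2 * s" for p1 p2 s t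
      using eval_exchange[of "x p1 p2 s t"] unfolding eq by (simp add: eval_cpoly_simps ea[of p1 p2] eb[of _ _ s t])
    \<comment> \<open>the values \<open>(0, 1; 1, 0)\<close> and \<open>(1, 0; 0, 1)\<close> of \<open>(s, t; p1, p2)\<close> give \<open>E = 1\<close>, so both factors
      are non-zero at \<open>(1, 0; 1, 0)\<close>, where \<open>E\<close> vanishes\<close>
    from this[of 0 1 1 0] this[of 1 0 0 1] this[of 1 0 1 0] show ?thesis by auto
  qed
qed

lemma exchange_irreducible: "Factorial_Ring.irreducible E"
proof (rule Factorial_Ring.irreducibleI)
  show "E \<noteq> 0" by (rule exchange_neq_0)
  show "\<not> E dvd 1"
  proof
    assume "E dvd 1"
    then obtain d where "1 = E * d" by (rule dvdE)
    hence "eval_cpoly (\<lambda>_. 0) (1 :: frozen cpoly) = eval_cpoly (\<lambda>_. 0) (E * d)" by (rule arg_cong)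
    thus False by (simp add: eval_exchange eval_cpoly_simps)
  qed
next
  fix a b assume eq: "E = a * b"
  have "Polynomial.degree (scale {F_p1, F_p2} E) \<le> 1"
    by (simp add: exchange_polynomial_def unital_hom.mult[OF scale_hom] unital_hom.add[OF scale_hom] scale_Var)
  hence "set_zero {F_p1, F_p2} a = a \<or> set_zero {F_p1, F_p2} b = b"
    using scale_degree_le_1[of _ a b] exchange_neq_0 unfolding eq by blast
  thus "a dvd 1 \<or> b dvd 1"
    using exchange_factor_unit[of a b] exchange_factor_unit[of b a] eq mult.commute[of a b] by metis
qed

section \<open>Normal forms modulo the exchange relation\<close>

text \<open>The frozen variables as generators, and the resulting inclusion of polynomial rings.\<close>
fun emb :: "frozen \<Rightarrow> gen" where
  "emb F_p1 = X_p1"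
| "emb F_p2 = X_p2"
| "emb F_s = X_s"
| "emb F_t = X_t"

definition emb_poly :: "frozen cpoly \<Rightarrow> gen cpoly"
  where "emb_poly = insertion Const (\<lambda>v. Var (emb v))"

lemma emb_poly_hom: "unital_hom emb_poly"
  unfolding emb_poly_def by (rule insertion_hom[OF Const_hom])

interpretation emb_poly: unital_hom emb_poly by (rule emb_poly_hom)

lemma emb_poly_Var: "emb_poly (Var v) = Var (emb v)"
  and emb_poly_Const: "emb_poly (Const c) = Const c"
  by (simp_all add: emb_poly_def insertion_Var insertion_Const Const_hom)

definition exchange_relation :: "gen cpoly"
  where "exchange_relation = Var X_q * Var X_r - Var X_p1 * Var X_t - Var X_p2 * Var X_s"

lemma exchange_relation_eq: "Var X_q * Var X_r = exchange_relation + emb_poly E"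
  by (simp add: exchange_relation_def exchange_polynomial_def emb_poly.add emb_poly.mult emb_poly_Var)

text \<open>The polynomial \<open>A(q) + r B(r)\<close>. The factor \<open>r\<close> in the second summand makes the pair \<open>(A, B)\<close> unique.\<close>
definition normal_form :: "frozen cpoly poly \<Rightarrow> frozen cpoly poly \<Rightarrow> gen cpoly"
  where "normal_form A B = emb_poly.peval (Var X_q) A + Var X_r * emb_poly.peval (Var X_r) B"

lemma normal_form_add: "normal_form (A + A') (B + B') = normal_form A B + normal_form A' B'"
  by (simp add: normal_form_def emb_poly.peval_add algebra_simps)

lemma normal_form_smult:
  "normal_form (Polynomial.smult c A) (Polynomial.smult c B) = emb_poly c * normal_form A B"
  by (simp add: normal_form_def emb_poly.peval_smult algebra_simps)

lemma normal_form_mult_q: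
  "\<exists>A' B'. exchange_relation dvd Var X_q * normal_form A B - normal_form A' B'"
proof (cases B)
  case (pCons b B')
  let ?q = "Var X_q :: gen cpoly" and ?r = "Var X_r :: gen cpoly"
  let ?A = "emb_poly.peval ?q A" and ?B = "emb_poly.peval ?r B" and ?B' = "emb_poly.peval ?r B'"
  have "?q * normal_form A B = ?q * ?A + (?q * ?r) * ?B"
    by (simp add: normal_form_def algebra_simps)
  also have "\<dots> = exchange_relation * ?B + (?q * ?A + emb_poly E * ?B)"
    unfolding exchange_relation_eq by (simp add: algebra_simps)
  also have "?q * ?A + emb_poly E * ?B = normal_form (pCons 0 A + [:E * b:]) (Polynomial.smult E B')"
    by (simp add: normal_form_def pCons emb_poly.peval_pCons emb_poly.peval_add emb_poly.peval_smult
        emb_poly.zero emb_poly.mult algebra_simps)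
  finally have "exchange_relation dvd ?q * normal_form A B - normal_form (pCons 0 A + [:E * b:]) (Polynomial.smult E B')"
    by simp
  thus ?thesis by blast
qed

lemma normal_form_mult_r:
  "\<exists>A' B'. exchange_relation dvd Var X_r * normal_form A B - normal_form A' B'"
proof (cases A)
  case (pCons a A')
  let ?q = "Var X_q :: gen cpoly" and ?r = "Var X_r :: gen cpoly"
  let ?A' = "emb_poly.peval ?q A'" and ?B = "emb_poly.peval ?r B"
  have "?r * normal_form A B = ?r * emb_poly a + (?q * ?r) * ?A' + ?r * ?r * ?B"
    by (simp add: normal_form_def pCons emb_poly.peval_pCons algebra_simps)
  also have "\<dots> = exchange_relation * ?A' + (?r * emb_poly a + emb_poly E * ?A' + ?r * ?r * ?B)"
    unfolding exchange_relation_eq by (simp add: algebra_simps)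
  also have "?r * emb_poly a + emb_poly E * ?A' + ?r * ?r * ?B = normal_form (Polynomial.smult E A') (pCons a B)"
    by (simp add: normal_form_def emb_poly.peval_pCons emb_poly.peval_smult algebra_simps)
  finally have "exchange_relation dvd ?r * normal_form A B - normal_form (Polynomial.smult E A') (pCons a B)"
    by simp
  thus ?thesis by blast
qed

lemma exists_normal_form:
  "\<exists>A B. exchange_relation dvd P - normal_form A B"
proof (induct P rule: cpoly_induct)
  case (Const c)
  have "normal_form [:Const c:] 0 = Const c"
    by (simp add: normal_form_def emb_poly.peval_pCons emb_poly_Const)
  thus ?case by (metis diff_self dvd_0_right)
next
  case (add P Q)
  then obtain A B A' B' where "exchange_relation dvd P - normal_form A B"
    "exchange_relation dvd Q - normal_form A' B'" by blast
  hence "exchange_relation dvd (P - normal_form A B) + (Q - normal_form A' B')"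
    by (rule dvd_add)
  hence "exchange_relation dvd (P + Q) - normal_form (A + A') (B + B')"
    by (simp add: normal_form_add algebra_simps)
  thus ?case by blast
next
  case (Var_mult v P)
  then obtain A B where 1: "exchange_relation dvd P - normal_form A B" by blast
  have "\<exists>A' B'. exchange_relation dvd Var v * normal_form A B - normal_form A' B'"
  proof -
    have fr: ?thesis if "v = emb w" for w
      by (rule exI[of _ "Polynomial.smult (Var w) A"], rule exI[of _ "Polynomial.smult (Var w) B"])
        (simp add: normal_form_smult emb_poly_Var that)
    show ?thesis
      using normal_form_mult_q normal_form_mult_r fr[of F_p1] fr[of F_p2] fr[of F_s] fr[of F_t]
      by (cases v) simp_all
  qed
  then obtain A' B' where 2: "exchange_relation dvd Var v * normal_form A B - normal_form A' B'"
    by blast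
  have eq: "Var v * P - normal_form A' B' =
      Var v * (P - normal_form A B) + (Var v * normal_form A B - normal_form A' B')"
    by (simp add: algebra_simps)
  have "exchange_relation dvd Var v * P - normal_form A' B'"
    unfolding eq by (rule dvd_add[OF dvd_mult[OF 1] 2])
  thus ?case by blast
qed

lemma insertion_emb_poly:
  assumes "unital_hom h"
  shows "insertion h y (emb_poly P) = insertion h (\<lambda>v. y (emb v)) P"
  unfolding emb_poly_def insertion_comp[OF Const_hom insertion_hom[OF assms]]
  by (simp add: insertion_Const insertion_Var assms)

text \<open>The value of a normal form at a point \<open>y\<close>: the homomorphism induced by \<open>y\<close> on \<open>S\<close> is applied to the
  coefficients.\<close>
lemma insertion_normal_form:
  assumes h: "unital_hom h"
  shows "insertion h y (normal_form A B) =
    unital_hom.peval (insertion h (\<lambda>v. y (emb v))) (y X_q) A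
      + y X_r * unital_hom.peval (insertion h (\<lambda>v. y (emb v))) (y X_r) B"
proof -
  interpret unital_hom "insertion h y" by (rule insertion_hom[OF h])
  show ?thesis
    by (simp add: normal_form_def add mult insertion_Var h peval_comp[OF emb_poly_hom insertion_hom[OF h]]
        insertion_emb_poly[OF h, abs_def])
qed

text \<open>The polynomial \<open>q ^ (n + 1) * (A(q) + r B(r))\<close> with \<open>r = E / q\<close>, for \<open>n\<close> at least the degree of \<open>B\<close>
  (\<open>peval_clear\<close>). Its coefficients are those of \<open>A\<close>, and those of \<open>B\<close> multiplied by powers of \<open>E\<close>.\<close>

definition clear :: "nat \<Rightarrow> frozen cpoly poly \<Rightarrow> frozen cpoly poly \<Rightarrow> frozen cpoly poly"
  where "clear n A B = Polynomial.monom 1 (n + 1) * A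
    + (\<Sum>k\<le>n. Polynomial.monom (Polynomial.coeff B k * E ^ (k + 1)) (n - k))"

lemma coeff_clear_high: "Polynomial.coeff (clear n A B) (n + 1 + k) = Polynomial.coeff A k"
proof -
  have "(\<Sum>i\<le>n. Polynomial.coeff (Polynomial.monom (Polynomial.coeff B i * E ^ (i + 1)) (n - i)) (n + 1 + k)) = 0"
    by (intro sum.neutral) auto
  thus ?thesis by (simp add: clear_def coeff_monom_mult coeff_sum)
qed

lemma coeff_clear_low: 
  assumes "k \<le> n"
  shows "Polynomial.coeff (clear n A B) (n - k) = Polynomial.coeff B k * E ^ (k + 1)"
proof -
  have "(\<Sum>i\<le>n. Polynomial.coeff (Polynomial.monom (Polynomial.coeff B i * E ^ (i + 1)) (n - i)) (n - k))
      = (\<Sum>i\<le>n. if i = k then Polynomial.coeff B k * E ^ (k + 1) else 0)"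
    using assms by (intro sum.cong) auto
  thus ?thesis using assms by (simp add: clear_def coeff_monom_mult coeff_sum)
qed

lemma clear_eq_0:
  assumes "clear n A B = 0" "Polynomial.degree B \<le> n"
  shows "A = 0 \<and> B = 0"
proof
  show "A = 0"
    using coeff_clear_high[of n A B] assms(1) by (intro poly_eqI) simp
  show "B = 0"
  proof (rule poly_eqI)
    fix k
    show "Polynomial.coeff B k = Polynomial.coeff 0 k"
    proof (cases "k \<le> n")
      case True
      thus ?thesis using coeff_clear_low[OF True, of A B] assms(1) exchange_neq_0 by simp
    next
      case False
      thus ?thesis using assms(2) by (simp add: coeff_eq_0)
    qed
  qed
qed

lemma peval_clear:
  assumes h: "unital_hom h" and zw: "z * w = h E" and deg: "Polynomial.degree B \<le> n"
  shows "unital_hom.peval h z (clear n A B) = z ^ (n + 1) * (unital_hom.peval h z A + w * unital_hom.peval h w B)"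
proof -
  interpret unital_hom h by (rule h)
  interpret p: unital_hom "peval z" by (rule peval_hom)
  have e: "h (Polynomial.coeff B k * E ^ (k + 1)) * z ^ (n - k) = z ^ (n + 1) * w * (h (Polynomial.coeff B k) * w ^ k)"
    if "k \<le> n" for k
  proof -
    have "z ^ (n + 1) = z ^ (n - k) * z ^ (k + 1)"
      unfolding power_add[symmetric] using that by simp
    thus ?thesis by (simp add: mult power power_mult_distrib flip: zw)
  qed
  have "peval z (\<Sum>k\<le>n. Polynomial.monom (Polynomial.coeff B k * E ^ (k + 1)) (n - k))
      = (\<Sum>k\<le>n. z ^ (n + 1) * w * (h (Polynomial.coeff B k) * w ^ k))"
    unfolding p.sum peval_monom by (intro sum.cong refl e) simp
  also have "\<dots> = z ^ (n + 1) * (w * peval w B)"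
    by (simp add: peval_altdef[OF deg] sum_distrib_left mult.assoc)
  finally show ?thesis
    by (simp add: clear_def peval_add peval_mult peval_monom one algebra_simps)
qed

section \<open>The upper Laurent phenomenon algebra\<close>

lemma lp_coeff_hom: "unital_hom lp_coeff"
  by standard (simp_all add: lp_coeff_def flip: to_fract_add to_fract_mult one_pCons)

interpretation lp_coeff: unital_hom lp_coeff by (rule lp_coeff_hom)

text \<open>The inclusion of \<open>S[q]\<close> into its field of fractions is evaluation at the element \<open>q\<close>.\<close>
lemma to_fract_eq_peval: "to_fract A = lp_coeff.peval lp_q A"
proof (induct A)
  case (pCons a A)
  have "pCons a A = [:a:] + [:0, 1:] * A" by simp
  hence "to_fract (pCons a A) = lp_coeff a + lp_q * to_fract A"
    by (simp only: to_fract_add to_fract_mult lp_coeff_def lp_q_def)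
  thus ?case by (simp add: pCons lp_coeff.peval_pCons)
qed simp

lemma lp_q_neq_0: "lp_q \<noteq> (0 :: frozen cpoly poly fract)"
  by (simp add: lp_q_def)

lemma lp_coeff_eq_0_iff: "lp_coeff c = 0 \<longleftrightarrow> c = 0"
  by (simp add: lp_coeff_def)

lemma lp_q'_neq_0: "lp_q' E \<noteq> 0"
  by (simp add: lp_q'_def lp_q_neq_0 lp_coeff_eq_0_iff exchange_neq_0)

lemma lp_q_mult_lp_q': "lp_q * lp_q' E = lp_coeff E" "lp_q' E * lp_q = lp_coeff E"
  by (simp_all add: lp_q'_def lp_q_neq_0)

text \<open>The images of the six generators in the upper Laurent phenomenon algebra, and the induced
  homomorphism.\<close>
definition lp_gen :: "gen \<Rightarrow> frozen cpoly poly fract"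
  where "lp_gen v = (case v of X_p1 \<Rightarrow> lp_coeff (Var F_p1) | X_p2 \<Rightarrow> lp_coeff (Var F_p2) | X_q \<Rightarrow> lp_q
    | X_r \<Rightarrow> lp_q' E | X_s \<Rightarrow> lp_coeff (Var F_s) | X_t \<Rightarrow> lp_coeff (Var F_t))"

definition to_LP :: "gen cpoly \<Rightarrow> frozen cpoly poly fract"
  where "to_LP = insertion (\<lambda>c. lp_coeff (Const c)) lp_gen"

lemma lp_coeff_Const_hom: "unital_hom (\<lambda>c. lp_coeff (Const c))"
  by (rule unital_hom_comp[OF Const_hom lp_coeff_hom])

interpretation to_LP: unital_hom to_LP
  unfolding to_LP_def by (rule insertion_hom[OF lp_coeff_Const_hom])

lemma to_LP_Var: "to_LP (Var v) = lp_gen v" and to_LP_Const: "to_LP (Const c) = lp_coeff (Const c)"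
  by (simp_all add: to_LP_def insertion_Var insertion_Const lp_coeff_Const_hom)

lemma to_LP_normal_form:
  "to_LP (normal_form A B) = lp_coeff.peval lp_q A + lp_q' E * lp_coeff.peval (lp_q' E) B"
proof -
  have *: "insertion (\<lambda>c. lp_coeff (Const c)) (\<lambda>v. lp_gen (emb v)) P = lp_coeff P" for P
  proof -
    have "(\<lambda>v. lp_gen (emb v)) = (\<lambda>v. lp_coeff (Var v))"
      by (rule ext, rename_tac v, case_tac v) (simp_all add: lp_gen_def)
    moreover have "insertion Const Var P = P" for P :: "frozen cpoly"
      by (induct P rule: cpoly_induct) 
        (simp_all add: insertion_Const insertion_Var Const_hom unital_hom.add[OF insertion_hom[OF Const_hom]]
          unital_hom.mult[OF insertion_hom[OF Const_hom]])
    ultimately show ?thesis using insertion_comp[OF Const_hom lp_coeff_hom, of Var P] by simp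
  qed
  have g: "lp_gen X_q = lp_q" "lp_gen X_r = lp_q' E" by (simp_all add: lp_gen_def)
  show ?thesis
    unfolding to_LP_def insertion_normal_form[OF lp_coeff_Const_hom] *[abs_def] g ..
qed

lemma to_LP_clear:
  assumes "Polynomial.degree B \<le> n"
  shows "to_fract (clear n A B) = lp_q ^ (n + 1) * to_LP (normal_form A B)"
  unfolding to_fract_eq_peval to_LP_normal_form
  by (rule peval_clear[OF lp_coeff_hom lp_q_mult_lp_q'(1) assms])

text \<open>The exchange relation generates the kernel: on normal forms the homomorphism is injective, because
  \<open>E\<close> is not a zero divisor.\<close>
lemma to_LP_eq_0_iff: "to_LP P = 0 \<longleftrightarrow> exchange_relation dvd P"
proof -
  have "to_LP exchange_relation = 0"
    by (simp add: exchange_relation_def to_LP.minus to_LP.mult to_LP_Var lp_gen_def lp_q_mult_lp_q')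
       (simp add: exchange_polynomial_def lp_coeff.add lp_coeff.mult)
  hence d: "to_LP Q = 0" if "exchange_relation dvd Q" for Q
    using that by (auto simp: dvd_def to_LP.mult)
  obtain A B where AB: "exchange_relation dvd P - normal_form A B" using exists_normal_form by blast
  show ?thesis
  proof
    assume "to_LP P = 0"
    hence "to_LP (normal_form A B) = 0" using d[OF AB] by (simp add: to_LP.minus)
    hence "clear (Polynomial.degree B) A B = 0"
      using to_LP_clear[of B "Polynomial.degree B" A] by simp
    hence "A = 0 \<and> B = 0" by (rule clear_eq_0) simp
    thus "exchange_relation dvd P" using AB by (simp add: normal_form_def)
  qed (rule d)
qed

lemma laurent_ring_eq: "laurent_ring x = {lp_coeff.peval x f / x ^ n | f n. True}"
  by (simp add: laurent_ring_def lp_coeff.peval_def)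

text \<open>An element of the intersection is both \<open>F(q) / q ^ n\<close> and \<open>G(r) / r ^ m\<close>. Comparing the coefficients of
  equal powers of \<open>q\<close> shows that it is the normal form whose coefficients are those of \<open>F\<close> from degree \<open>n\<close>
  on and those of \<open>G\<close> from degree \<open>m + 1\<close> on.\<close>
lemma to_LP_range: "range to_LP = laurent_ring lp_q \<inter> laurent_ring (lp_q' E)"
proof (intro equalityI subsetI)
  fix X0 assume "X0 \<in> range to_LP"
  then obtain P where X0: "X0 = to_LP P" by blast
  obtain A B where AB: "exchange_relation dvd P - normal_form A B" using exists_normal_form by blast
  hence X0: "X0 = to_LP (normal_form A B)"
    unfolding X0 using to_LP_eq_0_iff by (metis to_LP.minus eq_iff_diff_eq_0)
  let ?n = "Polynomial.degree B"
  have "X0 = lp_coeff.peval lp_q (clear ?n A B) / lp_q ^ (?n + 1)"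
    using to_LP_clear[of B ?n A] lp_q_neq_0 by (simp add: X0 to_fract_eq_peval field_simps)
  moreover obtain a A' where A: "A = pCons a A'" by (cases A)
  let ?m = "Polynomial.degree A'"
  have "X0 = lp_coeff.peval (lp_q' E) (pCons a B) + lp_q * lp_coeff.peval lp_q A'"
    by (simp add: X0 to_LP_normal_form A lp_coeff.peval_pCons)
  hence "lp_coeff.peval (lp_q' E) (clear ?m (pCons a B) A') = lp_q' E ^ (?m + 1) * X0"
    using peval_clear[OF lp_coeff_hom lp_q_mult_lp_q'(2), of A' ?m "pCons a B"] by simp
  hence "X0 = lp_coeff.peval (lp_q' E) (clear ?m (pCons a B) A') / lp_q' E ^ (?m + 1)"
    using lp_q'_neq_0 by (simp add: field_simps)
  ultimately show "X0 \<in> laurent_ring lp_q \<inter> laurent_ring (lp_q' E)"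
    unfolding laurent_ring_eq by blast
next
  fix X0 assume "X0 \<in> laurent_ring lp_q \<inter> laurent_ring (lp_q' E)"
  then obtain F n G m where F: "X0 = lp_coeff.peval lp_q F / lp_q ^ n" 
    and G: "X0 = lp_coeff.peval (lp_q' E) G / lp_q' E ^ m"
    unfolding laurent_ring_eq by blast
  define d where "d = Polynomial.degree G"
  \<comment> \<open>\<open>G(E / q)\<close> multiplied by \<open>q ^ d\<close>\<close>
  define G' where "G' = (\<Sum>k\<le>d. Polynomial.monom (Polynomial.coeff G k * E ^ k) (d - k))"
  have qG: "lp_q ^ d * lp_coeff.peval (lp_q' E) G = to_fract G'"
  proof -
    interpret p: unital_hom "lp_coeff.peval lp_q" by (rule lp_coeff.peval_hom)
    have e: "lp_coeff (Polynomial.coeff G k * E ^ k) * lp_q ^ (d - k) = 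
        lp_q ^ d * (lp_coeff (Polynomial.coeff G k) * lp_q' E ^ k)" if "k \<le> d" for k
    proof -
      have "lp_q ^ k * lp_q ^ (d - k) = (lp_q :: frozen cpoly poly fract) ^ d"
        unfolding power_add[symmetric] using that by simp
      thus ?thesis
        by (simp add: lp_coeff.mult lp_coeff.power power_mult_distrib flip: lp_q_mult_lp_q'(1))
    qed
    have "to_fract G' = (\<Sum>k\<le>d. lp_coeff (Polynomial.coeff G k * E ^ k) * lp_q ^ (d - k))"
      unfolding to_fract_eq_peval G'_def p.sum lp_coeff.peval_monom ..
    also have "\<dots> = (\<Sum>k\<le>d. lp_q ^ d * (lp_coeff (Polynomial.coeff G k) * lp_q' E ^ k))"
      by (intro sum.cong refl e) simp
    also have "\<dots> = lp_q ^ d * lp_coeff.peval (lp_q' E) G"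
      by (simp add: lp_coeff.peval_altdef[of G d] d_def sum_distrib_left)
    finally show ?thesis ..
  qed
  have "lp_coeff.peval lp_q F * lp_q' E ^ m = lp_q ^ n * lp_coeff.peval (lp_q' E) G"
    using F G lp_q_neq_0 lp_q'_neq_0 by (simp add: field_simps)
  hence "lp_q ^ (m + d) * (lp_coeff.peval lp_q F * lp_q' E ^ m) = lp_q ^ (m + d) * (lp_q ^ n * lp_coeff.peval (lp_q' E) G)"
    by simp
  also have "lp_q ^ (m + d) * (lp_coeff.peval lp_q F * lp_q' E ^ m) = 
      lp_coeff.peval lp_q F * (lp_q * lp_q' E) ^ m * lp_q ^ d"
    by (simp add: power_add power_mult_distrib algebra_simps)
  also have "\<dots> = to_fract (Polynomial.monom (E ^ m) d * F)"
    unfolding lp_q_mult_lp_q'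
    by (simp only: to_fract_eq_peval lp_coeff.peval_mult lp_coeff.peval_monom lp_coeff.power mult_ac)
  also have "lp_q ^ (m + d) * (lp_q ^ n * lp_coeff.peval (lp_q' E) G) = lp_q ^ (m + n) * to_fract G'"
    unfolding qG[symmetric] by (simp add: power_add)
  also have "\<dots> = to_fract (Polynomial.monom 1 (m + n) * G')"
    by (simp only: to_fract_eq_peval lp_coeff.peval_mult lp_coeff.peval_monom lp_coeff.one mult_1)
  finally have eq: "Polynomial.monom (E ^ m) d * F = Polynomial.monom 1 (m + n) * G'"
    by (simp only: to_fract_eq_iff)
  have coeff_G': "Polynomial.coeff G' (d - k) = Polynomial.coeff G k * E ^ k" if "k \<le> d" for k
  proof -
    have "Polynomial.coeff G' (d - k) = (\<Sum>i\<le>d. if i = k then Polynomial.coeff G k * E ^ k else 0)"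
      unfolding G'_def coeff_sum using that by (intro sum.cong) auto
    thus ?thesis using that by simp
  qed
  define A where "A = poly_shift n F"
  define B where "B = poly_shift (m + 1) G"
  \<comment> \<open>any bound with \<open>n \<le> N\<close> and \<open>degree B \<le> N\<close>\<close>
  define N where "N = n + Polynomial.degree B"
  have "clear N A B = Polynomial.monom 1 (N + 1 - n) * F"
  proof (rule poly_eqI)
    fix i
    show "Polynomial.coeff (clear N A B) i = Polynomial.coeff (Polynomial.monom 1 (N + 1 - n) * F) i"
    proof (cases "i \<le> N")
      case False
      then obtain k where i: "i = N + 1 + k" by (metis Suc_eq_plus1 less_iff_Suc_add not_le add_Suc_shift add_Suc)
      show ?thesis unfolding i coeff_clear_high
        by (simp add: coeff_monom_mult A_def coeff_poly_shift N_def add.commute)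
    next
      case True
      define k where "k = N - i"
      have k: "i = N - k" "k \<le> N" using True by (simp_all add: k_def)
      have "Polynomial.coeff B k * E ^ (k + 1) = (if k < n then Polynomial.coeff F (n - 1 - k) else 0)"
      proof (cases "m + 1 + k \<le> d")
        case False
        hence B0: "Polynomial.coeff B k = 0" by (simp add: B_def coeff_poly_shift d_def coeff_eq_0)
        moreover have "Polynomial.coeff F (n - 1 - k) = 0" if "k < n"
        proof -
          let ?i = "d + (n - 1 - k)"
          have "Polynomial.coeff (Polynomial.monom 1 (m + n) * G') ?i = 0"
            using False that by (simp add: coeff_monom_mult)
          hence "E ^ m * Polynomial.coeff F (n - 1 - k) = 0"
            unfolding eq[symmetric] by (simp add: coeff_monom_mult)
          thus ?thesis using exchange_neq_0 by simp
        qed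
        ultimately show ?thesis by simp
      next
        case le: True
        have g: "Polynomial.coeff (Polynomial.monom 1 (m + n) * G') (m + n + (d - (m + 1 + k)))
            = Polynomial.coeff B k * E ^ (k + 1) * E ^ m"
          using coeff_G'[OF le]
          by (simp add: coeff_monom_mult B_def coeff_poly_shift power_add) (simp add: mult_ac add.commute)
        show ?thesis
        proof (cases "k < n")
          case True
          have "m + n + (d - (m + 1 + k)) = d + (n - 1 - k)" using le True by simp
          hence "Polynomial.coeff B k * E ^ (k + 1) * E ^ m = E ^ m * Polynomial.coeff F (n - 1 - k)"
            unfolding g[symmetric] eq[symmetric] by (simp add: coeff_monom_mult)
          thus ?thesis using exchange_neq_0 True by simp
        next
          case False
          hence "m + n + (d - (m + 1 + k)) < d" using le by simp
          hence "Polynomial.coeff B k * E ^ (k + 1) * E ^ m = 0"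
            unfolding g[symmetric] eq[symmetric] by (simp add: coeff_monom_mult)
          thus ?thesis using exchange_neq_0 False by simp
        qed
      qed
      moreover have "Polynomial.coeff (Polynomial.monom 1 (N + 1 - n) * F) (N - k)
          = (if k < n then Polynomial.coeff F (n - 1 - k) else 0)"
      proof -
        have "N + 1 - n \<le> N - k \<longleftrightarrow> k < n" "k < n \<Longrightarrow> N - k - (N + 1 - n) = n - 1 - k"
          using k(2) by (auto simp: N_def)
        thus ?thesis by (cases "k < n") (simp_all add: coeff_monom_mult not_le)
      qed
      ultimately show ?thesis unfolding k(1) coeff_clear_low[OF k(2)] by simp
    qed
  qed
  hence "to_fract (clear N A B) = lp_q ^ (N + 1 - n) * lp_coeff.peval lp_q F"
    by (simp only: to_fract_eq_peval lp_coeff.peval_mult lp_coeff.peval_monom lp_coeff.one mult_1)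
  also have "\<dots> = lp_q ^ (N + 1) * X0"
  proof -
    have "(lp_q :: frozen cpoly poly fract) ^ (N + 1) = lp_q ^ (N + 1 - n) * lp_q ^ n"
      unfolding power_add[symmetric] by (simp add: N_def add.commute)
    thus ?thesis using lp_q_neq_0 by (simp add: F)
  qed
  finally have "lp_q ^ (N + 1) * to_LP (normal_form A B) = lp_q ^ (N + 1) * X0"
    by (subst (asm) to_LP_clear) (simp_all add: N_def)
  hence "X0 = to_LP (normal_form A B)" using lp_q_neq_0 by simp
  thus "X0 \<in> range to_LP" by blast
qed

section \<open>Seven-dimensional linear algebra\<close>

lemma exhaust_7: "(i::7) = 0 \<or> i = 1 \<or> i = 2 \<or> i = 3 \<or> i = 4 \<or> i = 5 \<or> i = 6"
proof (induct i)
  case (of_int z)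
  hence "0 \<le> z" "z < 7" by simp_all
  hence "z = 0 \<or> z = 1 \<or> z = 2 \<or> z = 3 \<or> z = 4 \<or> z = 5 \<or> z = 6" by arith
  thus ?case by auto
qed

lemma forall_7: "(\<forall>i::7. P i) \<longleftrightarrow> P 0 \<and> P 1 \<and> P 2 \<and> P 3 \<and> P 4 \<and> P 5 \<and> P 6"
  by (metis exhaust_7)

lemma UNIV_7: "(UNIV :: 7 set) = {0, 1, 2, 3, 4, 5, 6}"
  using exhaust_7 by auto

lemma sum_7: "sum f (UNIV :: 7 set) = f 0 + f 1 + f 2 + f 3 + f 4 + f 5 + f 6"
  unfolding UNIV_7 by (simp add: ac_simps)

lemma prod_7: "prod f (UNIV :: 7 set) = f 0 * f 1 * f 2 * f 3 * f 4 * f 5 * f 6"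
  unfolding UNIV_7 by (simp add: ac_simps)

text \<open>The order of the index type is that of the representatives.\<close>
lemma Rep_7: "Rep_bit1 (0::7) = 0" "Rep_bit1 (1::7) = 1" "Rep_bit1 (2::7) = 2" "Rep_bit1 (3::7) = 3"
  "Rep_bit1 (4::7) = 4" "Rep_bit1 (5::7) = 5" "Rep_bit1 (6::7) = 6"
  by (simp_all add: bit1.Rep_numeral bit1.Rep_0 bit1.Rep_1)

text \<open>The vector with the given seven components.\<close>
definition vec7 :: "complex \<Rightarrow> complex \<Rightarrow> complex \<Rightarrow> complex \<Rightarrow> complex \<Rightarrow> complex \<Rightarrow> complex \<Rightarrow> complex^7"
  where "vec7 a b c d e f g = (\<chi> i. if i = 0 then a else if i = 1 then b else if i = 2 then c
    else if i = 3 then d else if i = 4 then e else if i = 5 then f else g)"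

lemma vec7_nth [simp]:
  "vec7 a b c d e f g $ 0 = a" "vec7 a b c d e f g $ 1 = b" "vec7 a b c d e f g $ 2 = c"
  "vec7 a b c d e f g $ 3 = d" "vec7 a b c d e f g $ 4 = e" "vec7 a b c d e f g $ 5 = f"
  "vec7 a b c d e f g $ 6 = g"
  by (simp_all add: vec7_def)

lemma vec7_eqI:
  fixes x y :: "complex^7"
  assumes "x $ 0 = y $ 0" "x $ 1 = y $ 1" "x $ 2 = y $ 2" "x $ 3 = y $ 3" "x $ 4 = y $ 4"
    "x $ 5 = y $ 5" "x $ 6 = y $ 6"
  shows "x = y"
  using assms by (simp add: vec_eq_iff forall_7)

lemma vec7_eq_0_iff [simp]:
  "vec7 a b c d e f g = 0 \<longleftrightarrow> a = 0 \<and> b = 0 \<and> c = 0 \<and> d = 0 \<and> e = 0 \<and> f = 0 \<and> g = 0"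
  by (auto simp: vec_eq_iff forall_7)

lemma matrix_mult_entry: "((A::complex^7^7) ** B) $ i $ j = (\<Sum>k\<in>UNIV. A $ i $ k * B $ k $ j)"
  by (simp add: matrix_matrix_mult_def)

section \<open>The three-form, the cross product and the invariant bilinear form\<close>

lemma G2_form_explicit:
  "G2_form x y z =
    (x$3*y$1*z$5 + x$1*y$5*z$3 + x$5*y$3*z$1 - x$3*y$5*z$1 - x$1*y$3*z$5 - x$5*y$1*z$3) +
    (x$3*y$2*z$4 + x$2*y$4*z$3 + x$4*y$3*z$2 - x$3*y$4*z$2 - x$2*y$3*z$4 - x$4*y$2*z$3) +
    (x$3*y$6*z$0 + x$6*y$0*z$3 + x$0*y$3*z$6 - x$3*y$0*z$6 - x$6*y$3*z$0 - x$0*y$6*z$3) +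
    (x$1*y$2*z$6 + x$2*y$6*z$1 + x$6*y$1*z$2 - x$1*y$6*z$2 - x$2*y$1*z$6 - x$6*y$2*z$1) +
    (x$5*y$4*z$0 + x$4*y$0*z$5 + x$0*y$5*z$4 - x$5*y$0*z$4 - x$4*y$5*z$0 - x$0*y$4*z$5)"
  unfolding G2_form_def wedge3_def det_3 vector_3 by (simp add: algebra_simps)

text \<open>The symmetric bilinear form preserved by \<open>G\<^sub>2\<close>. The coefficient \<open>-2\<close> is forced by \<open>cross_cross\<close>.\<close>
definition bil :: "complex^7 \<Rightarrow> complex^7 \<Rightarrow> complex"
  where "bil x y = x$0*y$6 + x$6*y$0 + x$1*y$5 + x$5*y$1 + x$2*y$4 + x$4*y$2 - 2*(x$3*y$3)"

text \<open>The vector that represents the linear form \<open>z \<mapsto> G2_form x y z\<close> with respect to \<open>bil\<close>; this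
  is a multiple of the vector product of the trace zero octonions.\<close>
definition cross :: "complex^7 \<Rightarrow> complex^7 \<Rightarrow> complex^7"
  where "cross x y = vec7
    (x$0*y$3 - x$3*y$0 + x$1*y$2 - x$2*y$1)
    (x$3*y$1 - x$1*y$3 + x$4*y$0 - x$0*y$4)
    (x$3*y$2 - x$2*y$3 + x$0*y$5 - x$5*y$0)
    (- (x$1*y$5 - x$5*y$1 + x$2*y$4 - x$4*y$2 + x$6*y$0 - x$0*y$6) / 2)
    (x$4*y$3 - x$3*y$4 + x$6*y$1 - x$1*y$6)
    (x$5*y$3 - x$3*y$5 + x$2*y$6 - x$6*y$2)
    (x$3*y$6 - x$6*y$3 + x$5*y$4 - x$4*y$5)"

lemma G2_form_eq_bil_cross: "G2_form x y z = bil (cross x y) z"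
  unfolding G2_form_explicit bil_def cross_def by (simp add: algebra_simps)

text \<open>This identity determines \<open>bil\<close> by the product, which is the reason for the invariance of \<open>bil\<close>.\<close>
lemma cross_cross: "cross x (cross x y) = (bil x y / 2) *s x - (bil x x / 2) *s y"
  by (rule vec7_eqI) (simp_all add: cross_def bil_def field_simps)

lemma bil_commute: "bil x y = bil y x"
  by (simp add: bil_def algebra_simps)

lemma bil_smult_left: "bil (c *s x) y = c * bil x y"
  by (simp add: bil_def algebra_simps)

lemma bil_nondegenerate:
  assumes "\<And>z. bil x z = bil y z"
  shows "x = y"
proof (rule vec7_eqI)
  show "x $ 0 = y $ 0" using assms[of "vec7 0 0 0 0 0 0 1"] by (simp add: bil_def)
  show "x $ 1 = y $ 1" using assms[of "vec7 0 0 0 0 0 1 0"] by (simp add: bil_def)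
  show "x $ 2 = y $ 2" using assms[of "vec7 0 0 0 0 1 0 0"] by (simp add: bil_def)
  show "x $ 3 = y $ 3" using assms[of "vec7 0 0 0 1 0 0 0"] by (simp add: bil_def)
  show "x $ 4 = y $ 4" using assms[of "vec7 0 0 1 0 0 0 0"] by (simp add: bil_def)
  show "x $ 5 = y $ 5" using assms[of "vec7 0 1 0 0 0 0 0"] by (simp add: bil_def)
  show "x $ 6 = y $ 6" using assms[of "vec7 1 0 0 0 0 0 0"] by (simp add: bil_def)
qed

lemma cross_smult_right: "cross x (c *s y) = c *s cross x y"
  by (rule vec7_eqI) (simp_all add: cross_def field_simps)

section \<open>Invariance of the bilinear form\<close>

lemma G2_form_invariant: "g \<in> G2 \<Longrightarrow> G2_form (g *v x) (g *v y) (g *v z) = G2_form x y z"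
  by (simp add: G2_def)

lemma G2_mult: "g \<in> G2 \<Longrightarrow> h \<in> G2 \<Longrightarrow> g ** h \<in> G2"
  by (simp add: G2_def det_mul flip: matrix_vector_mul_assoc)

lemma G2_inverse_matrix:
  assumes "g \<in> G2"
  shows "matrix_inv g ** g = mat 1" "g ** matrix_inv g = mat 1" 
proof -
  have "\<exists>h. g ** h = mat 1 \<and> h ** g = mat 1"
    using assms by (simp add: G2_def invertible_det_nz flip: invertible_def)
  hence "g ** matrix_inv g = mat 1 \<and> matrix_inv g ** g = mat 1"
    unfolding matrix_inv_def by (rule someI_ex)
  thus "matrix_inv g ** g = mat 1" "g ** matrix_inv g = mat 1" 
    by simp_all
qed

lemma G2_inverse:
  assumes "g \<in> G2"
  shows "matrix_inv g \<in> G2"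
proof -
  let ?h = "matrix_inv g"
  note inv = G2_inverse_matrix[OF assms]
  have "det ?h * det g = 1" using inv(1) by (metis det_mul det_I)
  hence "det ?h = 1" using assms by (simp add: G2_def)
  moreover have "G2_form (?h *v x) (?h *v y) (?h *v z) = G2_form x y z" for x y z
    using G2_form_invariant[OF assms, of "?h *v x" "?h *v y" "?h *v z"]
    by (simp add: matrix_vector_mul_assoc inv)
  ultimately show ?thesis by (simp add: G2_def)
qed

lemma G2_cancel:
  assumes "g \<in> G2"
  shows "matrix_inv g *v (g *v x) = x" "g *v (matrix_inv g *v x) = x"
  by (simp_all add: matrix_vector_mul_assoc G2_inverse_matrix[OF assms])

text \<open>Only the vanishing of the product is at first known to be invariant, since \<open>cross\<close> is defined by means
  of \<open>bil\<close>, while \<open>cross x y = 0\<close> says that \<open>G2_form x y\<close> is zero.\<close>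
lemma G2_cross_zero:
  assumes g: "g \<in> G2" and "cross x y = 0"
  shows "cross (g *v x) (g *v y) = 0"
proof (rule bil_nondegenerate)
  fix z
  have "bil (cross (g *v x) (g *v y)) z = G2_form (g *v x) (g *v y) (g *v (matrix_inv g *v z))"
    by (simp add: G2_form_eq_bil_cross G2_cancel[OF g])
  also have "\<dots> = G2_form x y (matrix_inv g *v z)"
    using g by (rule G2_form_invariant)
  also have "\<dots> = bil 0 z"
    using assms(2) by (simp add: G2_form_eq_bil_cross bil_def)
  finally show "bil (cross (g *v x) (g *v y)) z = bil 0 z" .
qed

text \<open>If \<open>cross x y = 0\<close> for linearly independent \<open>x, y\<close>, then \<open>x\<close> is isotropic by \<open>cross_cross\<close>. The
  hypothesis is invariant under \<open>G\<^sub>2\<close>, hence \<open>g\<close> maps such \<open>x\<close> to isotropic vectors.\<close>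
lemma G2_isotropic:
  assumes g: "g \<in> G2" and cr: "cross x y = 0" and ind: "x $ i * y $ j \<noteq> x $ j * y $ i"
  shows "bil (g *v x) (g *v x) = 0"
proof (rule ccontr)
  assume nz: "bil (g *v x) (g *v x) \<noteq> 0"
  let ?b = "bil (g *v x) (g *v y)" and ?q = "bil (g *v x) (g *v x)"
  have "(?b / 2) *s (g *v x) - (?q / 2) *s (g *v y) = 0"
    using cross_cross[of "g *v x" "g *v y"] G2_cross_zero[OF g cr]
    by (simp add: cross_def vec_eq_iff forall_7)
  hence "matrix_inv g *v ((?b / 2) *s (g *v x) - (?q / 2) *s (g *v y)) = 0"
    by (simp add: matrix_vector_mult_0_right)
  hence "(?b / 2) *s x - (?q / 2) *s y = 0"
    by (simp add: matrix_vector_mult_diff_distrib vector_scalar_commute[symmetric] G2_cancel[OF g])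
  hence e: "?b * x $ k = ?q * y $ k" for k
    by (simp add: vec_eq_iff)
  have "?q * (x $ i * y $ j) = x $ i * (?q * y $ j)" by simp
  also have "\<dots> = x $ j * (?b * x $ i)" by (simp flip: e)
  also have "\<dots> = ?q * (x $ j * y $ i)" by (simp add: e)
  finally show False using nz ind by simp
qed

text \<open>The Gram matrix of the transported form \<open>(x, y) \<mapsto> bil (g x) (g y)\<close>.\<close>
definition gram :: "complex^7^7 \<Rightarrow> complex^7^7"
  where "gram g = (\<chi> i j. bil (g *v axis i 1) (g *v axis j 1))"

lemma bil_add_left: "bil (x + y) z = bil x z + bil y z"
  and bil_add_right: "bil z (x + y) = bil z x + bil z y"
  by (simp_all add: bil_def algebra_simps)

lemma bil_smult_right: "bil x (c *s y) = c * bil x y"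
  by (simp add: bil_def algebra_simps)

lemma bil_gram: "bil (g *v x) (g *v y) = (\<Sum>i\<in>UNIV. \<Sum>j\<in>UNIV. x $ i * y $ j * gram g $ i $ j)"
proof -
  have dec: "z = (z$0) *s axis 0 1 + (z$1) *s axis 1 1 + (z$2) *s axis 2 1 + (z$3) *s axis 3 1
     + (z$4) *s axis 4 1 + (z$5) *s axis 5 1 + (z$6) *s axis 6 1" for z :: "complex^7"
    by (rule vec7_eqI) (simp_all add: axis_def)
  show ?thesis
    by (subst (1) dec[of x], subst (1) dec[of y])
      (simp add: matrix_vector_right_distrib vector_scalar_commute bil_add_left bil_add_right
        bil_smult_left bil_smult_right gram_def sum_7 algebra_simps)
qed

lemma gram_commute: "gram g $ i $ j = gram g $ j $ i"
  by (simp add: gram_def bil_commute)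

lemma G2_gram_zero:
  assumes "g \<in> G2" and "cross x y = 0" and "x $ i * y $ j \<noteq> x $ j * y $ i"
  shows "(\<Sum>i\<in>UNIV. \<Sum>j\<in>UNIV. x $ i * x $ j * gram g $ i $ j) = 0"
  using G2_isotropic[OF assms] by (simp add: bil_gram)

text \<open>The transported form vanishes on all isotropic vectors to which \<open>G2_isotropic\<close> applies. The following
  ones suffice to conclude that it is a multiple of \<open>bil\<close>: the basis vectors other than the middle one,
  sums of two of them that are not opposite, and three families of vectors with a non-zero
  middle component.\<close>
lemma G2_bil_similitude:
  assumes g: "g \<in> G2"
  obtains c where "\<And>x y. bil (g *v x) (g *v y) = c * bil x y"
proof -
  define M where "M = gram g"
  have Q: "(\<Sum>i\<in>UNIV. \<Sum>j\<in>UNIV. x $ i * x $ j * M $ i $ j) = 0"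
    if "cross x y = 0" "x $ i * y $ j \<noteq> x $ j * y $ i" for x y i j
    using G2_gram_zero[OF g that] by (simp add: M_def)
  have sym: "M $ 1 $ 0 = M $ 0 $ 1" "M $ 2 $ 0 = M $ 0 $ 2" "M $ 3 $ 0 = M $ 0 $ 3" 
    "M $ 4 $ 0 = M $ 0 $ 4" "M $ 5 $ 0 = M $ 0 $ 5" "M $ 6 $ 0 = M $ 0 $ 6"
    "M $ 2 $ 1 = M $ 1 $ 2" "M $ 3 $ 1 = M $ 1 $ 3" "M $ 4 $ 1 = M $ 1 $ 4" "M $ 5 $ 1 = M $ 1 $ 5"
    "M $ 6 $ 1 = M $ 1 $ 6" "M $ 3 $ 2 = M $ 2 $ 3" "M $ 4 $ 2 = M $ 2 $ 4" "M $ 5 $ 2 = M $ 2 $ 5"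
    "M $ 6 $ 2 = M $ 2 $ 6" "M $ 4 $ 3 = M $ 3 $ 4" "M $ 5 $ 3 = M $ 3 $ 5" "M $ 6 $ 3 = M $ 3 $ 6"
    "M $ 5 $ 4 = M $ 4 $ 5" "M $ 6 $ 4 = M $ 4 $ 6" "M $ 6 $ 5 = M $ 5 $ 6"
    unfolding M_def by (rule gram_commute)+
  note red = sum_7 sym cross_def
  \<comment> \<open>each pair consists of an isotropic vector and a vector with which its product vanishes\<close>
  have d: "M $ 0 $ 0 = 0" "M $ 1 $ 1 = 0" "M $ 2 $ 2 = 0" "M $ 4 $ 4 = 0" "M $ 5 $ 5 = 0" "M $ 6 $ 6 = 0"
    using Q[of "vec7 1 0 0 0 0 0 0" "vec7 0 1 0 0 0 0 0" 0 1]
      Q[of "vec7 0 1 0 0 0 0 0" "vec7 1 0 0 0 0 0 0" 1 0]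
      Q[of "vec7 0 0 1 0 0 0 0" "vec7 1 0 0 0 0 0 0" 2 0]
      Q[of "vec7 0 0 0 0 1 0 0" "vec7 0 1 0 0 0 0 0" 4 1]
      Q[of "vec7 0 0 0 0 0 1 0" "vec7 0 0 1 0 0 0 0" 5 2]
      Q[of "vec7 0 0 0 0 0 0 1" "vec7 0 0 0 0 1 0 0" 6 4]
    by (simp_all add: red)
  have l: "M $ 0 $ 1 = 0" "M $ 0 $ 2 = 0" "M $ 1 $ 4 = 0" "M $ 2 $ 5 = 0" "M $ 4 $ 6 = 0" "M $ 5 $ 6 = 0"
    using Q[of "vec7 1 1 0 0 0 0 0" "vec7 1 0 0 0 0 0 0" 1 0]
      Q[of "vec7 1 0 1 0 0 0 0" "vec7 1 0 0 0 0 0 0" 2 0]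
      Q[of "vec7 0 1 0 0 1 0 0" "vec7 0 1 0 0 0 0 0" 4 1]
      Q[of "vec7 0 0 1 0 0 1 0" "vec7 0 0 1 0 0 0 0" 5 2]
      Q[of "vec7 0 0 0 0 1 0 1" "vec7 0 0 0 0 1 0 0" 6 4]
      Q[of "vec7 0 0 0 0 0 1 1" "vec7 0 0 0 0 0 1 0" 6 5]
    by (simp_all add: red d)
  have s: "M $ 1 $ 2 = 0" "M $ 0 $ 4 = 0" "M $ 0 $ 5 = 0" "M $ 1 $ 6 = 0" "M $ 2 $ 6 = 0" "M $ 4 $ 5 = 0"
    using Q[of "vec7 0 1 1 0 0 0 0" "vec7 1 0 0 0 0 0 0" 1 0]
      Q[of "vec7 1 0 0 0 1 0 0" "vec7 0 1 0 0 0 0 0" 0 1]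
      Q[of "vec7 1 0 0 0 0 1 0" "vec7 0 0 1 0 0 0 0" 0 2]
      Q[of "vec7 0 1 0 0 0 0 1" "vec7 0 0 0 0 1 0 0" 1 4]
      Q[of "vec7 0 0 1 0 0 0 1" "vec7 0 0 0 0 0 1 0" 2 5]
      Q[of "vec7 0 0 0 0 1 1 0" "vec7 0 0 0 0 0 0 1" 4 6]
    by (simp_all add: red d)
  \<comment> \<open>the coefficients of a cubic polynomial without constant term that is identically zero\<close>
  have z: "a = 0 \<and> b = 0 \<and> c + 2 * e = 0"
    if "\<And>t. t * t * c + 2 * t * a + 2 * t * t * e + 2 * t * t * t * b = 0" for a b c e :: complex
  proof -
    have e: "c + 2 * a + 2 * e + 2 * b = 0" "c - 2 * a + 2 * e - 2 * b = 0" 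
        "4 * c + 4 * a + 8 * e + 16 * b = 0"
      using that[of 1] that[of "-1"] that[of 2] by simp_all
    have "2 * (c + 2 * e) = (c + 2 * a + 2 * e + 2 * b) + (c - 2 * a + 2 * e - 2 * b)"
      "12 * b = (4 * c + 4 * a + 8 * e + 16 * b) - 3 * (c + 2 * a + 2 * e + 2 * b) - (c - 2 * a + 2 * e - 2 * b)"
      "12 * a = 6 * (c + 2 * a + 2 * e + 2 * b) - 2 * (c - 2 * a + 2 * e - 2 * b) - (4 * c + 4 * a + 8 * e + 16 * b)"
      by (simp_all add: algebra_simps)
    hence "2 * (c + 2 * e) = 0" "12 * b = 0" "12 * a = 0" unfolding e by simp_all
    thus ?thesis by (simp only: mult_eq_0_iff) simp
  qed
  have "- M $ 2 $ 3 = 0 \<and> - M $ 3 $ 4 = 0 \<and> M $ 3 $ 3 + 2 * M $ 2 $ 4 = 0"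
  proof (rule z)
    fix t :: complex
    show "t * t * M$3$3 + 2 * t * (- M$2$3) + 2 * t * t * M$2$4 + 2 * t * t * t * (- M$3$4) = 0"
      using Q[of "vec7 0 0 1 (-t) (t*t) 0 0" "vec7 1 t 0 0 0 0 0" 2 0]
      by (simp add: red d algebra_simps)
  qed
  moreover have "M $ 1 $ 3 = 0 \<and> M $ 3 $ 5 = 0 \<and> M $ 3 $ 3 + 2 * M $ 1 $ 5 = 0"
  proof (rule z)
    fix t :: complex
    show "t * t * M$3$3 + 2 * t * M$1$3 + 2 * t * t * M$1$5 + 2 * t * t * t * M$3$5 = 0"
      using Q[of "vec7 0 1 0 t 0 (t*t) 0" "vec7 1 0 t 0 0 0 0" 1 0]
      by (simp add: red d algebra_simps)
  qed
  moreover have "M $ 0 $ 3 = 0 \<and> M $ 3 $ 6 = 0 \<and> M $ 3 $ 3 + 2 * M $ 0 $ 6 = 0"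
  proof (rule z)
    fix t :: complex
    show "t * t * M$3$3 + 2 * t * M$0$3 + 2 * t * t * M$0$6 + 2 * t * t * t * M$3$6 = 0"
      using Q[of "vec7 1 0 0 t 0 0 (t*t)" "vec7 0 1 0 0 t 0 0" 0 1]
      by (simp add: red d algebra_simps)
  qed
  ultimately have z3: "M $ 2 $ 3 = 0" "M $ 3 $ 4 = 0" "M $ 1 $ 3 = 0" "M $ 3 $ 5 = 0" "M $ 0 $ 3 = 0" 
      "M $ 3 $ 6 = 0" and "M $ 3 $ 3 = - 2 * M $ 0 $ 6" "M $ 3 $ 3 = - 2 * M $ 1 $ 5" "M $ 3 $ 3 = - 2 * M $ 2 $ 4"
    by (simp_all add: eq_neg_iff_add_eq_0)
  hence m: "M $ 2 $ 4 = M $ 0 $ 6" "M $ 1 $ 5 = M $ 0 $ 6" "M $ 3 $ 3 = - 2 * M $ 0 $ 6"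
    by simp_all
  have "bil (g *v x) (g *v y) = M $ 0 $ 6 * bil x y" for x y
    unfolding bil_gram M_def[symmetric] by (simp add: sum_7 sym d l s z3 m bil_def algebra_simps)
  thus ?thesis using that by blast
qed

lemma det_gram_one: "det (gram (mat 1)) \<noteq> 0"
proof -
  have e: "gram (mat 1) $ i $ j = bil (axis i 1) (axis j 1)" for i j
    by (simp add: gram_def)
  have "gram (mat 1) ** gram (mat 1) = (\<chi> i j. if i = j then if i = 3 then 4 else 1 else 0)"
    by (simp add: vec_eq_iff forall_7 matrix_mult_entry sum_7 e bil_def axis_def)
  hence "det (gram (mat 1)) * det (gram (mat 1)) = 4"
    by (simp add: det_diagonal prod_7 flip: det_mul)
  thus ?thesis by auto
qed

lemma gram_eq: "gram g = transpose g ** gram (mat 1) ** g"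
proof -
  have "bil (g *v axis i 1) (g *v axis j 1) = (transpose g ** gram (mat 1) ** g) $ i $ j" for i j
  proof -
    have a: "(g *v axis j 1) $ k = g $ k $ j" for j k
      by (simp add: matrix_vector_mult_def axis_def if_distrib[where f = "\<lambda>x. _ * x"] cong: if_cong)
    have e: "gram (mat 1) $ i $ j = bil (axis i 1) (axis j 1)" for i j
      by (simp add: gram_def)
    have ax: "axis i (1::complex) $ j = (if j = i then 1 else 0)" for i j :: 7
      by (simp add: axis_def)
    show ?thesis
      by (simp add: matrix_mult_entry sum_7 transpose_def e bil_def a ax algebra_simps)
  qed
  thus ?thesis by (simp add: gram_def vec_eq_iff)
qed

text \<open>The similitude factor \<open>c\<close> is trivial: taking determinants gives \<open>c ^ 7 = 1\<close>, as \<open>det g = 1\<close>, and the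
  transformation of \<open>cross_cross\<close> under \<open>g\<close> gives \<open>c ^ 3 = 1\<close>.\<close>
theorem G2_bil_invariant:
  assumes g: "g \<in> G2"
  shows "bil (g *v x) (g *v y) = bil x y"
proof -
  obtain c where c: "\<And>x y. bil (g *v x) (g *v y) = c * bil x y"
    using G2_bil_similitude[OF g] by blast
  have "gram g $ i $ j = (mat c ** gram (mat 1)) $ i $ j" for i j
  proof -
    have "(mat c :: complex^7^7) $ i $ k = (if i = k then c else 0)" for i k
      by (simp add: mat_def)
    thus ?thesis
      by (simp add: matrix_mult_entry if_distrib[where f = "\<lambda>x. x * _"] cong: if_cong)
        (simp add: gram_def c)
  qed
  hence "gram g = mat c ** gram (mat 1)"
    by (simp add: vec_eq_iff)
  moreover have "det (mat c :: complex^7^7) = c ^ 7"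
    by (subst det_diagonal) (simp_all add: mat_def prod_7 eval_nat_numeral)
  ultimately have "c ^ 7 * det (gram (mat 1)) = det g * det (gram (mat 1)) * det g"
    by (metis gram_eq det_mul det_transpose)
  hence c7: "c ^ 7 = 1"
    using g det_gram_one by (simp add: G2_def)
  hence c0: "c \<noteq> 0" by auto
  have cr: "cross (g *v x) (g *v y) = (1 / c) *s (g *v cross x y)" for x y
  proof (rule bil_nondegenerate)
    fix z
    have "bil (cross (g *v x) (g *v y)) z = G2_form (g *v x) (g *v y) (g *v (matrix_inv g *v z))"
      by (simp add: G2_form_eq_bil_cross G2_cancel[OF g])
    also have "\<dots> = bil (cross x y) (matrix_inv g *v z)"
      unfolding G2_form_invariant[OF g] by (rule G2_form_eq_bil_cross)
    also have "\<dots> = (1 / c) * bil (g *v cross x y) (g *v (matrix_inv g *v z))"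
      using c0 by (simp add: c)
    finally show "bil (cross (g *v x) (g *v y)) z = bil ((1 / c) *s (g *v cross x y)) z"
      by (simp add: bil_smult_left G2_cancel[OF g])
  qed
  let ?x = "vec7 1 0 0 0 0 0 0" and ?y = "vec7 0 0 0 0 0 0 1"
  have b: "bil ?x ?x = 0" "bil ?x ?y = 1" by (simp_all add: bil_def)
  have "cross (g *v ?x) (cross (g *v ?x) (g *v ?y)) = (c / 2) *s (g *v ?x)"
    by (simp add: cross_cross c b)
  moreover have "cross (g *v ?x) (cross (g *v ?x) (g *v ?y)) = (1 / (2 * c * c)) *s (g *v ?x)"
    by (simp add: cr cross_smult_right cross_cross b vector_scalar_commute[symmetric])
      (simp add: vector_scalar_commute vector_smult_assoc)
  ultimately have "(c / 2) *s (g *v ?x) = (1 / (2 * c * c)) *s (g *v ?x)" by (rule trans[OF sym])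
  hence "matrix_inv g *v ((c / 2) *s (g *v ?x)) = matrix_inv g *v ((1 / (2 * c * c)) *s (g *v ?x))"
    by (rule arg_cong)
  hence "(c / 2) *s ?x = (1 / (2 * c * c)) *s ?x"
    by (simp only: vector_scalar_commute G2_cancel[OF g])
  hence "(c / 2) * (?x $ 0) = (1 / (2 * c * c)) * (?x $ 0)" by (metis vector_smult_component)
  hence "c ^ 3 = 1" using c0 by (simp add: field_simps power3_eq_cube)
  moreover have "c ^ 7 = c * (c ^ 3) ^ 2"
    by (simp add: eval_nat_numeral)
  ultimately have "c = 1" using c7 by simp
  thus ?thesis by (simp add: c)
qed

section \<open>Root elements\<close>

text \<open>\<open>entry_matrix es\<close> is the identity matrix with the entries of \<open>es\<close>, listed as (value, row, column),
  added.\<close>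

definition entry_matrix :: "(complex \<times> 7 \<times> 7) list \<Rightarrow> complex^7^7"
  where "entry_matrix es = (\<chi> i j. (if i = j then 1 else 0) + (\<Sum>(c, k, l)\<leftarrow>es. if i = k \<and> j = l then c else 0))"

lemma entry_matrix_nth:
  "entry_matrix es $ i $ j = (if i = j then 1 else 0) + (\<Sum>(c, k, l)\<leftarrow>es. if i = k \<and> j = l then c else 0)"
  by (simp add: entry_matrix_def)

text \<open>The one-parameter subgroups of \<open>G\<^sub>2\<close> of the positive roots \<open>\<alpha>\<^sub>1\<close>, \<open>\<alpha>\<^sub>2\<close>, \<open>\<alpha>\<^sub>1 + \<alpha>\<^sub>2\<close>, \<open>2\<alpha>\<^sub>1 + \<alpha>\<^sub>2\<close>
  and of the negative roots \<open>-\<alpha>\<^sub>1\<close>, \<open>-\<alpha>\<^sub>2\<close>, \<open>-2\<alpha>\<^sub>1 - \<alpha>\<^sub>2\<close>.\<close>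
definition x_a :: "complex \<Rightarrow> complex^7^7"
  where "x_a t = entry_matrix [(t, 0, 1), (-2*t, 2, 3), (-t, 3, 4), (t^2, 2, 4), (-t, 5, 6)]"
definition x_b :: "complex \<Rightarrow> complex^7^7"
  where "x_b t = entry_matrix [(t, 1, 2), (-t, 4, 5)]"
definition x_ab :: "complex \<Rightarrow> complex^7^7"
  where "x_ab t = entry_matrix [(t, 0, 2), (2*t, 1, 3), (t, 3, 5), (t^2, 1, 5), (-t, 4, 6)]"
definition x_aab :: "complex \<Rightarrow> complex^7^7"
  where "x_aab t = entry_matrix [(2*t, 0, 3), (t, 1, 4), (-t, 2, 5), (t, 3, 6), (t^2, 0, 6)]"
definition y_a :: "complex \<Rightarrow> complex^7^7"
  where "y_a t = entry_matrix [(t, 1, 0), (-t, 3, 2), (t^2, 4, 2), (-2*t, 4, 3), (-t, 6, 5)]"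
definition y_b :: "complex \<Rightarrow> complex^7^7"
  where "y_b t = entry_matrix [(t, 2, 1), (-t, 5, 4)]"

definition y_aab :: "complex \<Rightarrow> complex^7^7"
  where "y_aab t = entry_matrix [(t, 3, 0), (t, 4, 1), (-t, 5, 2), (2*t, 6, 3), (t^2, 6, 0)]"

lemmas root_defs = x_a_def x_b_def x_ab_def x_aab_def y_a_def y_b_def y_aab_def

lemma x_a_upper: "x_a t \<in> upper_unitriangular" 
  and x_b_upper: "x_b t \<in> upper_unitriangular" 
  and x_ab_upper: "x_ab t \<in> upper_unitriangular" 
  and x_aab_upper: "x_aab t \<in> upper_unitriangular" 
  by (simp_all add: upper_unitriangular_def forall_7 root_defs entry_matrix_nth Rep_7 less_bit1_def)

lemma y_a_lower: "y_a t \<in> lower_unitriangular" 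
  and y_b_lower: "y_b t \<in> lower_unitriangular" 
  and y_aab_lower: "y_aab t \<in> lower_unitriangular" 
  by (simp_all add: lower_unitriangular_def forall_7 root_defs entry_matrix_nth Rep_7 less_bit1_def)

lemma det_upper_unitriangular: "g \<in> upper_unitriangular \<Longrightarrow> det (g :: complex^7^7) = 1"
  by (subst det_upperdiagonal) (auto simp: upper_unitriangular_def)

lemma det_lower_unitriangular: "g \<in> lower_unitriangular \<Longrightarrow> det (g :: complex^7^7) = 1"
  by (subst det_lowerdiagonal) (auto simp: lower_unitriangular_def)

lemmas G2_form_simps = G2_form_explicit matrix_vector_mult_def sum_7 entry_matrix_nth

lemma x_a_G2: "x_a t \<in> G2"
proof -
  have "G2_form (x_a t *v x) (x_a t *v y) (x_a t *v z) = G2_form x y z" for x y z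
    by (simp add: x_a_def G2_form_simps) (simp add: algebra_simps power2_eq_square)
  thus ?thesis by (simp add: G2_def det_upper_unitriangular[OF x_a_upper])
qed

lemma x_b_G2: "x_b t \<in> G2"
proof -
  have "G2_form (x_b t *v x) (x_b t *v y) (x_b t *v z) = G2_form x y z" for x y z
    by (simp add: x_b_def G2_form_simps) (simp add: algebra_simps power2_eq_square)
  thus ?thesis by (simp add: G2_def det_upper_unitriangular[OF x_b_upper])
qed

lemma x_ab_G2: "x_ab t \<in> G2"
proof -
  have "G2_form (x_ab t *v x) (x_ab t *v y) (x_ab t *v z) = G2_form x y z" for x y z
    by (simp add: x_ab_def G2_form_simps) (simp add: algebra_simps power2_eq_square)
  thus ?thesis by (simp add: G2_def det_upper_unitriangular[OF x_ab_upper])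
qed

lemma x_aab_G2: "x_aab t \<in> G2"
proof -
  have "G2_form (x_aab t *v x) (x_aab t *v y) (x_aab t *v z) = G2_form x y z" for x y z
    by (simp add: x_aab_def G2_form_simps) (simp add: algebra_simps power2_eq_square)
  thus ?thesis by (simp add: G2_def det_upper_unitriangular[OF x_aab_upper])
qed

lemma y_a_G2: "y_a t \<in> G2"
proof -
  have "G2_form (y_a t *v x) (y_a t *v y) (y_a t *v z) = G2_form x y z" for x y z
    by (simp add: y_a_def G2_form_simps) (simp add: algebra_simps power2_eq_square)
  thus ?thesis by (simp add: G2_def det_lower_unitriangular[OF y_a_lower])
qed

lemma y_b_G2: "y_b t \<in> G2"
proof -
  have "G2_form (y_b t *v x) (y_b t *v y) (y_b t *v z) = G2_form x y z" for x y z
    by (simp add: y_b_def G2_form_simps) (simp add: algebra_simps power2_eq_square)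
  thus ?thesis by (simp add: G2_def det_lower_unitriangular[OF y_b_lower])
qed

lemma y_aab_G2: "y_aab t \<in> G2"
proof -
  have "G2_form (y_aab t *v x) (y_aab t *v y) (y_aab t *v z) = G2_form x y z" for x y z
    by (simp add: y_aab_def G2_form_simps) (simp add: algebra_simps power2_eq_square)
  thus ?thesis by (simp add: G2_def det_lower_unitriangular[OF y_aab_lower])
qed

text \<open>The element of the maximal torus with prescribed first two diagonal entries.\<close>
definition torus :: "complex \<Rightarrow> complex \<Rightarrow> complex^7^7"
  where "torus a b = (\<chi> i j. if i = j then vec7 a b (a / b) 1 (b / a) (1 / b) (1 / a) $ i else 0)"

lemma torus_G2:
  assumes "a \<noteq> 0" "b \<noteq> 0"
  shows "torus a b \<in> G2"
proof -
  have "det (torus a b) = 1"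
    using assms by (subst det_diagonal) (simp_all add: torus_def prod_7)
  moreover have "G2_form (torus a b *v x) (torus a b *v y) (torus a b *v z) = G2_form x y z" for x y z
    using assms by (simp add: torus_def G2_form_explicit matrix_vector_mult_def sum_7) 
  ultimately show ?thesis by (simp add: G2_def)
qed

section \<open>The unipotent subgroup of \<open>SL\<^sub>3\<close>\<close>

text \<open>The image of the unitriangular matrix with entries \<open>x, y, z\<close> above the diagonal, where \<open>y\<close> is in the
  corner.\<close>
definition usl3 :: "complex \<Rightarrow> complex \<Rightarrow> complex \<Rightarrow> complex^7^7"
  where "usl3 x y z = entry_matrix [(x, 1, 2), (y, 1, 6), (z, 2, 6), (-x, 4, 5), (x*z - y, 0, 5), (-z, 0, 4)]"

lemma usl3_G2: "usl3 x y z \<in> U_G2"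
proof -
  have u: "usl3 x y z \<in> upper_unitriangular"
    by (simp add: upper_unitriangular_def forall_7 usl3_def entry_matrix_nth Rep_7 less_bit1_def)
  have "G2_form (usl3 x y z *v x') (usl3 x y z *v y') (usl3 x y z *v z') = G2_form x' y' z'" for x' y' z'
    by (simp add: usl3_def G2_form_simps) (simp add: algebra_simps power2_eq_square)
  thus ?thesis using u by (simp add: U_G2_def G2_def det_upper_unitriangular[OF u])
qed

lemma usl3_SL3: "usl3 x y z \<in> SL3"
proof -
  define A :: "complex^3^3" where "A = vector [vector [1, x, y], vector [0, 1, z], vector [0, 0, 1]]"
  define B :: "complex^3^3" where "B = vector [vector [1, -x, x*z-y], vector [0, 1, -z], vector [0, 0, 1]]"
  have d: "det A = 1" by (simp add: A_def det_3)
  have inv: "A ** B = mat 1" "B ** A = mat 1"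
    by (simp_all add: vec_eq_iff forall_3 matrix_matrix_mult_def sum_3 A_def B_def mat_def)
  have "A ** matrix_inv A = mat 1 \<and> matrix_inv A ** A = mat 1"
    unfolding matrix_inv_def by (rule someI_ex) (use inv in blast)
  hence B: "matrix_inv A = B"
    by (metis inv(2) matrix_mul_assoc matrix_mul_lid matrix_mul_rid)
  have "SL3_embedding A = usl3 x y z"
    by (simp add: vec_eq_iff forall_7 SL3_embedding_def B sum_3 std_index_def usl3_def entry_matrix_nth)
       (simp add: A_def B_def)
  thus ?thesis using d by (force simp: SL3_def)
qed

lemma usl3_U: "usl3 x y z \<in> U_SL3"
  using usl3_G2 usl3_SL3 by (simp add: U_SL3_def)

text \<open>The basis vectors \<open>e\<^sub>0, e\<^sub>1, e\<^sub>3\<close> are highest weight vectors of \<open>SL\<^sub>3\<close>.\<close>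
lemma U_SL3_columns:
  assumes "v \<in> U_SL3"
  shows "v $ i $ 0 = (if i = 0 then 1 else 0)" "v $ i $ 1 = (if i = 1 then 1 else 0)"
    "v $ i $ 3 = (if i = 3 then 1 else 0)"
proof -
  from assms have u: "v \<in> upper_unitriangular" and "v \<in> SL3"
    by (auto simp: U_SL3_def U_G2_def)
  then obtain A where v: "v = SL3_embedding A" by (auto simp: SL3_def)
  have U: "j < i \<Longrightarrow> v $ i $ j = 0" "v $ i $ i = 1" for i j
    using u by (auto simp: upper_unitriangular_def)
  have "i = 0 \<or> 0 < i" "i = 0 \<or> i = 1 \<or> 1 < i" using exhaust_7[of i]
    by (auto simp: less_bit1_def Rep_7)
  moreover have "v $ 0 $ 1 = 0" 
    by (simp add: v SL3_embedding_def std_index_def sum_3)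
  ultimately show "v $ i $ 0 = (if i = 0 then 1 else 0)" "v $ i $ 1 = (if i = 1 then 1 else 0)"
    using U by auto
  show "v $ i $ 3 = (if i = 3 then 1 else 0)"
    by (simp add: v SL3_embedding_def std_index_def sum_3)
qed

section \<open>Separation of generic orbits\<close>

text \<open>The vector that represents a row vector with respect to \<open>bil\<close>.\<close>
definition dual_vec :: "complex^7 \<Rightarrow> complex^7"
  where "dual_vec a = vec7 (a$6) (a$5) (a$4) (- a$3 / 2) (a$2) (a$1) (a$0)"

text \<open>The transpose of \<open>g\<close> is conjugate to its inverse under \<open>bil\<close>; this turns properties of columns into
  properties of rows.\<close>
lemma G2_inverse_row:
  assumes g: "g \<in> G2"
  shows "matrix_inv g *v axis 6 1 = dual_vec (g $ 0)" "matrix_inv g *v axis 5 1 = dual_vec (g $ 1)"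
proof -
  have *: "bil (matrix_inv g *v x) z = bil x (g *v z)" for x z
    using G2_bil_invariant[OF g, of "matrix_inv g *v x" z] by (simp add: G2_cancel[OF g])
  show "matrix_inv g *v axis 6 1 = dual_vec (g $ 0)"
    by (rule bil_nondegenerate)
      (simp add: *, simp add: bil_def axis_def dual_vec_def matrix_vector_mult_def sum_7 algebra_simps)
  show "matrix_inv g *v axis 5 1 = dual_vec (g $ 1)"
    by (rule bil_nondegenerate)
      (simp add: *, simp add: bil_def axis_def dual_vec_def matrix_vector_mult_def sum_7 algebra_simps)
qed

text \<open>The quadratic relations between the first two rows of an element of \<open>G\<^sub>2\<close>.\<close>
lemma G2_rows:
  assumes g: "g \<in> G2"
  shows "cross (dual_vec (g $ 0)) (dual_vec (g $ 1)) = 0" "bil (dual_vec (g $ 0)) (dual_vec (g $ 0)) = 0"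
proof -
  have "cross (axis 6 1) (axis 5 1) = 0"
    by (simp add: cross_def axis_def)
  from G2_cross_zero[OF G2_inverse[OF g] this]
  show "cross (dual_vec (g $ 0)) (dual_vec (g $ 1)) = 0" by (simp add: G2_inverse_row[OF g])
  have "bil (axis 6 1) (axis 6 1) = 0" by (simp add: bil_def axis_def)
  thus "bil (dual_vec (g $ 0)) (dual_vec (g $ 0)) = 0"
    by (simp add: G2_bil_invariant[OF G2_inverse[OF g]] flip: G2_inverse_row[OF g])
qed

text \<open>The stabiliser of the highest weight vectors is the opposite maximal unipotent subgroup. The columns
  \<open>5\<close> and \<open>6\<close> are known from the rows \<open>1\<close> and \<open>0\<close>, and the invariance of the three-form with one of
  these columns inserted yields the rows \<open>2, 3, 4\<close> as far as they are needed.\<close>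
lemma U_minus_criterion:
  assumes h: "h \<in> G2" and r: "h $ 0 = axis 0 1" "h $ 1 = axis 1 1"
  shows "h \<in> U_minus_G2"
proof -
  have "dual_vec (axis 0 1) = axis 6 1" "dual_vec (axis 1 1) = axis 5 1"
    by (rule vec7_eqI; simp add: dual_vec_def axis_def)+
  hence "matrix_inv h *v axis 6 1 = axis 6 1" "matrix_inv h *v axis 5 1 = axis 5 1"
    using G2_inverse_row[OF h] by (simp_all add: r)
  hence fixd: "h *v axis 6 1 = axis 6 1" "h *v axis 5 1 = axis 5 1"
    by (metis G2_cancel(2)[OF h])+
  have comp: "(h *v axis j 1) $ i = h $ i $ j" for i j
    by (simp add: matrix_vector_mult_def axis_def if_distrib[where f = "\<lambda>x. _ * x"] cong: if_cong)
  have ax: "axis i (1::complex) $ j = (if j = i then 1 else 0)" for i j :: 7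
    by (simp add: axis_def)
  have c6: "h $ i $ 6 = (if i = 6 then 1 else 0)" and c5: "h $ i $ 5 = (if i = 5 then 1 else 0)" for i
    by (simp_all add: fixd ax flip: comp)
  have r0: "h $ 0 $ i = (if i = 0 then 1 else 0)" and r1: "h $ 1 $ i = (if i = 1 then 1 else 0)" for i
    by (simp_all add: r ax)
  note inv = G2_form_invariant[OF h]
  have three: "h $ 3 $ k = (if k = 3 then 1 else 0)" if "k \<in> {3, 4}" for k
    using inv[of "axis 0 1" "axis 6 1" "axis k 1"] that
    by (auto simp: G2_form_explicit comp ax c5 c6 r0 r1)
  have two: "h $ 2 $ k = (if k = 2 then 1 else 0)" if "k \<in> {2, 3, 4}" for k
    using inv[of "axis 1 1" "axis 6 1" "axis k 1"] that
    by (auto simp: G2_form_explicit comp ax c5 c6 r0 r1)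
  have four: "h $ 4 $ 4 = 1"
    using inv[of "axis 0 1" "axis 5 1" "axis 4 1"]
    by (auto simp: G2_form_explicit comp ax c5 c6 r0 r1)
  have "h \<in> lower_unitriangular"
    by (simp add: lower_unitriangular_def forall_7 less_bit1_def Rep_7 c5 c6 r0 r1 two three four)
  thus ?thesis using h by (simp add: U_minus_G2_def)
qed

lemma row_mult: "((A::complex^7^7) ** B) $ i = (A $ i) v* B"
  by (simp add: vec_eq_iff matrix_mult_entry vector_matrix_mult_def mult.commute)

lemma same_rows_orbit:
  assumes g: "g \<in> G2" and g': "g' \<in> G2" and "g' $ 0 = g $ 0" "g' $ 1 = g $ 1"
  obtains u where "u \<in> U_minus_G2" "g' = u ** g"
proof -
  let ?u = "g' ** matrix_inv g"
  have "?u $ i = axis i 1" if "g' $ i = g $ i" for i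
  proof -
    have "?u $ i = (g ** matrix_inv g) $ i" by (simp add: row_mult that)
    thus ?thesis by (simp add: G2_inverse_matrix[OF g] mat_def axis_def vec_eq_iff)
  qed
  hence "?u \<in> U_minus_G2"
    using assms by (intro U_minus_criterion G2_mult G2_inverse) auto
  moreover have "g' = ?u ** g"
    by (simp add: G2_inverse_matrix[OF g] flip: matrix_mul_assoc)
  ultimately show ?thesis using that by blast
qed

text \<open>The minors of the first two rows.\<close>

definition minor :: "7 \<Rightarrow> 7 \<Rightarrow> complex^7^7 \<Rightarrow> complex"
  where "minor i j g = g $ 0 $ i * g $ 1 $ j - g $ 0 $ j * g $ 1 $ i"

lemma left_rows:
  fixes g :: "complex^7^7"
  assumes "u \<in> U_minus_G2"
  shows "(u ** g) $ 0 $ j = g $ 0 $ j" "(u ** g) $ 1 $ j = g $ 1 $ j + u $ 1 $ 0 * g $ 0 $ j"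
proof -
  have U: "u $ i $ i = 1" "i < j \<Longrightarrow> u $ i $ j = 0" for i j
    using assms by (auto simp: U_minus_G2_def lower_unitriangular_def)
  have z: "u $ 0 $ i = (if i = 0 then 1 else 0)" "u $ 1 $ i = (if i = 1 then 1 else if i = 0 then u $ 1 $ 0 else 0)" for i
    using U exhaust_7[of i] by (auto simp: less_bit1_def Rep_7)
  show "(u ** g) $ 0 $ j = g $ 0 $ j" "(u ** g) $ 1 $ j = g $ 1 $ j + u $ 1 $ 0 * g $ 0 $ j"
    by (simp_all add: matrix_mult_entry sum_7 z(1), simp add: z(2))
qed

lemma right_columns:
  assumes "v \<in> U_SL3" and "j \<in> {0, 1, 3}"
  shows "((g::complex^7^7) ** v) $ i $ j = g $ i $ j"
  using assms(2) by (auto simp: matrix_mult_entry sum_7 U_SL3_columns[OF assms(1)])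

lemma entry_invariant:
  assumes "u \<in> U_minus_G2" "v \<in> U_SL3" "j \<in> {0, 1, 3}"
  shows "(u ** g ** v) $ 0 $ j = g $ 0 $ j"
  using assms by (simp add: right_columns left_rows)

lemma minor_invariant:
  assumes "u \<in> U_minus_G2" "v \<in> U_SL3" "i \<in> {0, 1, 3}" "j \<in> {0, 1, 3}"
  shows "minor i j (u ** g ** v) = minor i j g"
  using assms by (simp add: minor_def right_columns left_rows algebra_simps)

text \<open>A normal form for generic double cosets of the two unipotent groups.\<close>
definition normalised :: "complex^7^7 \<Rightarrow> bool"
  where "normalised g \<longleftrightarrow> g $ 0 $ 2 = 0 \<and> g $ 0 $ 4 = 0 \<and> g $ 0 $ 6 = 0 \<and> g $ 1 $ 1 = 0"

lemma U_G2_subset: "u \<in> U_minus_G2 \<Longrightarrow> u \<in> G2" "v \<in> U_SL3 \<Longrightarrow> v \<in> G2"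
  by (auto simp: U_minus_G2_def U_SL3_def U_G2_def)

lemma exists_normalised:
  assumes g: "g \<in> G2" and nz: "g $ 0 $ 0 \<noteq> 0" "g $ 0 $ 1 \<noteq> 0"
  obtains u v where "u \<in> U_minus_G2" "v \<in> U_SL3" "normalised (u ** g ** v)"
proof -
  define x z where "x = - g $ 0 $ 2 / g $ 0 $ 1" and "z = g $ 0 $ 4 / g $ 0 $ 0"
  define y where "y = - (g $ 0 $ 6 + z * g $ 0 $ 2) / g $ 0 $ 1"
  define v where "v = usl3 x y z"
  define t where "t = - g $ 1 $ 1 / g $ 0 $ 1"
  have u: "y_a t \<in> U_minus_G2" using y_a_G2 y_a_lower by (simp add: U_minus_G2_def)
  have v: "v \<in> U_SL3" by (simp add: v_def usl3_U)
  have t: "y_a t $ 1 $ 0 = t" by (simp add: y_a_def entry_matrix_nth)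
  have c: "(g ** v) $ i $ 1 = g $ i $ 1" "(g ** v) $ i $ 2 = g $ i $ 2 + x * g $ i $ 1"
    "(g ** v) $ i $ 4 = g $ i $ 4 - z * g $ i $ 0" 
    "(g ** v) $ i $ 6 = g $ i $ 6 + y * g $ i $ 1 + z * g $ i $ 2" for i
    by (simp_all add: matrix_mult_entry sum_7 v_def usl3_def entry_matrix_nth)
  have "g $ 0 $ 2 + x * g $ 0 $ 1 = 0" "g $ 0 $ 4 - z * g $ 0 $ 0 = 0" 
     "g $ 0 $ 6 + y * g $ 0 $ 1 + z * g $ 0 $ 2 = 0" "g $ 1 $ 1 + t * g $ 0 $ 1 = 0"
    using nz by (simp_all add: x_def y_def z_def t_def)
  hence "normalised (y_a t ** (g ** v))"
    by (simp add: normalised_def left_rows[OF u] c t)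
  thus ?thesis using that[OF u v] by (simp add: matrix_mul_assoc)
qed

text \<open>The first two rows of a normalised element, as functions of the generators.\<close>
definition normal_row0 :: "complex \<Rightarrow> complex \<Rightarrow> complex \<Rightarrow> complex^7"
  where "normal_row0 p1 q s = vec7 p1 q 0 s 0 (s^2 / (4 * q)) 0"

definition normal_row1 :: "complex \<Rightarrow> complex \<Rightarrow> complex \<Rightarrow> complex \<Rightarrow> complex \<Rightarrow> complex^7"
  where "normal_row1 p1 q s p2 t = (let a5 = s^2 / (4 * q); b0 = - p2 / q; b3 = t / q;
       b4 = - t / (2 * p1); b2 = (s * b0 - p1 * b3) / (2 * q) in
       vec7 b0 0 b2 b3 b4 ((a5 * b0 - s * b2 / 2) / p1) (- s * b4 / (2 * q)))"

text \<open>The entries that are not normalised are determined by the relations \<open>G2_rows\<close>.\<close>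
lemma normalised_rows:
  assumes g: "g \<in> G2" and nz: "g $ 0 $ 0 \<noteq> 0" "g $ 0 $ 1 \<noteq> 0" and n: "normalised g"
  shows "g $ 0 = normal_row0 (g $ 0 $ 0) (g $ 0 $ 1) (g $ 0 $ 3)"
    and "g $ 1 = normal_row1 (g $ 0 $ 0) (g $ 0 $ 1) (g $ 0 $ 3) (minor 0 1 g) (minor 1 3 g)"
proof -
  have z: "g $ 0 $ 2 = 0" "g $ 0 $ 4 = 0" "g $ 0 $ 6 = 0" "g $ 1 $ 1 = 0"
    using n by (simp_all add: normalised_def)
  let ?a = "g $ 0" and ?b = "g $ 1"
  have "4 * (?a$1 * ?a$5) = (?a$3)^2"
    using G2_rows(2)[OF g] by (simp add: bil_def dual_vec_def z field_simps power2_eq_square)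
  hence a5: "?a $ 5 = (?a $ 3)^2 / (4 * ?a $ 1)" using nz by (simp add: field_simps)
  show "g $ 0 = normal_row0 (g $ 0 $ 0) (g $ 0 $ 1) (g $ 0 $ 3)"
    unfolding normal_row0_def by (rule vec7_eqI) (simp_all only: z a5 vec7_nth)
  have c: "cross (dual_vec ?a) (dual_vec ?b) $ i = 0" for i
    by (simp only: G2_rows(1)[OF g] zero_index)
  let ?c = "cross (dual_vec ?a) (dual_vec ?b)"
  have "2 * (?a$1 * ?b$6) = - (?a$3 * ?b$4) - 2 * ?c $ 2"
    "?a$0 * ?b$5 = ?a$5 * ?b$0 - ?a$3 * ?b$2 / 2 + ?c $ 4"
    "2 * (?a$0 * ?b$4) = - (?a$1 * ?b$3) - 2 * ?c $ 5"
    "2 * (?a$1 * ?b$2) = ?a$3 * ?b$0 - ?a$0 * ?b$3 + 2 * ?c $ 6"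
    by (simp_all add: cross_def dual_vec_def z)
  hence e1: "2 * (?a$1 * ?b$6) = - (?a$3 * ?b$4)"
    and e2: "?a$0 * ?b$5 = ?a$5 * ?b$0 - ?a$3 * ?b$2 / 2"
    and e3: "2 * (?a$0 * ?b$4) = - (?a$1 * ?b$3)"
    and e4: "2 * (?a$1 * ?b$2) = ?a$3 * ?b$0 - ?a$0 * ?b$3"
    unfolding c by simp_all
  have m: "minor 0 1 g = - (?a$1 * ?b$0)" "minor 1 3 g = ?a$1 * ?b$3"
    by (simp_all add: minor_def z)
  have b: "?b $ 0 = - minor 0 1 g / ?a $ 1" "?b $ 3 = minor 1 3 g / ?a $ 1"
    using nz by (simp_all add: m)
  have "?b $ 6 = - ?a $ 3 * ?b $ 4 / (2 * ?a $ 1)"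
    using e1 nz by (simp add: field_simps)
  moreover have "?b $ 5 = (?a $ 5 * ?b $ 0 - ?a $ 3 * ?b $ 2 / 2) / ?a $ 0"
    unfolding e2[symmetric] using nz by simp
  moreover have "?b $ 4 = - minor 1 3 g / (2 * ?a $ 0)"
    using e3 nz by (simp add: field_simps m)
  moreover have "?b $ 2 = (?a $ 3 * ?b $ 0 - ?a $ 0 * ?b $ 3) / (2 * ?a $ 1)"
    using e4 nz by (simp add: field_simps)
  ultimately show "g $ 1 = normal_row1 (g $ 0 $ 0) (g $ 0 $ 1) (g $ 0 $ 3) (minor 0 1 g) (minor 1 3 g)"
    unfolding normal_row1_def Let_def
    by (intro vec7_eqI) (simp_all only: z a5 b vec7_nth)
qed

text \<open>Where \<open>p\<^sub>1 q \<noteq> 0\<close>, the values of the generators determine those of all elements of the branching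
  algebra.\<close>
theorem separation:
  assumes f: "f \<in> carrier B_G2_SL3" and g: "g \<in> G2" and g': "g' \<in> G2"
    and nz: "g $ 0 $ 0 \<noteq> 0" "g $ 0 $ 1 \<noteq> 0"
    and eq: "g' $ 0 $ 0 = g $ 0 $ 0" "g' $ 0 $ 1 = g $ 0 $ 1" "g' $ 0 $ 3 = g $ 0 $ 3"
      "minor 0 1 g' = minor 0 1 g" "minor 1 3 g' = minor 1 3 g"
  shows "f g' = f g"
proof -
  have inv: "f (u ** g ** v) = f g" if "u \<in> U_minus_G2" "v \<in> U_SL3" "g \<in> G2" for u g v
    using f that by (simp add: B_G2_SL3_def branching_algebra_def)
  obtain u v where uv: "u \<in> U_minus_G2" "v \<in> U_SL3" "normalised (u ** g ** v)"
    using exists_normalised[OF g nz] .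
  obtain u' v' where uv': "u' \<in> U_minus_G2" "v' \<in> U_SL3" "normalised (u' ** g' ** v')"
    using exists_normalised[OF g'] nz eq by metis
  let ?h = "u ** g ** v" and ?h' = "u' ** g' ** v'"
  have h: "?h \<in> G2" "?h' \<in> G2"
    using g g' uv uv' by (simp_all add: G2_mult U_G2_subset)
  note [simp] = entry_invariant[OF uv(1,2)] entry_invariant[OF uv'(1,2)] 
     minor_invariant[OF uv(1,2)] minor_invariant[OF uv'(1,2)]
  have nz': "?h $ 0 $ 0 \<noteq> 0" "?h $ 0 $ 1 \<noteq> 0" "?h' $ 0 $ 0 \<noteq> 0" "?h' $ 0 $ 1 \<noteq> 0"
    using nz eq by simp_all
  have "?h $ 0 = normal_row0 (g $ 0 $ 0) (g $ 0 $ 1) (g $ 0 $ 3)"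
    "?h $ 1 = normal_row1 (g $ 0 $ 0) (g $ 0 $ 1) (g $ 0 $ 3) (minor 0 1 g) (minor 1 3 g)"
    by (subst normalised_rows[OF h(1) nz'(1,2) uv(3)], simp)+
  moreover have "?h' $ 0 = normal_row0 (g $ 0 $ 0) (g $ 0 $ 1) (g $ 0 $ 3)"
    "?h' $ 1 = normal_row1 (g $ 0 $ 0) (g $ 0 $ 1) (g $ 0 $ 3) (minor 0 1 g) (minor 1 3 g)"
    by (subst normalised_rows[OF h(2) nz'(3,4) uv'(3)], simp add: eq)+
  ultimately obtain w where w: "w \<in> U_minus_G2" "?h' = w ** ?h"
    using same_rows_orbit[OF h] by metis
  have "f g' = f ?h'" using inv uv' g' by simp
  also have "\<dots> = f (w ** ?h ** usl3 0 0 0)"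
  proof -
    have "usl3 0 0 0 = mat 1"
      by (simp add: vec_eq_iff usl3_def entry_matrix_nth mat_def)
    thus ?thesis by (simp add: w)
  qed
  also have "\<dots> = f ?h" using inv w h usl3_U by blast
  also have "\<dots> = f g" using inv uv g by simp
  finally show ?thesis .
qed

section \<open>Algebras of functions\<close>

text \<open>Complex-valued functions on a set of parameters that form an algebra. The instances below are the
  polynomial functions on \<open>G\<^sub>2\<close>, the polynomial functions of one complex parameter, and the functions on the
  quadric with prescribed denominators.\<close>
locale function_algebra =
  fixes A :: "('x \<Rightarrow> complex) set"
  assumes const: "(\<lambda>_. c) \<in> A"
    and add: "\<phi> \<in> A \<Longrightarrow> \<psi> \<in> A \<Longrightarrow> (\<lambda>x. \<phi> x + \<psi> x) \<in> A"
    and mult: "\<phi> \<in> A \<Longrightarrow> \<psi> \<in> A \<Longrightarrow> (\<lambda>x. \<phi> x * \<psi> x) \<in> A"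
begin

lemma uminus: "\<phi> \<in> A \<Longrightarrow> (\<lambda>x. - \<phi> x) \<in> A"
  using mult[OF const[of "-1"]] by simp

lemma diff: "\<phi> \<in> A \<Longrightarrow> \<psi> \<in> A \<Longrightarrow> (\<lambda>x. \<phi> x - \<psi> x) \<in> A"
  using add[of \<phi>, OF _ uminus] by simp

lemma power: "\<phi> \<in> A \<Longrightarrow> (\<lambda>x. \<phi> x ^ n) \<in> A"
  by (induct n) (simp_all add: const mult)

lemma cond: "\<phi> \<in> A \<Longrightarrow> \<psi> \<in> A \<Longrightarrow> (\<lambda>x. if b then \<phi> x else \<psi> x) \<in> A"
  by (cases b) simp_all

lemma eval:
  assumes "\<And>v. y v \<in> A"
  shows "(\<lambda>x. eval_cpoly (\<lambda>v. y v x) P) \<in> A"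
  by (induct P rule: cpoly_induct) (simp_all add: eval_cpoly_simps const add mult assms)

lemmas closed = const add mult uminus diff power cond

text \<open>Matrices depending on a parameter, with entries in the algebra.\<close>

definition entries :: "('x \<Rightarrow> complex^7^7) \<Rightarrow> bool"
  where "entries M \<longleftrightarrow> (\<forall>i j. (\<lambda>x. M x $ i $ j) \<in> A)"

lemma entries_const: "entries (\<lambda>_. g)"
  by (simp add: entries_def const)

lemma entries_mult: "entries M \<Longrightarrow> entries N \<Longrightarrow> entries (\<lambda>x. M x ** N x)"
  by (simp add: entries_def matrix_mult_entry sum_7 add mult)

lemma entries_root:
  assumes "\<phi> \<in> A"
  shows "entries (\<lambda>x. x_a (\<phi> x))" "entries (\<lambda>x. x_b (\<phi> x))" "entries (\<lambda>x. x_ab (\<phi> x))"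
    "entries (\<lambda>x. x_aab (\<phi> x))" "entries (\<lambda>x. y_a (\<phi> x))" "entries (\<lambda>x. y_b (\<phi> x))" 
    "entries (\<lambda>x. y_aab (\<phi> x))"
  using assms by (simp_all add: entries_def root_defs entry_matrix_nth closed)

lemma entries_torus:
  assumes "\<phi> \<in> A" "\<psi> \<in> A" "(\<lambda>x. 1 / \<phi> x) \<in> A" "(\<lambda>x. 1 / \<psi> x) \<in> A" 
  shows "entries (\<lambda>x. torus (\<phi> x) (\<psi> x))"
proof -
  have "(\<lambda>x. \<phi> x / \<psi> x) \<in> A" "(\<lambda>x. \<psi> x / \<phi> x) \<in> A"
    using mult[OF assms(1,4)] mult[OF assms(2,3)] by simp_all
  thus ?thesis using assms
    by (simp add: entries_def torus_def forall_7 const)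
qed

end

section \<open>Generators\<close>

fun gen_fun :: "gen \<Rightarrow> complex^7^7 \<Rightarrow> complex" where
  "gen_fun X_p1 g = g $ 0 $ 0"
| "gen_fun X_p2 g = minor 0 1 g"
| "gen_fun X_q g = g $ 0 $ 1"
| "gen_fun X_r g = minor 0 3 g"
| "gen_fun X_s g = g $ 0 $ 3"
| "gen_fun X_t g = minor 1 3 g"

text \<open>The hypersurface in six-dimensional space that is cut out by the exchange relation.\<close>
definition on_quadric :: "(gen \<Rightarrow> complex) \<Rightarrow> bool"
  where "on_quadric y \<longleftrightarrow> y X_q * y X_r = y X_p1 * y X_t + y X_p2 * y X_s"

lemma gen_fun_on_quadric: "on_quadric (\<lambda>v. gen_fun v g)"
  by (simp add: on_quadric_def minor_def algebra_simps)

lemma on_quadric_eqI: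
  assumes y: "on_quadric y" "on_quadric y'"
    and eq: "y' X_p1 = y X_p1" "y' X_p2 = y X_p2" "y' X_q = y X_q" "y' X_t = y X_t"
      "y' X_s = y X_s \<and> y X_q \<noteq> 0 \<or> y' X_r = y X_r \<and> y X_p2 \<noteq> 0"
  shows "y' = y"
proof -
  have "y' X_s = y X_s \<and> y' X_r = y X_r"
    using eq(5)
  proof
    assume s: "y' X_s = y X_s \<and> y X_q \<noteq> 0"
    hence "y X_q * y' X_r = y X_q * y X_r"
      using y eq(1-4) unfolding on_quadric_def by metis
    thus ?thesis using s by simp
  next
    assume r: "y' X_r = y X_r \<and> y X_p2 \<noteq> 0"
    hence "y X_p2 * y' X_s = y X_p2 * y X_s"
      using y eq(1-4) unfolding on_quadric_def by (metis add_left_cancel)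
    thus ?thesis using r by simp
  qed
  thus ?thesis
    using eq by (intro ext, rename_tac v, case_tac v) auto
qed

section \<open>Two sections over the quadric\<close>

text \<open>Right multiplication by root elements as column operations.\<close>
lemma root_columns:
  fixes g :: "complex^7^7"
  shows
  "(g ** x_a u) $ i $ 0 = g $ i $ 0" "(g ** x_a u) $ i $ 1 = g $ i $ 1 + u * g $ i $ 0"
  "(g ** x_a u) $ i $ 2 = g $ i $ 2" "(g ** x_a u) $ i $ 3 = g $ i $ 3 - 2 * u * g $ i $ 2"
  "(g ** x_a u) $ i $ 4 = g $ i $ 4 - u * g $ i $ 3 + u^2 * g $ i $ 2"
  "(g ** x_a u) $ i $ 5 = g $ i $ 5"  "(g ** x_a u) $ i $ 6 = g $ i $ 6 - u * g $ i $ 5"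
  "(g ** x_b u) $ i $ 0 = g $ i $ 0" "(g ** x_b u) $ i $ 1 = g $ i $ 1"
  "(g ** x_b u) $ i $ 2 = g $ i $ 2 + u * g $ i $ 1" "(g ** x_b u) $ i $ 3 = g $ i $ 3"
  "(g ** x_b u) $ i $ 4 = g $ i $ 4" "(g ** x_b u) $ i $ 5 = g $ i $ 5 - u * g $ i $ 4"
  "(g ** x_b u) $ i $ 6 = g $ i $ 6"
  "(g ** x_ab u) $ i $ 0 = g $ i $ 0" "(g ** x_ab u) $ i $ 1 = g $ i $ 1"
  "(g ** x_ab u) $ i $ 2 = g $ i $ 2 + u * g $ i $ 0"
  "(g ** x_ab u) $ i $ 3 = g $ i $ 3 + 2 * u * g $ i $ 1" 
  "(g ** x_ab u) $ i $ 4 = g $ i $ 4"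
  "(g ** x_ab u) $ i $ 5 = g $ i $ 5 + u * g $ i $ 3 + u^2 * g $ i $ 1"
  "(g ** x_ab u) $ i $ 6 = g $ i $ 6 - u * g $ i $ 4"
  "(g ** x_aab u) $ i $ 0 = g $ i $ 0" "(g ** x_aab u) $ i $ 1 = g $ i $ 1"
  "(g ** x_aab u) $ i $ 3 = g $ i $ 3 + 2 * u * g $ i $ 0"
  "(g ** y_a u) $ i $ 0 = g $ i $ 0 + u * g $ i $ 1" "(g ** y_a u) $ i $ 1 = g $ i $ 1"
  "(g ** y_a u) $ i $ 2 = g $ i $ 2 - u * g $ i $ 3 + u^2 * g $ i $ 4"
  "(g ** y_a u) $ i $ 3 = g $ i $ 3 - 2 * u * g $ i $ 4"
  "(g ** y_a u) $ i $ 4 = g $ i $ 4" "(g ** y_a u) $ i $ 5 = g $ i $ 5 - u * g $ i $ 6"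
  "(g ** y_a u) $ i $ 6 = g $ i $ 6"
  "(g ** y_b u) $ i $ 0 = g $ i $ 0" "(g ** y_b u) $ i $ 1 = g $ i $ 1 + u * g $ i $ 2"
  "(g ** y_b u) $ i $ 2 = g $ i $ 2" "(g ** y_b u) $ i $ 3 = g $ i $ 3"
  "(g ** y_b u) $ i $ 4 = g $ i $ 4 - u * g $ i $ 5" "(g ** y_b u) $ i $ 5 = g $ i $ 5"
  "(g ** y_b u) $ i $ 6 = g $ i $ 6"
  "(g ** y_aab u) $ i $ 0 = g $ i $ 0 + u * g $ i $ 3 + u^2 * g $ i $ 6"
  "(g ** y_aab u) $ i $ 1 = g $ i $ 1 + u * g $ i $ 4"
  by (simp_all add: matrix_mult_entry sum_7 root_defs entry_matrix_nth mult_ac)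

lemma torus_rows: 
  "torus a b $ 0 $ j = (if j = 0 then a else 0)" "torus a b $ 1 $ j = (if j = 1 then b else 0)"
  by (auto simp: torus_def)

text \<open>An element of the big cell with prescribed generators. In \<open>torus a b ** x_a x ** x_ab y ** x_aab z\<close> the
  generators \<open>p\<^sub>1, p\<^sub>2, q, r, t\<close> have the values \<open>a\<close>, \<open>a b\<close>, \<open>a x\<close>, \<open>2 a b y\<close>, \<open>-2 a b z\<close>.\<close>
definition section1 :: "(gen \<Rightarrow> complex) \<Rightarrow> complex^7^7"
  where "section1 y = torus (y X_p1) (y X_p2 / y X_p1) ** x_a (y X_q / y X_p1)
    ** x_ab (y X_r / (2 * y X_p2)) ** x_aab (- y X_t / (2 * y X_p2))"

lemma section1_G2: "y X_p1 \<noteq> 0 \<Longrightarrow> y X_p2 \<noteq> 0 \<Longrightarrow> section1 y \<in> G2"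
  by (simp add: section1_def G2_mult torus_G2 x_a_G2 x_ab_G2 x_aab_G2)

lemma section1_gen_fun:
  assumes "on_quadric y" and nz: "y X_p1 \<noteq> 0" "y X_p2 \<noteq> 0"
  shows "gen_fun v (section1 y) = y v"
proof -
  have "(\<lambda>v. gen_fun v (section1 y)) = y"
    by (rule on_quadric_eqI[OF assms(1) gen_fun_on_quadric])
      (use nz in \<open>simp_all add: section1_def minor_def root_columns torus_rows field_simps\<close>)
  thus ?thesis by (rule fun_cong)
qed

text \<open>A representative of the element of the Weyl group that moves the columns \<open>0, 2\<close> to \<open>1, 0\<close>.\<close>

definition weyl :: "complex^7^7"
  where "weyl = x_b 1 ** y_b (-1) ** x_b 1 ** x_a 1 ** y_a (-1) ** x_a 1"

lemma weyl_G2: "weyl \<in> G2"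
  by (simp add: weyl_def G2_mult x_b_G2 y_b_G2 x_a_G2 y_a_G2)

lemma weyl_columns:
  fixes g :: "complex^7^7"
  shows
  "(g ** weyl) $ i $ 0 = g $ i $ 2" "(g ** weyl) $ i $ 1 = g $ i $ 0" "(g ** weyl) $ i $ 3 = - g $ i $ 3"
  by (simp_all add: weyl_def matrix_mul_assoc root_columns)

text \<open>An element of a translate of the big cell on which \<open>q\<close> is a coordinate of the torus. In
  \<open>torus q b ** x_a x ** x_b y ** x_ab z ** weyl\<close> the generators \<open>p\<^sub>2, s, t\<close> are \<open>-q b y\<close>, \<open>-2 q x z\<close>, \<open>-2 q b z\<close>,
  and the value of \<open>p\<^sub>1\<close> amounts to \<open>p\<^sub>1 b + p\<^sub>2 x = -t/2\<close>. This is solved with denominators prime to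
  \<open>p\<^sub>1 p\<^sub>2\<close> by taking \<open>b\<close> and \<open>x\<close> proportional to \<open>t\<close> and \<open>s\<close>, since \<open>p\<^sub>1 t + p\<^sub>2 s = q r\<close>.\<close>
definition section2 :: "(gen \<Rightarrow> complex) \<Rightarrow> complex^7^7"
  where "section2 y = torus (y X_q) (- ((y X_t)^2) / (2 * y X_q * y X_r))
    ** x_a (- y X_t * y X_s / (2 * y X_q * y X_r)) ** x_b (2 * y X_p2 * y X_r / (y X_t)^2)
    ** x_ab (y X_r / y X_t) ** weyl"

lemma section2_G2: "y X_q \<noteq> 0 \<Longrightarrow> y X_r \<noteq> 0 \<Longrightarrow> y X_t \<noteq> 0 \<Longrightarrow> section2 y \<in> G2"
  by (simp add: section2_def G2_mult torus_G2 x_a_G2 x_b_G2 x_ab_G2 weyl_G2)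

lemma section2_gen_fun:
  assumes y: "on_quadric y" and nz: "y X_q \<noteq> 0" "y X_r \<noteq> 0" "y X_t \<noteq> 0"
  shows "gen_fun v (section2 y) = y v"
proof -
  have "y X_p1 * y X_t = y X_q * y X_r - y X_p2 * y X_s" using y by (simp add: on_quadric_def)
  hence p1: "y X_p1 = (y X_q * y X_r - y X_p2 * y X_s) / y X_t" using nz by (simp add: field_simps)
  have "(\<lambda>v. gen_fun v (section2 y)) = y"
    by (rule on_quadric_eqI[OF assms(1) gen_fun_on_quadric])
      (use nz in \<open>simp_all add: section2_def minor_def root_columns weyl_columns torus_rows p1 
          field_simps power2_eq_square\<close>)
  thus ?thesis by (rule fun_cong)
qed

section \<open>Vanishing on the quadric\<close>

lemma eval_exchange_relation: "on_quadric y \<longleftrightarrow> eval_cpoly y exchange_relation = 0"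
  by (simp add: on_quadric_def exchange_relation_def eval_cpoly_simps algebra_simps)

lemma on_quadric_eval_cong:
  assumes "on_quadric y" and "exchange_relation dvd P - Q"
  shows "eval_cpoly y P = eval_cpoly y Q"
proof -
  obtain C where "P - Q = exchange_relation * C" using assms(2) by (rule dvdE)
  hence "eval_cpoly y (P - Q) = 0"
    using assms(1) by (simp add: eval_cpoly_simps eval_exchange_relation)
  thus ?thesis by (simp add: eval_cpoly_simps)
qed

lemma eval_normal_form:
  "eval_cpoly y (normal_form A B) = unital_hom.peval (eval_cpoly (\<lambda>v. y (emb v))) (y X_q) A
     + y X_r * unital_hom.peval (eval_cpoly (\<lambda>v. y (emb v))) (y X_r) B"
  using insertion_normal_form[OF unital_hom_id] by (simp add: eval_cpoly_eq_insertion[abs_def])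

text \<open>Every polynomial function that is zero on the quadric is a multiple of its equation.\<close>
lemma vanishing_on_quadric:
  assumes "\<And>y. on_quadric y \<Longrightarrow> eval_cpoly y P = 0"
  shows "exchange_relation dvd P"
proof -
  obtain A B where AB: "exchange_relation dvd P - normal_form A B" using exists_normal_form by blast
  let ?n = "Polynomial.degree B"
  have "clear ?n A B = 0"
  proof (rule frozen_cpoly_poly_eq_0_dense[of "[:0, 1:]"])
    fix x :: "frozen \<Rightarrow> complex" and z :: complex
    interpret unital_hom "eval_cpoly x :: frozen cpoly \<Rightarrow> complex" by (rule eval_cpoly_hom)
    assume "peval z [:0, 1:] \<noteq> 0"
    hence z: "z \<noteq> 0" by (simp add: peval_pCons zero one)
    define w where "w = eval_cpoly x exchange_polynomial / z"
    have zw: "z * w = eval_cpoly x exchange_polynomial" using z by (simp add: w_def)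
    define y where "y v = (case v of X_p1 \<Rightarrow> x F_p1 | X_p2 \<Rightarrow> x F_p2 | X_q \<Rightarrow> z | X_r \<Rightarrow> w
      | X_s \<Rightarrow> x F_s | X_t \<Rightarrow> x F_t)" for v
    have emb: "(\<lambda>v. y (emb v)) = x"
      by (rule ext, rename_tac v, case_tac v) (simp_all add: y_def)
    have q: "on_quadric y"
      using zw by (simp add: on_quadric_def y_def eval_exchange)
    have "eval_cpoly y (normal_form A B) = 0"
      using on_quadric_eval_cong[OF q AB] assms[OF q] by simp
    hence "peval z A + w * peval w B = 0"
      unfolding eval_normal_form emb by (simp add: y_def)
    thus "peval z (clear ?n A B) = 0"
      using peval_clear[OF eval_cpoly_hom zw, of B ?n A] by simp
  qed simp
  hence "A = 0 \<and> B = 0" by (rule clear_eq_0) simp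
  thus ?thesis using AB by (simp add: normal_form_def)
qed

lemma normal_form_unique:
  assumes "to_LP (normal_form A B) = to_LP (normal_form A' B')"
  shows "A = A' \<and> B = B'"
proof -
  have "normal_form (A - A') (B - B') + normal_form A' B' = normal_form A B"
    by (simp flip: normal_form_add)
  hence "to_LP (normal_form (A - A') (B - B')) = 0"
    using assms by (metis to_LP.add add_cancel_left_left)
  hence "clear (Polynomial.degree (B - B')) (A - A') (B - B') = 0"
    using to_LP_clear[of "B - B'" "Polynomial.degree (B - B')" "A - A'"] by simp
  hence "A - A' = 0 \<and> B - B' = 0" by (rule clear_eq_0) simp
  thus ?thesis by simp
qed

section \<open>Regular functions along the sections\<close>

text \<open>The functions on the quadric that become polynomial, where \<open>d \<noteq> 0\<close>, after multiplication with a
  power of \<open>d\<close>.\<close>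
definition laurent :: "gen cpoly \<Rightarrow> ((gen \<Rightarrow> complex) \<Rightarrow> complex) set"
  where "laurent d = {\<phi>. \<exists>k P. \<forall>y. on_quadric y \<longrightarrow> eval_cpoly y d \<noteq> 0 \<longrightarrow>
    \<phi> y * eval_cpoly y d ^ k = eval_cpoly y P}"

lemma laurentI:
  assumes "\<And>y. on_quadric y \<Longrightarrow> eval_cpoly y d \<noteq> 0 \<Longrightarrow> \<phi> y * eval_cpoly y d ^ k = eval_cpoly y P"
  shows "\<phi> \<in> laurent d"
  using assms unfolding laurent_def by blast

lemma laurentE:
  assumes "\<phi> \<in> laurent d"
  obtains k P where "\<And>y. on_quadric y \<Longrightarrow> eval_cpoly y d \<noteq> 0 \<Longrightarrow> \<phi> y * eval_cpoly y d ^ k = eval_cpoly y P"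
  using assms unfolding laurent_def by blast

lemma laurent_algebra: "function_algebra (laurent d)"
proof
  fix c show "(\<lambda>_. c) \<in> laurent d"
    by (rule laurentI[of _ _ 0 "Const c"]) (simp add: eval_cpoly_simps)
next
  fix \<phi> \<psi> assume \<phi>: "\<phi> \<in> laurent d" and \<psi>: "\<psi> \<in> laurent d"
  obtain k P where
    P: "\<And>y. on_quadric y \<Longrightarrow> eval_cpoly y d \<noteq> 0 \<Longrightarrow> eval_cpoly y P = \<phi> y * eval_cpoly y d ^ k"
    using laurentE[OF \<phi>] by metis
  obtain l Q where
    Q: "\<And>y. on_quadric y \<Longrightarrow> eval_cpoly y d \<noteq> 0 \<Longrightarrow> eval_cpoly y Q = \<psi> y * eval_cpoly y d ^ l"
    using laurentE[OF \<psi>] by metis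
  show "(\<lambda>x. \<phi> x + \<psi> x) \<in> laurent d"
    by (rule laurentI[of _ _ "k + l" "P * d ^ l + Q * d ^ k"])
      (simp add: eval_cpoly_simps P Q power_add algebra_simps)
  show "(\<lambda>x. \<phi> x * \<psi> x) \<in> laurent d"
    by (rule laurentI[of _ _ "k + l" "P * Q"])
      (simp add: eval_cpoly_simps P Q power_add algebra_simps)
qed

lemma laurent_Var: "(\<lambda>y. y v) \<in> laurent d"
  by (rule laurentI[of _ _ 0 "Var v"]) (simp add: eval_cpoly_simps)

lemma laurent_inverse:
  assumes "d = Var v * b"
  shows "(\<lambda>y. 1 / y v) \<in> laurent d"
  by (rule laurentI[of _ _ 1 b]) (simp add: assms eval_cpoly_simps)

definition matrix_entries :: "complex^7^7 \<Rightarrow> 7 \<times> 7 \<Rightarrow> complex"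
  where "matrix_entries g = (\<lambda>(i, j). g $ i $ j)"

text \<open>The functions that agree on \<open>G\<^sub>2\<close> with a polynomial in the matrix entries. There the determinant is
  \<open>1\<close>, so that they are the regular functions without the condition on the values outside \<open>G\<^sub>2\<close>.\<close>
definition polynomial_on_G2 :: "(complex^7^7 \<Rightarrow> complex) set"
  where "polynomial_on_G2 = {f. \<exists>P. \<forall>g\<in>G2. f g = eval_cpoly (matrix_entries g) P}"

lemma regular_functions_G2: "regular_functions G2 = extensional G2 \<inter> polynomial_on_G2"
proof -
  have d: "det g = 1" if "g \<in> G2" for g using that by (simp add: G2_def)
  have "(\<exists>(P :: (7 \<times> 7) cpoly) k. \<forall>g\<in>G2. f g = eval_cpoly (\<lambda>(i, j). g $ i $ j) P / det g ^ k)
      \<longleftrightarrow> f \<in> polynomial_on_G2" for f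
    by (simp add: polynomial_on_G2_def d matrix_entries_def)
  thus ?thesis by (auto simp: regular_functions_def)
qed

lemma polynomial_on_G2I:
  "(\<And>g. g \<in> G2 \<Longrightarrow> f g = eval_cpoly (matrix_entries g) P) \<Longrightarrow> f \<in> polynomial_on_G2"
  unfolding polynomial_on_G2_def by blast

interpretation polynomial_on_G2: function_algebra polynomial_on_G2
proof
  fix c show "(\<lambda>_. c) \<in> polynomial_on_G2"
    by (rule polynomial_on_G2I[of _ "Const c"]) (simp add: eval_cpoly_simps)
next
  fix \<phi> \<psi> assume "\<phi> \<in> polynomial_on_G2" "\<psi> \<in> polynomial_on_G2"
  then obtain P Q where P: "\<And>g. g \<in> G2 \<Longrightarrow> \<phi> g = eval_cpoly (matrix_entries g) P"
    and Q: "\<And>g. g \<in> G2 \<Longrightarrow> \<psi> g = eval_cpoly (matrix_entries g) Q"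
    unfolding polynomial_on_G2_def by blast
  show "(\<lambda>x. \<phi> x + \<psi> x) \<in> polynomial_on_G2"
    by (rule polynomial_on_G2I[of _ "P + Q"]) (simp add: eval_cpoly_simps P Q)
  show "(\<lambda>x. \<phi> x * \<psi> x) \<in> polynomial_on_G2"
    by (rule polynomial_on_G2I[of _ "P * Q"]) (simp add: eval_cpoly_simps P Q)
qed

lemma entry_polynomial: "(\<lambda>g. g $ i $ j) \<in> polynomial_on_G2"
  by (rule polynomial_on_G2I[of _ "Var (i, j)"]) (simp add: eval_cpoly_simps matrix_entries_def)

lemma minor_polynomial: "minor i j \<in> polynomial_on_G2"
  unfolding minor_def[abs_def] by (intro polynomial_on_G2.closed entry_polynomial)

lemma gen_fun_polynomial: "gen_fun v \<in> polynomial_on_G2"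
proof -
  have "gen_fun X_p1 = (\<lambda>g. g $ 0 $ 0)" "gen_fun X_p2 = minor 0 1" "gen_fun X_q = (\<lambda>g. g $ 0 $ 1)"
    "gen_fun X_r = minor 0 3" "gen_fun X_s = (\<lambda>g. g $ 0 $ 3)" "gen_fun X_t = minor 1 3"
    by (rule ext, simp)+
  thus ?thesis by (cases v) (simp_all add: entry_polynomial minor_polynomial)
qed

lemma (in function_algebra) polynomial_on_G2_comp:
  assumes f: "f \<in> polynomial_on_G2" and M: "entries M"
  obtains \<phi> where "\<phi> \<in> A" "\<And>x. M x \<in> G2 \<Longrightarrow> f (M x) = \<phi> x"
proof -
  obtain P where P: "\<And>g. g \<in> G2 \<Longrightarrow> f g = eval_cpoly (matrix_entries g) P"
    using f unfolding polynomial_on_G2_def by blast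
  have "(\<lambda>x. eval_cpoly (\<lambda>v. (\<lambda>v x. matrix_entries (M x) v) v x) P) \<in> A"
    by (rule eval) (use M in \<open>auto simp: entries_def matrix_entries_def split: prod.split\<close>)
  thus ?thesis using that P by auto
qed

lemma section1_entries: "function_algebra.entries (laurent (Var X_p1 * Var X_p2)) section1"
proof -
  interpret function_algebra "laurent (Var X_p1 * Var X_p2)" by (rule laurent_algebra)
  have [simp]: "(\<lambda>y. 1 / y X_p1) \<in> laurent (Var X_p1 * Var X_p2)" 
      "(\<lambda>y. 1 / y X_p2) \<in> laurent (Var X_p1 * Var X_p2)"
    by (rule laurent_inverse[of _ _ "Var X_p2"], simp) 
      (rule laurent_inverse[of _ _ "Var X_p1"], simp add: mult.commute)
  note [simp] = laurent_Var
  have "(\<lambda>y. y X_p2 * (1 / y X_p1)) \<in> laurent (Var X_p1 * Var X_p2)"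
    "(\<lambda>y. y X_p1 * (1 / y X_p2)) \<in> laurent (Var X_p1 * Var X_p2)"
    "(\<lambda>y. y X_q * (1 / y X_p1)) \<in> laurent (Var X_p1 * Var X_p2)"
    "(\<lambda>y. y X_r * ((1 / 2) * (1 / y X_p2))) \<in> laurent (Var X_p1 * Var X_p2)"
    "(\<lambda>y. - y X_t * ((1 / 2) * (1 / y X_p2))) \<in> laurent (Var X_p1 * Var X_p2)"
    by (intro closed; simp)+
  hence "(\<lambda>y. y X_p2 / y X_p1) \<in> laurent (Var X_p1 * Var X_p2)"
    "(\<lambda>y. 1 / (y X_p2 / y X_p1)) \<in> laurent (Var X_p1 * Var X_p2)"
    "(\<lambda>y. y X_q / y X_p1) \<in> laurent (Var X_p1 * Var X_p2)"
    "(\<lambda>y. y X_r / (2 * y X_p2)) \<in> laurent (Var X_p1 * Var X_p2)"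
    "(\<lambda>y. - y X_t / (2 * y X_p2)) \<in> laurent (Var X_p1 * Var X_p2)"
    by simp_all
  thus ?thesis
    unfolding section1_def[abs_def] by (intro entries_mult entries_torus entries_root) simp_all
qed

lemma section2_entries: "function_algebra.entries (laurent (Var X_q * Var X_r * Var X_t)) section2"
proof -
  let ?d = "Var X_q * Var X_r * Var X_t"
  interpret function_algebra "laurent ?d" by (rule laurent_algebra)
  have [simp]: "(\<lambda>y. 1 / y X_q) \<in> laurent ?d" "(\<lambda>y. 1 / y X_r) \<in> laurent ?d" "(\<lambda>y. 1 / y X_t) \<in> laurent ?d"
    by (rule laurent_inverse[of _ _ "Var X_r * Var X_t"], simp add: mult_ac) 
      (rule laurent_inverse[of _ _ "Var X_q * Var X_t"], simp add: mult_ac,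
       rule laurent_inverse[of _ _ "Var X_q * Var X_r"], simp add: mult_ac)
  note [simp] = laurent_Var
  have "(\<lambda>y. - (y X_t * y X_t * ((1 / 2) * ((1 / y X_q) * (1 / y X_r))))) \<in> laurent ?d"
    "(\<lambda>y. - (2 * y X_q * y X_r * ((1 / y X_t) * (1 / y X_t)))) \<in> laurent ?d"
    "(\<lambda>y. - y X_t * y X_s * ((1 / 2) * ((1 / y X_q) * (1 / y X_r)))) \<in> laurent ?d"
    "(\<lambda>y. 2 * y X_p2 * y X_r * ((1 / y X_t) * (1 / y X_t))) \<in> laurent ?d"
    "(\<lambda>y. y X_r * (1 / y X_t)) \<in> laurent ?d"
    by (intro closed; simp)+
  hence "(\<lambda>y. - ((y X_t)^2) / (2 * y X_q * y X_r)) \<in> laurent ?d"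
    "(\<lambda>y. 1 / (- ((y X_t)^2) / (2 * y X_q * y X_r))) \<in> laurent ?d"
    "(\<lambda>y. - y X_t * y X_s / (2 * y X_q * y X_r)) \<in> laurent ?d"
    "(\<lambda>y. 2 * y X_p2 * y X_r / (y X_t)^2) \<in> laurent ?d"
    "(\<lambda>y. y X_r / y X_t) \<in> laurent ?d"
    by (simp_all add: power2_eq_square mult.assoc)
  thus ?thesis
    unfolding section2_def[abs_def] by (intro entries_mult entries_torus entries_root entries_const) simp_all
qed

section \<open>Generation by the six functions\<close>

lemma B_carrier:
  "f \<in> carrier B_G2_SL3 \<longleftrightarrow> f \<in> extensional G2 \<and> f \<in> polynomial_on_G2
    \<and> (\<forall>u\<in>U_minus_G2. \<forall>v\<in>U_SL3. \<forall>g\<in>G2. f (u ** g ** v) = f g)"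
  by (auto simp: B_G2_SL3_def branching_algebra_def regular_functions_G2)

text \<open>Restriction to \<open>section1\<close> gives the polynomial \<open>P\<close> with \<open>f (p\<^sub>1 p\<^sub>2) ^ k = P\<close> where \<open>p\<^sub>1 p\<^sub>2 q \<noteq> 0\<close>, and
  restriction to \<open>section2\<close> gives \<open>Q\<close> with \<open>f (q r t) ^ l = Q\<close> at the points of \<open>section2\<close>. Hence
  \<open>P (q r t) ^ l = Q (p\<^sub>1 p\<^sub>2) ^ k\<close>, and \<open>q r t = E t\<close> is an element of \<open>S\<close> that is divisible neither by
  \<open>p\<^sub>1\<close> nor by \<open>p\<^sub>2\<close>. So \<open>(p\<^sub>1 p\<^sub>2) ^ k\<close> divides all coefficients of the normal form of \<open>P\<close>.\<close>
lemma generic_generation: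
  assumes f: "f \<in> carrier B_G2_SL3"
  obtains P where "\<And>g. g \<in> G2 \<Longrightarrow> g $ 0 $ 0 \<noteq> 0 \<Longrightarrow> minor 0 1 g \<noteq> 0 \<Longrightarrow> g $ 0 $ 1 \<noteq> 0 \<Longrightarrow>
    f g = eval_cpoly (\<lambda>v. gen_fun v g) P"
proof -
  let ?p = "Var X_p1 * Var X_p2 :: gen cpoly" and ?d = "Var X_q * Var X_r * Var X_t :: gen cpoly"
  have reg: "f \<in> polynomial_on_G2" using f by (simp add: B_carrier)
  obtain \<phi>1 where \<phi>1: "\<phi>1 \<in> laurent ?p" "\<And>y. section1 y \<in> G2 \<Longrightarrow> f (section1 y) = \<phi>1 y"
    using function_algebra.polynomial_on_G2_comp[OF laurent_algebra reg section1_entries] by blast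
  obtain \<phi>2 where \<phi>2: "\<phi>2 \<in> laurent ?d" "\<And>y. section2 y \<in> G2 \<Longrightarrow> f (section2 y) = \<phi>2 y"
    using function_algebra.polynomial_on_G2_comp[OF laurent_algebra reg section2_entries] by blast
  obtain k P where P: "\<And>y. on_quadric y \<Longrightarrow> eval_cpoly y ?p \<noteq> 0 \<Longrightarrow> \<phi>1 y * eval_cpoly y ?p ^ k = eval_cpoly y P"
    using laurentE[OF \<phi>1(1)] by blast
  obtain l Q where Q: "\<And>y. on_quadric y \<Longrightarrow> eval_cpoly y ?d \<noteq> 0 \<Longrightarrow> \<phi>2 y * eval_cpoly y ?d ^ l = eval_cpoly y Q"
    using laurentE[OF \<phi>2(1)] by blast
  have fP: "f g * (g $ 0 $ 0 * minor 0 1 g) ^ k = eval_cpoly (\<lambda>v. gen_fun v g) P"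
    if g: "g \<in> G2" and nz: "g $ 0 $ 0 \<noteq> 0" "minor 0 1 g \<noteq> 0" "g $ 0 $ 1 \<noteq> 0" for g
  proof -
    let ?y = "\<lambda>v. gen_fun v g"
    have s: "section1 ?y \<in> G2" using nz by (intro section1_G2) simp_all
    have v: "gen_fun v (section1 ?y) = gen_fun v g" for v
      using nz by (intro section1_gen_fun gen_fun_on_quadric) simp_all
    have "f (section1 ?y) = f g"
      using v[of X_p1] v[of X_p2] v[of X_q] v[of X_s] v[of X_t] nz
      by (intro separation[OF f g s]) simp_all
    thus ?thesis
      using P[OF gen_fun_on_quadric, of g] \<phi>1(2)[OF s] nz by (simp add: eval_cpoly_simps)
  qed
  have eq: "to_LP P * to_LP ?d ^ l = to_LP Q * to_LP ?p ^ k"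
  proof -
    let ?T = "P * ?d ^ l - Q * ?p ^ k"
    \<comment> \<open>the factor \<open>?p * ?d\<close> takes care of the points where one of the sections is not defined\<close>
    have "exchange_relation dvd (?p * ?d) * ?T"
    proof (rule vanishing_on_quadric)
      fix y assume y: "on_quadric y"
      show "eval_cpoly y (?p * ?d * ?T) = 0"
      proof (cases "eval_cpoly y (?p * ?d) = 0")
        case False
        hence nz: "y X_p1 \<noteq> 0" "y X_p2 \<noteq> 0" "y X_q \<noteq> 0" "y X_r \<noteq> 0" "y X_t \<noteq> 0"
          by (simp_all add: eval_cpoly_simps)
        have s: "section2 y \<in> G2" using nz by (intro section2_G2)
        have v: "gen_fun v (section2 y) = y v" for v
          using nz y by (intro section2_gen_fun)
        have "f (section2 y) * (y X_p1 * y X_p2) ^ k = eval_cpoly y P"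
        proof -
          have "section2 y $ 0 $ 0 = y X_p1" "minor 0 1 (section2 y) = y X_p2" "section2 y $ 0 $ 1 = y X_q"
            using v[of X_p1] v[of X_p2] v[of X_q] by simp_all
          thus ?thesis using fP[OF s] nz v by simp
        qed
        moreover have "f (section2 y) * (y X_q * y X_r * y X_t) ^ l = eval_cpoly y Q"
          using Q[OF y] \<phi>2(2)[OF s] nz by (simp add: eval_cpoly_simps)
        ultimately have "eval_cpoly y P * (y X_q * y X_r * y X_t) ^ l = eval_cpoly y Q * (y X_p1 * y X_p2) ^ k"
          by (metis mult.assoc mult.commute)
        thus ?thesis by (simp add: eval_cpoly_simps)
      qed (simp add: eval_cpoly_simps)
    qed
    hence "to_LP (?p * ?d) * to_LP ?T = 0" by (simp add: to_LP_eq_0_iff flip: to_LP.mult)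
    moreover have "to_LP (?p * ?d) \<noteq> 0"
      by (simp add: to_LP.mult to_LP_Var lp_gen_def lp_q_neq_0 lp_q'_neq_0 lp_coeff_eq_0_iff Var_neq_0)
    ultimately have "to_LP ?T = 0" by simp
    thus ?thesis by (simp add: to_LP.minus to_LP.mult to_LP.power)
  qed
  obtain A B where AB: "exchange_relation dvd P - normal_form A B" using exists_normal_form by blast
  obtain A' B' where AB': "exchange_relation dvd Q - normal_form A' B'" using exists_normal_form by blast
  have LP: "to_LP P = to_LP (normal_form A B)" "to_LP Q = to_LP (normal_form A' B')"
    using AB AB' by (simp_all add: to_LP.minus flip: to_LP_eq_0_iff)
  let ?u = "(exchange_polynomial * Var F_t) ^ l" and ?w = "Var F_p1 ^ k * Var F_p2 ^ k :: frozen cpoly"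
  have emb: "to_LP (emb_poly c) = lp_coeff c" for c
    using to_LP_normal_form[of "[:c:]" 0] 
    by (simp add: normal_form_def emb_poly.peval_pCons lp_coeff.peval_pCons)
  have "to_LP ?d = lp_coeff (exchange_polynomial * Var F_t)" "to_LP ?p = lp_coeff (Var F_p1 * Var F_p2)"
    by (simp_all add: to_LP.mult to_LP_Var lp_gen_def lp_q_mult_lp_q' lp_coeff.mult)
  hence "lp_coeff ?u * to_LP (normal_form A B) = lp_coeff ?w * to_LP (normal_form A' B')"
    using eq by (simp add: LP mult.commute lp_coeff.power lp_coeff.mult power_mult_distrib)
  hence "to_LP (normal_form (Polynomial.smult ?u A) (Polynomial.smult ?u B)) =
      to_LP (normal_form (Polynomial.smult ?w A') (Polynomial.smult ?w B'))"
    by (simp add: normal_form_smult to_LP.mult emb)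
  hence sm: "Polynomial.smult ?u A = Polynomial.smult ?w A'" "Polynomial.smult ?u B = Polynomial.smult ?w B'"
    using normal_form_unique by blast+
  have E: "\<not> Var v dvd exchange_polynomial * Var F_t" if "v \<in> {F_p1, F_p2}" for v
    using that
    by (auto simp: Var_dvd_iff exchange_polynomial_def unital_hom.mult[OF set_zero_hom] 
        unital_hom.add[OF set_zero_hom] set_zero_Var Var_neq_0)
  have nd: "\<not> Var v dvd ?u" if "v \<in> {F_p1, F_p2}" for v
    using E[OF that] Var_prime[of v] by (induct l) (auto simp: Var_dvd_iff unital_hom.one[OF set_zero_hom])
  have w: "?w dvd Polynomial.coeff C i" if "Polynomial.smult ?u C = Polynomial.smult ?w C'" for C C' i
  proof -
    have "?u * Polynomial.coeff C i = ?w * Polynomial.coeff C' i"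
      using that by (metis Polynomial.coeff_smult)
    hence "?w dvd ?u * Polynomial.coeff C i" by (metis dvd_triv_left)
    thus ?thesis by (rule Var_powers_dvd_cancel[rotated 2]) (rule nd, simp)+
  qed
  obtain A1 where A1: "A = Polynomial.smult ?w A1"
    using w[OF sm(1)] const_poly_dvd_iff[of ?w A] by (auto simp: dvd_def)
  obtain B1 where B1: "B = Polynomial.smult ?w B1"
    using w[OF sm(2)] const_poly_dvd_iff[of ?w B] by (auto simp: dvd_def)
  have "f g = eval_cpoly (\<lambda>v. gen_fun v g) (normal_form A1 B1)"
    if "g \<in> G2" "g $ 0 $ 0 \<noteq> 0" "minor 0 1 g \<noteq> 0" "g $ 0 $ 1 \<noteq> 0" for g
  proof -
    have "eval_cpoly (\<lambda>v. gen_fun v g) P = eval_cpoly (\<lambda>v. gen_fun v g) (normal_form A B)"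
      by (rule on_quadric_eval_cong[OF gen_fun_on_quadric AB])
    also have "\<dots> = (g $ 0 $ 0 * minor 0 1 g) ^ k * eval_cpoly (\<lambda>v. gen_fun v g) (normal_form A1 B1)"
      by (simp add: A1 B1 normal_form_smult eval_cpoly_simps emb_poly.mult emb_poly.power emb_poly_Var power_mult_distrib)
    finally show ?thesis using fP[OF that] that by simp
  qed
  thus ?thesis using that by blast
qed

section \<open>Density\<close>

text \<open>The polynomial functions of one complex parameter.\<close>
definition polynomial_curves :: "(complex \<Rightarrow> complex) set"
  where "polynomial_curves = {\<phi>. \<exists>p. \<forall>x. \<phi> x = poly p x}"

interpretation polynomial_curves: function_algebra polynomial_curves
proof
  fix c show "(\<lambda>_. c) \<in> polynomial_curves"
    unfolding polynomial_curves_def by (auto intro: exI[of _ "[:c:]"])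
next
  fix \<phi> \<psi> assume "\<phi> \<in> polynomial_curves" "\<psi> \<in> polynomial_curves"
  then obtain p r where "\<And>x. \<phi> x = poly p x" "\<And>x. \<psi> x = poly r x"
    unfolding polynomial_curves_def by blast
  thus "(\<lambda>x. \<phi> x + \<psi> x) \<in> polynomial_curves" "(\<lambda>x. \<phi> x * \<psi> x) \<in> polynomial_curves"
    unfolding polynomial_curves_def by (auto intro: exI[of _ "p + r"] exI[of _ "p * r"])
qed

lemma id_polynomial_curve: "(\<lambda>x. x) \<in> polynomial_curves"
  unfolding polynomial_curves_def by (auto intro: exI[of _ "[:0, 1:]"])

text \<open>A polynomial curve in \<open>G\<^sub>2\<close> that starts at the identity at parameter \<open>0\<close>.\<close>
definition one_parameter :: "(complex \<Rightarrow> complex^7^7) \<Rightarrow> bool"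
  where "one_parameter n \<longleftrightarrow> polynomial_curves.entries n \<and> n 0 = mat 1 \<and> (\<forall>x. n x \<in> G2)"

lemma one_parameter_roots: "one_parameter x_a" "one_parameter y_a" "one_parameter y_b" "one_parameter y_aab"
  using polynomial_curves.entries_root[OF id_polynomial_curve]
  by (simp_all add: one_parameter_def x_a_G2 y_a_G2 y_b_G2 y_aab_G2)
     (simp_all add: root_defs vec_eq_iff entry_matrix_nth mat_def)

lemma polynomial_along_curve:
  assumes n: "one_parameter n" and g: "g \<in> G2" and f: "f \<in> polynomial_on_G2"
  obtains p where "\<And>x. f (g ** n x) = poly p x"
proof -
  have "polynomial_curves.entries (\<lambda>x. g ** n x)"
    using n by (intro polynomial_curves.entries_mult polynomial_curves.entries_const) (simp add: one_parameter_def)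
  then obtain \<phi> where "\<phi> \<in> polynomial_curves" "\<And>x. g ** n x \<in> G2 \<Longrightarrow> f (g ** n x) = \<phi> x"
    using polynomial_curves.polynomial_on_G2_comp[OF f] by blast
  moreover have "g ** n x \<in> G2" for x using n g by (simp add: one_parameter_def G2_mult)
  ultimately show ?thesis using that unfolding polynomial_curves_def by force
qed

text \<open>If \<open>f\<close> vanishes where \<open>c \<noteq> 0\<close>, and \<open>c\<close> is not identically zero on a curve through \<open>g\<close>, then \<open>f\<close>
  vanishes at \<open>g\<close>.\<close>
lemma density_step:
  assumes f: "f \<in> polynomial_on_G2" and c: "c \<in> polynomial_on_G2"
    and van: "\<And>h. h \<in> G2 \<Longrightarrow> c h \<noteq> 0 \<Longrightarrow> f h = 0"
    and n: "one_parameter n" and g: "g \<in> G2" and x0: "c (g ** n x0) \<noteq> 0"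
  shows "f g = 0"
proof -
  obtain p where p: "\<And>x. f (g ** n x) = poly p x" using polynomial_along_curve[OF n g f] by blast
  obtain d where d: "\<And>x. c (g ** n x) = poly d x" using polynomial_along_curve[OF n g c] by blast
  have "poly (d * p) x = 0" for x
    using van[of "g ** n x"] n g by (auto simp: one_parameter_def G2_mult simp flip: p d)
  hence "d * p = 0" using poly_all_0_iff_0 by blast
  moreover have "d \<noteq> 0" using x0 d by auto
  ultimately have "poly p 0 = 0" by simp
  thus ?thesis using p[of 0] n by (simp add: one_parameter_def)
qed

text \<open>If \<open>p\<^sub>2\<close> and \<open>t\<close> vanished, then so would the row \<open>1\<close> of the normalised element of the double coset.\<close>
lemma minor_13_neq_0:
  assumes g: "g \<in> G2" and nz: "g $ 0 $ 0 \<noteq> 0" "g $ 0 $ 1 \<noteq> 0" and z: "minor 0 1 g = 0"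
  shows "minor 1 3 g \<noteq> 0"
proof
  assume t: "minor 1 3 g = 0"
  obtain u v where uv: "u \<in> U_minus_G2" "v \<in> U_SL3" "normalised (u ** g ** v)"
    using exists_normalised[OF g nz] .
  let ?h = "u ** g ** v"
  have h: "?h \<in> G2" using g uv by (simp add: G2_mult U_G2_subset)
  have inv: "?h $ 0 $ 0 = g $ 0 $ 0" "?h $ 0 $ 1 = g $ 0 $ 1" "minor 0 1 ?h = 0" "minor 1 3 ?h = 0"
    using uv z t by (simp_all add: entry_invariant minor_invariant)
  have "?h $ 1 = normal_row1 (?h $ 0 $ 0) (?h $ 0 $ 1) (?h $ 0 $ 3) (minor 0 1 ?h) (minor 1 3 ?h)"
    by (rule normalised_rows[OF h _ _ uv(3)]) (simp_all add: inv nz)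
  also have "\<dots> = 0" unfolding inv by (simp add: normal_row1_def)
  finally have "(?h ** matrix_inv ?h) $ 1 $ 1 = 0" by (simp add: matrix_mult_entry)
  thus False by (simp add: G2_inverse_matrix[OF h] mat_def)
qed

text \<open>The locus \<open>p\<^sub>1 p\<^sub>2 q \<noteq> 0\<close> is reached in several steps: from \<open>p\<^sub>1 q \<noteq> 0\<close> along the root \<open>-2\<alpha>\<^sub>1 - \<alpha>\<^sub>2\<close>, from
  \<open>q \<noteq> 0\<close> along \<open>-\<alpha>\<^sub>1\<close>, and then from any non-zero entry of the row \<open>0\<close> to the neighbouring entry on the way
  to the column \<open>1\<close>, along simple roots and their opposites.\<close>
lemma vanishing_on_G2:
  assumes f: "f \<in> polynomial_on_G2"
    and van: "\<And>g. g \<in> G2 \<Longrightarrow> g $ 0 $ 0 \<noteq> 0 \<Longrightarrow> minor 0 1 g \<noteq> 0 \<Longrightarrow> g $ 0 $ 1 \<noteq> 0 \<Longrightarrow> f g = 0"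
    and g: "g \<in> G2"
  shows "f g = 0"
proof -
  have 1: "f h = 0" if h: "h \<in> G2" and nz: "h $ 0 $ 0 \<noteq> 0" "h $ 0 $ 1 \<noteq> 0" for h
  proof (cases "minor 0 1 h = 0")
    case True
    let ?c = "\<lambda>g. g $ 0 $ 0 * minor 0 1 g * g $ 0 $ 1"
    note n = one_parameter_roots(4)
    obtain p1 p2 q where p: "\<And>x. (h ** y_aab x) $ 0 $ 0 = poly p1 x" 
        "\<And>x. minor 0 1 (h ** y_aab x) = poly p2 x" "\<And>x. (h ** y_aab x) $ 0 $ 1 = poly q x"
      using polynomial_along_curve[OF n h entry_polynomial] polynomial_along_curve[OF n h minor_polynomial]
      by metis
    have "poly p1 0 \<noteq> 0" "poly q 0 \<noteq> 0"
      using nz by (simp_all add: root_columns flip: p)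
    moreover have "p2 \<noteq> 0"
    proof
      assume "p2 = 0"
      hence z: "minor 0 1 (h ** y_aab x) = 0" for x by (simp add: p)
      have "minor 1 3 h + 2 * minor 0 4 h = - 2 * cross (dual_vec (h $ 0)) (dual_vec (h $ 1)) $ 5"
        by (simp add: cross_def dual_vec_def minor_def field_simps)
      hence m: "minor 1 3 h = - 2 * minor 0 4 h" by (simp add: G2_rows[OF h] eq_neg_iff_add_eq_0)
      \<comment> \<open>the coefficients of \<open>p\<^sub>2\<close> along the curve, the constant one being zero\<close>
      define c1 c2 c3 where "c1 = minor 0 4 h - minor 1 3 h" and "c2 = minor 3 4 h - minor 1 6 h"
        and "c3 = - minor 4 6 h"
      have e: "minor 0 1 (h ** y_aab x) = x * c1 + x^2 * c2 + x^3 * c3" for x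
        using True by (simp add: minor_def root_columns c1_def c2_def c3_def algebra_simps 
            power2_eq_square power3_eq_cube)
      \<comment> \<open>the values at \<open>1\<close>, \<open>-1\<close> and \<open>2\<close> determine the linear coefficient\<close>
      have "6 * c1 = 6 * (1 * c1 + 1^2 * c2 + 1^3 * c3) - 2 * ((-1) * c1 + (-1)^2 * c2 + (-1)^3 * c3)
          - (2 * c1 + 2^2 * c2 + 2^3 * c3)" 
        by (simp add: algebra_simps)
      also have "\<dots> = 0" unfolding e[symmetric] z by simp
      finally have "c1 = 0" by simp
      hence "minor 1 3 h = 0" using m by (simp add: c1_def)
      thus False using minor_13_neq_0[OF h nz True] by simp
    qed
    ultimately have "p1 * p2 * q \<noteq> 0" by auto
    then obtain x where "poly (p1 * p2 * q) x \<noteq> 0" using poly_all_0_iff_0 by blast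
    hence x: "?c (h ** y_aab x) \<noteq> 0" by (simp add: p)
    show ?thesis
      by (rule density_step[where c = ?c, OF f _ _ n h x])
        (auto intro!: polynomial_on_G2.mult entry_polynomial minor_polynomial van)
  qed (use van h nz in blast)
  have row: "f h = 0" if van': "\<And>g. g \<in> G2 \<Longrightarrow> g $ 0 $ i \<noteq> 0 \<Longrightarrow> f g = 0" and n: "one_parameter n" 
      and h: "h \<in> G2" and x: "(h ** n x) $ 0 $ i \<noteq> 0" for h i n x
    by (rule density_step[where c = "\<lambda>g. g $ 0 $ i", OF f entry_polynomial van' n h x])
  have 2: "f h = 0" if h: "h \<in> G2" and nz: "h $ 0 $ 1 \<noteq> 0" for h
  proof (cases "h $ 0 $ 0 = 0")
    case True
    show ?thesis
    proof (rule density_step[OF f _ _ one_parameter_roots(2) h])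
      show "(\<lambda>g. g $ 0 $ 0 * g $ 0 $ 1) \<in> polynomial_on_G2"
        by (intro polynomial_on_G2.mult entry_polynomial)
      show "(h ** y_a 1) $ 0 $ 0 * (h ** y_a 1) $ 0 $ 1 \<noteq> 0"
        using nz True by (simp add: root_columns)
    qed (use 1 in auto)
  qed (use 1 h nz in blast)
  have 3: "f h = 0" if h: "h \<in> G2" and nz: "h $ 0 $ 2 \<noteq> 0" for h
  proof (cases "h $ 0 $ 1 = 0")
    case True
    have "(h ** y_b 1) $ 0 $ 1 \<noteq> 0" using nz True by (simp add: root_columns)
    from row[OF _ one_parameter_roots(3) h this] show ?thesis using 2 by blast
  qed (use 2 h in blast)
  have 4: "f h = 0" if h: "h \<in> G2" and nz: "h $ 0 $ 3 \<noteq> 0" for h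
  proof (cases "h $ 0 $ 2 = 0")
    case True
    show ?thesis
    proof (cases "h $ 0 $ 4 = h $ 0 $ 3")
      case True': True
      have "(h ** y_a (-1)) $ 0 $ 2 \<noteq> 0" using nz True True' by (simp add: root_columns)
      from row[OF _ one_parameter_roots(2) h this] show ?thesis using 3 by blast
    next
      case False
      have "(h ** y_a 1) $ 0 $ 2 \<noteq> 0" using False True by (simp add: root_columns)
      from row[OF _ one_parameter_roots(2) h this] show ?thesis using 3 by blast
    qed
  qed (use 3 h in blast)
  have 5: "f h = 0" if h: "h \<in> G2" and nz: "h $ 0 $ 4 \<noteq> 0" for h
  proof (cases "h $ 0 $ 3 = 0")
    case True
    have "(h ** y_a 1) $ 0 $ 3 \<noteq> 0" using nz True by (simp add: root_columns)
    from row[OF _ one_parameter_roots(2) h this] show ?thesis using 4 by blast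
  qed (use 4 h in blast)
  have 6: "f h = 0" if h: "h \<in> G2" and nz: "h $ 0 $ 5 \<noteq> 0" for h
  proof (cases "h $ 0 $ 4 = 0")
    case True
    have "(h ** y_b 1) $ 0 $ 4 \<noteq> 0" using nz True by (simp add: root_columns)
    from row[OF _ one_parameter_roots(3) h this] show ?thesis using 5 by blast
  qed (use 5 h in blast)
  have 7: "f h = 0" if h: "h \<in> G2" and nz: "h $ 0 $ 6 \<noteq> 0" for h
  proof (cases "h $ 0 $ 5 = 0")
    case True
    have "(h ** y_a 1) $ 0 $ 5 \<noteq> 0" using nz True by (simp add: root_columns)
    from row[OF _ one_parameter_roots(2) h this] show ?thesis using 6 by blast
  qed (use 6 h in blast)
  have 8: "f h = 0" if h: "h \<in> G2" and nz: "h $ 0 $ 0 \<noteq> 0" for h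
  proof (cases "h $ 0 $ 1 = 0")
    case True
    have "(h ** x_a 1) $ 0 $ 1 \<noteq> 0" using nz True by (simp add: root_columns)
    from row[OF _ one_parameter_roots(1) h this] show ?thesis using 2 by blast
  qed (use 2 h in blast)
  have "\<exists>i. g $ 0 $ i \<noteq> 0"
  proof (rule ccontr)
    assume "\<not> (\<exists>i. g $ 0 $ i \<noteq> 0)"
    hence "(g ** matrix_inv g) $ 0 $ 0 = 0" by (simp add: matrix_mult_entry)
    thus False by (simp add: G2_inverse_matrix[OF g] mat_def)
  qed
  then obtain i where i: "g $ 0 $ i \<noteq> 0" by blast
  consider "i = 0" | "i = 1" | "i = 2" | "i = 3" | "i = 4" | "i = 5" | "i = 6" using exhaust_7[of i] by blast
  thus ?thesis using i g 2 3 4 5 6 7 8 by cases blast+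
qed

lemma eval_gen_fun_polynomial: "(\<lambda>g. eval_cpoly (\<lambda>v. gen_fun v g) P) \<in> polynomial_on_G2"
  by (rule polynomial_on_G2.eval) (rule gen_fun_polynomial)

theorem generation:
  assumes f: "f \<in> carrier B_G2_SL3"
  obtains P where "\<And>g. g \<in> G2 \<Longrightarrow> f g = eval_cpoly (\<lambda>v. gen_fun v g) P"
proof -
  obtain P where P: "\<And>g. g \<in> G2 \<Longrightarrow> g $ 0 $ 0 \<noteq> 0 \<Longrightarrow> minor 0 1 g \<noteq> 0 \<Longrightarrow> g $ 0 $ 1 \<noteq> 0 \<Longrightarrow>
      f g = eval_cpoly (\<lambda>v. gen_fun v g) P"
    using generic_generation[OF f] by blast
  have "f g - eval_cpoly (\<lambda>v. gen_fun v g) P = 0" if "g \<in> G2" for g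
    by (rule vanishing_on_G2[OF polynomial_on_G2.diff[OF _ eval_gen_fun_polynomial]])
      (use f P that in \<open>auto simp: B_carrier\<close>)
  thus ?thesis using that by simp
qed

section \<open>The presentation of the branching algebra\<close>

text \<open>The relations between the weights of the basis vectors. They follow from the invariance of single
  terms of the three-form, and from \<open>det g = 1\<close> for the middle entry.\<close>
lemma T_G2_relations:
  assumes "g \<in> T_G2"
  shows "i \<noteq> j \<Longrightarrow> g $ i $ j = 0" "g $ 0 $ 0 = g $ 1 $ 1 * g $ 2 $ 2" "g $ 3 $ 3 = 1"
    "g $ 2 $ 2 \<noteq> 0"
proof -
  from assms have g: "g \<in> G2" and d: "\<And>i j. i \<noteq> j \<Longrightarrow> g $ i $ j = 0"
    by (auto simp: T_G2_def diagonal_matrices_def)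
  show "i \<noteq> j \<Longrightarrow> g $ i $ j = 0" by (rule d)
  let ?t = "\<lambda>i. g $ i $ i"
  have v: "(g *v axis j 1) $ i = (if i = j then ?t j else 0)" for i j
    by (subst matrix_vector_mult_def) 
      (simp add: axis_def if_distrib[where f = "\<lambda>x. _ * x"] d cong: if_cong)
  have ax: "axis i (1::complex) $ j = (if j = i then 1 else 0)" for i j :: 7
    by (simp add: axis_def)
  note inv = G2_form_invariant[OF g]
  have a: "?t 1 * ?t 2 * ?t 6 = 1" and b: "?t 3 * ?t 6 * ?t 0 = 1" and c: "?t 5 * ?t 4 * ?t 0 = 1"
    using inv[of "axis 1 1" "axis 2 1" "axis 6 1"] inv[of "axis 3 1" "axis 6 1" "axis 0 1"]
      inv[of "axis 5 1" "axis 4 1" "axis 0 1"]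
    by (simp_all add: G2_form_explicit v ax)
  have "det g = ?t 0 * ?t 1 * ?t 2 * ?t 3 * ?t 4 * ?t 5 * ?t 6"
    by (subst det_diagonal) (simp_all add: d prod_7)
  also have "\<dots> = (?t 1 * ?t 2 * ?t 6) * (?t 5 * ?t 4 * ?t 0) * ?t 3" by (simp add: mult_ac)
  finally show 3: "?t 3 = 1" using g a c by (simp add: G2_def)
  have "?t 0 = ?t 0 * (?t 1 * ?t 2 * ?t 6)" by (simp add: a)
  also have "\<dots> = (?t 3 * ?t 6 * ?t 0) * (?t 1 * ?t 2)" by (simp add: 3 mult_ac)
  finally show "?t 0 = ?t 1 * ?t 2" by (simp add: b)
  show "?t 2 \<noteq> 0" using a by auto
qed

lemma diagonal_rows:
  assumes "t \<in> T_G2" "s \<in> T_SL3"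
  shows "(t ** g ** s) $ i $ j = t $ i $ i * g $ i $ j * s $ j $ j"
proof -
  have s: "s \<in> T_G2" using assms(2) by (simp add: T_SL3_def)
  have "(t ** h) $ i $ k = t $ i $ i * h $ i $ k" for h :: "complex^7^7" and k
  proof -
    have "(t ** h) $ i $ k = (\<Sum>l\<in>UNIV. if l = i then t $ i $ i * h $ i $ k else 0)"
      unfolding matrix_mult_entry
      by (intro sum.cong refl) (auto simp: T_G2_relations(1)[OF assms(1)])
    thus ?thesis by simp
  qed
  moreover have "(h ** s) $ k $ j = h $ k $ j * s $ j $ j" for h :: "complex^7^7" and k
  proof -
    have "(h ** s) $ k $ j = (\<Sum>l\<in>UNIV. if l = j then h $ k $ j * s $ j $ j else 0)"
      unfolding matrix_mult_entry
      by (intro sum.cong refl) (auto simp: T_G2_relations(1)[OF s])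
    thus ?thesis by simp
  qed
  ultimately show ?thesis by simp
qed

text \<open>The generators as extensional functions on \<open>G\<^sub>2\<close>.\<close>
definition gens :: "gen \<Rightarrow> complex^7^7 \<Rightarrow> complex"
  where "gens v = restrict (gen_fun v) G2"

lemma gens_degree:
  "has_degree (gens X_p1) omega1 varpi2"
  "has_degree (gens X_p2) omega2 (\<lambda>x. varpi1 x * varpi2 x)"
  "has_degree (gens X_q) omega1 varpi1"
  "has_degree (gens X_r) omega2 varpi2"
  "has_degree (gens X_s) omega1 (\<lambda>x. 1)"
  "has_degree (gens X_t) omega2 varpi1"
proof -
  have T: "T_SL3 \<subseteq> T_G2" by (auto simp: T_SL3_def)
  have G: "t ** g ** s \<in> G2" if "t \<in> T_G2" "s \<in> T_SL3" "g \<in> G2" for t g s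
    using that T by (auto simp: T_G2_def intro!: G2_mult)
  have w: "omega1 t = t $ 0 $ 0" "omega2 t = t $ 0 $ 0 * t $ 1 $ 1" "t $ 3 $ 3 = 1" if "t \<in> T_G2" for t
    using T_G2_relations(2-)[OF that]
    by (simp_all add: omega1_def omega2_def alpha1_def alpha2_def power2_eq_square power3_eq_cube)
  have p: "varpi2 s = s $ 0 $ 0" "varpi1 s = s $ 1 $ 1" "s $ 3 $ 3 = 1" if "s \<in> T_SL3" for s
    using T_G2_relations(2-)[of s] that T by (auto simp: varpi1_def varpi2_def)
  note defs = has_bidegree_def gens_def G diagonal_rows minor_def w p algebra_simps
  show "has_degree (gens X_p1) omega1 varpi2"
    "has_degree (gens X_p2) omega2 (\<lambda>x. varpi1 x * varpi2 x)"
    "has_degree (gens X_q) omega1 varpi1"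
    "has_degree (gens X_r) omega2 varpi2"
    "has_degree (gens X_s) omega1 (\<lambda>x. 1)"
    "has_degree (gens X_t) omega2 varpi1"
    by (simp_all add: defs)
qed

text \<open>The substitution of the generators for the variables.\<close>
definition eval_gens :: "gen cpoly \<Rightarrow> complex^7^7 \<Rightarrow> complex"
  where "eval_gens P = (\<lambda>g\<in>G2. eval_cpoly (\<lambda>v. gen_fun v g) P)"

lemma subst_gens: "subst_functions G2 gens = eval_gens"
  by (simp add: fun_eq_iff subst_functions_def eval_gens_def gens_def restrict_def)

text \<open>All relations between the generators are multiples of the exchange relation: by \<open>section1\<close> a relation
  vanishes on the part \<open>p\<^sub>1 p\<^sub>2 \<noteq> 0\<close> of the quadric.\<close>
lemma eval_gens_eq_iff: "eval_gens P = eval_gens Q \<longleftrightarrow> exchange_relation dvd P - Q"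
proof
  assume eq: "eval_gens P = eval_gens Q"
  have g: "eval_cpoly (\<lambda>v. gen_fun v g) P = eval_cpoly (\<lambda>v. gen_fun v g) Q" if "g \<in> G2" for g
    using fun_cong[OF eq, of g] that by (simp add: eval_gens_def)
  have "exchange_relation dvd (Var X_p1 * Var X_p2) * (P - Q)"
  proof (rule vanishing_on_quadric)
    fix y assume y: "on_quadric y"
    show "eval_cpoly y (Var X_p1 * Var X_p2 * (P - Q)) = 0"
    proof (cases "y X_p1 = 0 \<or> y X_p2 = 0")
      case False
      hence "(\<lambda>v. gen_fun v (section1 y)) = y"
        using section1_gen_fun[OF y] by blast
      moreover have "section1 y \<in> G2" using False by (simp add: section1_G2)
      ultimately have "eval_cpoly y P = eval_cpoly y Q" using g by metis
      thus ?thesis by (simp add: eval_cpoly_simps)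
    qed (auto simp: eval_cpoly_simps)
  qed
  hence "to_LP (Var X_p1 * Var X_p2) * to_LP (P - Q) = 0" by (simp add: to_LP_eq_0_iff flip: to_LP.mult)
  moreover have "to_LP (Var X_p1 * Var X_p2) \<noteq> 0"
    by (simp add: to_LP.mult to_LP_Var lp_gen_def lp_coeff_eq_0_iff Var_neq_0)
  ultimately show "exchange_relation dvd P - Q" by (simp add: to_LP_eq_0_iff)
next
  assume "exchange_relation dvd P - Q"
  thus "eval_gens P = eval_gens Q"
    using on_quadric_eval_cong[OF gen_fun_on_quadric] by (auto simp: eval_gens_def restrict_def)
qed

lemma eval_gens_range: "range eval_gens = carrier B_G2_SL3"
proof (intro equalityI subsetI)
  fix f assume "f \<in> range eval_gens"
  then obtain P where f: "f = eval_gens P" by blast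
  have "f (u ** g ** v) = f g" if uv: "u \<in> U_minus_G2" "v \<in> U_SL3" and g: "g \<in> G2" for u v g
  proof -
    have "gen_fun w (u ** g ** v) = gen_fun w g" for w
      by (cases w) (simp_all add: entry_invariant[OF uv] minor_invariant[OF uv])
    thus ?thesis using g uv by (simp add: f eval_gens_def G2_mult U_G2_subset)
  qed
  moreover have "f \<in> polynomial_on_G2"
  proof -
    obtain Q where "\<And>g. g \<in> G2 \<Longrightarrow> eval_cpoly (\<lambda>v. gen_fun v g) P = eval_cpoly (matrix_entries g) Q"
      using eval_gen_fun_polynomial[of P] unfolding polynomial_on_G2_def by blast
    thus ?thesis by (intro polynomial_on_G2I[of _ Q]) (simp add: f eval_gens_def)
  qed
  ultimately show "f \<in> carrier B_G2_SL3" by (simp add: B_carrier f eval_gens_def)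
next
  fix f assume f: "f \<in> carrier B_G2_SL3"
  then obtain P where P: "\<And>g. g \<in> G2 \<Longrightarrow> f g = eval_cpoly (\<lambda>v. gen_fun v g) P"
    using generation[OF f] by blast
  have "f = eval_gens P"
    using f by (intro ext) (auto simp: eval_gens_def P B_carrier extensional_def)
  thus "f \<in> range eval_gens" by blast
qed

lemma eval_gens_hom:
  "eval_gens P \<oplus>\<^bsub>B_G2_SL3\<^esub> eval_gens Q = eval_gens (P + Q)"
  "eval_gens P \<otimes>\<^bsub>B_G2_SL3\<^esub> eval_gens Q = eval_gens (P * Q)"
  "\<one>\<^bsub>B_G2_SL3\<^esub> = eval_gens 1" "\<zero>\<^bsub>B_G2_SL3\<^esub> = eval_gens 0"
  by (simp_all add: B_G2_SL3_def branching_algebra_def eval_gens_def restrict_def eval_cpoly_simps fun_eq_iff)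

text \<open>The axioms are inherited from the polynomial ring, of which the branching algebra is an image.\<close>
lemma B_ring: "ring B_G2_SL3"
proof -
  have inv: "\<exists>Q. eval_gens (P + Q) = eval_gens 0" for P
    by (rule exI[of _ "- P"]) simp
  show ?thesis
    by (intro ringI abelian_groupI monoidI; unfold eval_gens_range[symmetric])
      (auto simp: eval_gens_hom algebra_simps inv)
qed

lemma eval_gens_ring_hom: "ring_hom_ring ring_of_type_algebra B_G2_SL3 eval_gens"
proof (rule ring_hom_ringI)
  show "ring (ring_of_type_algebra :: gen cpoly ring)" by (rule ring_from_type_algebra)
qed (use eval_gens_range in \<open>auto simp: B_ring ring_of_type_algebra_def eval_gens_hom\<close>)

lemma PIdl_type_algebra:
  "PIdl\<^bsub>ring_of_type_algebra\<^esub> (a :: 'a::comm_ring_1) = {b. a dvd b}"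
  by (auto simp: cgenideal_def ring_of_type_algebra_def dvd_def mult.commute)

lemma eval_gens_kernel:
  "a_kernel ring_of_type_algebra B_G2_SL3 eval_gens = PIdl\<^bsub>ring_of_type_algebra\<^esub> exchange_relation"
  unfolding PIdl_type_algebra a_kernel_def'
  by (simp add: ring_of_type_algebra_def eval_gens_hom eval_gens_eq_iff)

theorem presentation:
  "(\<lambda>C. the_elem (eval_gens ` C)) \<in> ring_iso
     (ring_of_type_algebra Quot (PIdl\<^bsub>ring_of_type_algebra\<^esub> exchange_relation)) B_G2_SL3"
proof -
  have "eval_gens ` carrier ring_of_type_algebra = carrier B_G2_SL3"
    by (simp add: ring_of_type_algebra_def eval_gens_range)
  thus ?thesis
    using ring_hom_ring.FactRing_iso_set[OF eval_gens_ring_hom] by (simp add: eval_gens_kernel)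
qed

section \<open>The isomorphism with the upper Laurent phenomenon algebra\<close>

text \<open>The homomorphism \<open>to_LP\<close> on representatives; by \<open>eval_gens_eq_iff\<close> and \<open>to_LP_eq_0_iff\<close> the choice of
  the polynomial is irrelevant.\<close>
definition B_to_LP :: "(complex^7^7 \<Rightarrow> complex) \<Rightarrow> frozen cpoly poly fract"
  where "B_to_LP f = to_LP (SOME P. eval_gens P = f)"

lemma B_to_LP_eval_gens: "B_to_LP (eval_gens P) = to_LP P"
proof -
  have "eval_gens (SOME Q. eval_gens Q = eval_gens P) = eval_gens P"
    by (rule someI) (rule refl)
  hence "to_LP ((SOME Q. eval_gens Q = eval_gens P) - P) = 0"
    by (simp only: eval_gens_eq_iff to_LP_eq_0_iff)
  thus ?thesis by (simp add: B_to_LP_def to_LP.minus)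
qed

theorem B_to_LP_iso: "B_to_LP \<in> ring_iso B_G2_SL3 (upper_LP_algebra exchange_polynomial)"
proof (rule ring_iso_memI)
  show "bij_betw B_to_LP (carrier B_G2_SL3) (carrier (upper_LP_algebra exchange_polynomial))"
  proof (rule bij_betw_imageI)
    show "inj_on B_to_LP (carrier B_G2_SL3)"
      unfolding eval_gens_range[symmetric]
    proof (rule inj_onI, elim rangeE, clarify)
      fix P Q assume "B_to_LP (eval_gens P) = B_to_LP (eval_gens Q)"
      hence "to_LP (P - Q) = 0" by (simp add: B_to_LP_eval_gens to_LP.minus)
      thus "eval_gens P = eval_gens Q" by (simp only: eval_gens_eq_iff to_LP_eq_0_iff)
    qed
    show "B_to_LP ` carrier B_G2_SL3 = carrier (upper_LP_algebra exchange_polynomial)"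
      unfolding eval_gens_range[symmetric]
      by (simp add: image_image B_to_LP_eval_gens upper_LP_algebra_def to_LP_range)
  qed
qed (auto simp: B_to_LP_eval_gens eval_gens_hom upper_LP_algebra_def ring_of_type_algebra_def
      to_LP.add to_LP.mult to_LP.one to_LP_range[symmetric] simp flip: eval_gens_range)

lemma gens_eq_eval_gens: "gens v = eval_gens (Var v)"
  by (simp add: gens_def eval_gens_def eval_cpoly_simps)

theorem proposition7p10:
  shows "\<exists>p1 p2 q r s t :: complex^7^7 \<Rightarrow> complex.
    {p1, p2, q, r, s, t} \<subseteq> carrier B_G2_SL3 \<and>
    has_degree p1 omega1 varpi2 \<and>
    has_degree p2 omega2 (\<lambda>x. varpi1 x * varpi2 x) \<and>
    has_degree q omega1 varpi1 \<and>
    has_degree r omega2 varpi2 \<and>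
    has_degree s omega1 (\<lambda>x. 1) \<and>
    has_degree t omega2 varpi1 \<and>
    (\<lambda>C. the_elem (subst_functions G2
            (\<lambda>v. case v of X_p1 \<Rightarrow> p1 | X_p2 \<Rightarrow> p2 | X_q \<Rightarrow> q | X_r \<Rightarrow> r | X_s \<Rightarrow> s | X_t \<Rightarrow> t) ` C))
      \<in> ring_iso
          (ring_of_type_algebra Quot
             (PIdl\<^bsub>ring_of_type_algebra\<^esub>
                (Var X_q * Var X_r - Var X_p1 * Var X_t - Var X_p2 * Var X_s :: gen cpoly)))
          B_G2_SL3 \<and>
    Factorial_Ring.irreducible exchange_polynomial \<and>
    (\<exists>\<psi> \<in> ring_iso B_G2_SL3 (upper_LP_algebra exchange_polynomial).
       (\<forall>c. \<psi> (\<lambda>g\<in>G2. c) = lp_coeff (Const c)) \<and>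
       \<psi> p1 = lp_coeff (Var F_p1) \<and>
       \<psi> p2 = lp_coeff (Var F_p2) \<and>
       \<psi> s = lp_coeff (Var F_s) \<and>
       \<psi> t = lp_coeff (Var F_t) \<and>
       \<psi> q = lp_q \<and>
       \<psi> r = lp_q' exchange_polynomial)"
proof -
  have case_gens: "(\<lambda>v. case v of X_p1 \<Rightarrow> gens X_p1 | X_p2 \<Rightarrow> gens X_p2 | X_q \<Rightarrow> gens X_q
      | X_r \<Rightarrow> gens X_r | X_s \<Rightarrow> gens X_s | X_t \<Rightarrow> gens X_t) = gens"
    by (rule ext, rename_tac v, case_tac v) simp_all
  have in_B: "{gens X_p1, gens X_p2, gens X_q, gens X_r, gens X_s, gens X_t} \<subseteq> carrier B_G2_SL3"
    by (auto simp: gens_eq_eval_gens simp flip: eval_gens_range)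
  have "(\<lambda>g\<in>G2. c) = eval_gens (Const c)" for c
    by (simp add: eval_gens_def eval_cpoly_simps)
  hence "B_to_LP (\<lambda>g\<in>G2. c) = lp_coeff (Const c)" for c
    by (simp add: B_to_LP_eval_gens to_LP_Const)
  moreover have "B_to_LP (gens v) = lp_gen v" for v
    by (simp add: gens_eq_eval_gens B_to_LP_eval_gens to_LP_Var)
  ultimately have "\<exists>\<psi> \<in> ring_iso B_G2_SL3 (upper_LP_algebra exchange_polynomial).
       (\<forall>c. \<psi> (\<lambda>g\<in>G2. c) = lp_coeff (Const c)) \<and>
       \<psi> (gens X_p1) = lp_coeff (Var F_p1) \<and> \<psi> (gens X_p2) = lp_coeff (Var F_p2) \<and>
       \<psi> (gens X_s) = lp_coeff (Var F_s) \<and> \<psi> (gens X_t) = lp_coeff (Var F_t) \<and>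
       \<psi> (gens X_q) = lp_q \<and> \<psi> (gens X_r) = lp_q' exchange_polynomial"
    by (intro bexI[OF _ B_to_LP_iso]) (simp add: lp_gen_def)
  note iso = this
  show ?thesis
    by (rule exI[of _ "gens X_p1"], rule exI[of _ "gens X_p2"], rule exI[of _ "gens X_q"],
        rule exI[of _ "gens X_r"], rule exI[of _ "gens X_s"], rule exI[of _ "gens X_t"],
        unfold case_gens subst_gens,
        intro conjI in_B gens_degree presentation[unfolded exchange_relation_def] exchange_irreducible iso)
qed

end
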